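(* Let $G$ be a DAG with vertices $V$ and let $\mathrm{BN}_G^{\mathrm{eqb}}$ be the class of equicontinuous and bounded Bayesian networks induced by a tuple $(K,\omega,\mu)$ (as in the context). If there is at least one faithful model in $\mathrm{BN}_G^{\mathrm{eqb}}$, then the set of faithful Bayesian networks $\{m\in\mathrm{BN}_G^{\mathrm{eqb}}:D(m)\in F_G\}$ is open and dense in $(\mathrm{BN}_G^{\mathrm{eqb}},d_{TV}^\circ)$.
   Context: A DAG $G=(V,E)$ has a finite vertex set $V$ and no directed cycles; $\mathrm{pa}(v)=\{w: w\to v\in E\}$. The ancestors of $v$ are $v$ itself and all $w$ with a directed path from $w$ to $v$; an ancestor of a set $C$ is an ancestor of some element of $C$. A collider on a path is a vertex $v$ with $\cdots\to v\leftarrow\cdots$ on the path; other vertices of the path (including endpoints) are non-colliders. For (not necessarily disjoint) $A,B,C\subseteq V$, $A\perp^d_G B\mid C$ means that every path between some $a\in A$ and some $b\in B$ contains a collider that is not an ancestor of $C$, or a non-collider in $C$; for $a=b$ the trivial path $a$ counts as a path, blocked precisely when $a\in C$. $A\not\perp^d_G B\mid C$ is the negation. For each $v\in V$, $\mathcal X_v$ is a separable complete metric space with at least two points and its Borel $\sigma$-algebra; $\mathcal X_A=\prod_{v\in A}\mathcal X_v$ carries the Euclidean product metric $d(x,x')=(\sum_{v\in A}d_v(x_v,x_v')^2)^{1/2}$. $X_A\perp\!\!\!\perp_{\mathbb P}X_B\mid X_C$ means $\mathbb P(X_A\in E_A,X_B\in E_B\mid X_C)=\mathbb P(X_A\in E_A\mid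 X_C)\mathbb P(X_B\in E_B\mid X_C)$ a.s. for all Borel $E_A,E_B$. $M_G$ is the set of Borel probability measures $\mathbb P$ on $\mathcal X_V$ with $A\perp^d_G B\mid C\Rightarrow X_A\perp\!\!\!\perp_{\mathbb P}X_B\mid X_C$ for all $A,B,C\subseteq V$; $F_G$ is the set of $\mathbb P\in M_G$ such that $A\not\perp^d_G B\mid C$ implies that $X_A\perp\!\!\!\perp_{\mathbb P}X_B\mid X_C$ fails, for all $A,B,C\subseteq V$. $\mathrm{BN}_G$ is the set of tuples $(\mathbb P(X_v\mid X_{\mathrm{pa}(v)}))_{v\in V}$ of Markov kernels $\mathcal X_{\mathrm{pa}(v)}\to\mathcal P(\mathcal X_v)$; the distribution map $D:\mathrm{BN}_G\to M_G$ sends such a tuple to the product of kernels $\bigotimes_{v}\mathbb P(X_v\mid X_{\mathrm{pa}(v)})$. A model $m$ is faithful if $D(m)\in F_G$. With $d_{TV}(\mathbb P,\mathbb Q)=\sup_E|\mathbb P(E)-\mathbb Q(E)|$ over Borel $E$, $d_{TV}^\circ(m,m')=\sum_{v\in V}\sup_{x_{\mathrm{pa}(v)}}d_{TV}(\mathbb P_m(X_v\mid x_{\mathrm{pa}(v)}),\mathbb P_{m'}(X_v\mid x_{\mathrm{pa}(v)}))$. A modulus of continuity is a nonzero function $\omega:[0,\infty)\to[0,\infty)$ with $\lim_{t\downarrow0}\omega(t)=\omega(0)=0$, throughout assumed concave; $f$ admits the modulus $\omega$ if $|f(x)-f(x')|\le\omega(d(x,x'))$ for all $x,x'$. Given $K>0$,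 a modulus $\omega$ and locally finite measures $\mu_v$ on $\mathcal X_v$ ($v\in V$), with $\mu=\bigotimes_v\mu_v$, the class $\mathrm{BN}_G^{\mathrm{eqb}}\subseteq\mathrm{BN}_G$ induced by $(K,\omega,\mu)$ consists of the Bayesian networks such that for each $v$ the kernel has a conditional density $(x_v,x_{\mathrm{pa}(v)})\mapsto p(x_v\mid x_{\mathrm{pa}(v)})$ with respect to $\mu_v$ that is bounded by $K$ and admits the modulus $\omega$ on $\mathcal X_v\times\mathcal X_{\mathrm{pa}(v)}$. *)

theory Defs
  imports "HOL-Probability.Probability"
begin

section \<open>DAGs and d-separation\<close>

text \<open>A DAG is given by a finite vertex set \<open>V\<close> and an acyclic edge relation \<open>E \<subseteq> V \<times> V\<close>,
  where \<open>(w, v) \<in> E\<close> is the edge from \<open>w\<close> to \<open>v\<close>.\<close>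

definition dag :: "'v set \<Rightarrow> ('v \<times> 'v) set \<Rightarrow> bool" where
  "dag V E \<longleftrightarrow> finite V \<and> E \<subseteq> V \<times> V \<and> acyclic E"

definition parents :: "('v \<times> 'v) set \<Rightarrow> 'v \<Rightarrow> 'v set" where
  "parents E v = {w. (w, v) \<in> E}"

definition ancestors :: "('v \<times> 'v) set \<Rightarrow> 'v set \<Rightarrow> 'v set" where
  "ancestors E C = {w. \<exists>c\<in>C. (w, c) \<in> E\<^sup>*}"

text \<open>Paths have no repeated vertices. In a DAG two vertices are joined by at most one edge, so a
  path is determined by its vertices; the only path from \<open>a\<close> to \<open>a\<close> is the trivial path \<open>[a]\<close>.\<close>

definition is_path :: "'v set \<Rightarrow> ('v \<times> 'v) set \<Rightarrow> 'v list \<Rightarrow> bool" where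
  "is_path V E p \<longleftrightarrow> p \<noteq> [] \<and> distinct p \<and> set p \<subseteq> V \<and>
     (\<forall>i. Suc i < length p \<longrightarrow> (p ! i, p ! Suc i) \<in> E \<or> (p ! Suc i, p ! i) \<in> E)"

definition collider :: "('v \<times> 'v) set \<Rightarrow> 'v list \<Rightarrow> nat \<Rightarrow> bool" where
  "collider E p i \<longleftrightarrow> 0 < i \<and> Suc i < length p \<and>
     (p ! (i - 1), p ! i) \<in> E \<and> (p ! Suc i, p ! i) \<in> E"

definition blocked :: "('v \<times> 'v) set \<Rightarrow> 'v set \<Rightarrow> 'v list \<Rightarrow> bool" where
  "blocked E C p \<longleftrightarrow>
     (\<exists>i<length p. (collider E p i \<and> p ! i \<notin> ancestors E C) \<or> (\<not> collider E p i \<and> p ! i \<in> C))"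

definition d_separated :: "'v set \<Rightarrow> ('v \<times> 'v) set \<Rightarrow> 'v set \<Rightarrow> 'v set \<Rightarrow> 'v set \<Rightarrow> bool" where
  "d_separated V E A B C \<longleftrightarrow>
     (\<forall>p. is_path V E p \<and> hd p \<in> A \<and> last p \<in> B \<longrightarrow> blocked E C p)"


section \<open>Polish coordinate spaces and their products\<close>

text \<open>The coordinate space of \<open>v\<close> is the carrier \<open>X v\<close> with metric \<open>d v\<close>. All carriers live in one
  ambient type \<open>'a\<close> but are otherwise unrelated.\<close>

definition polish_nontrivial :: "'a set \<Rightarrow> ('a \<Rightarrow> 'a \<Rightarrow> real) \<Rightarrow> bool" where
  "polish_nontrivial M \<delta> \<longleftrightarrow> Metric_space M \<delta> \<and> Metric_space.mcomplete M \<delta> \<and>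
     separable_space (Metric_space.mtopology M \<delta>) \<and> (\<exists>x\<in>M. \<exists>y\<in>M. x \<noteq> y)"

definition metric_borel :: "'a set \<Rightarrow> ('a \<Rightarrow> 'a \<Rightarrow> real) \<Rightarrow> 'a measure" where
  "metric_borel M \<delta> = sigma M {U. openin (Metric_space.mtopology M \<delta>) U}"

definition euclid_dist ::
  "('v \<Rightarrow> 'a \<Rightarrow> 'a \<Rightarrow> real) \<Rightarrow> 'v set \<Rightarrow> ('v \<Rightarrow> 'a) \<Rightarrow> ('v \<Rightarrow> 'a) \<Rightarrow> real" where
  "euclid_dist d A x x' = sqrt (\<Sum>v\<in>A. (d v (x v) (x' v))\<^sup>2)"

text \<open>The measurable space \<open>\<Prod>\<^sub>v\<^sub>\<in>\<^sub>A X\<^sub>v\<close>. For finite \<open>A\<close> and Polish factors, its product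
  \<open>\<sigma>\<close>-algebra is the Borel \<open>\<sigma>\<close>-algebra of the Euclidean product metric; see
  \<open>sets_coord_space\<close> below.\<close>

definition coord_space ::
  "('v \<Rightarrow> 'a set) \<Rightarrow> ('v \<Rightarrow> 'a \<Rightarrow> 'a \<Rightarrow> real) \<Rightarrow> 'v set \<Rightarrow> ('v \<Rightarrow> 'a) measure" where
  "coord_space X d A = PiM A (\<lambda>v. metric_borel (X v) (d v))"

lemma space_metric_borel [simp]: "space (metric_borel M \<delta>) = M"
  by (simp add: metric_borel_def space_measure_of_conv)

lemma space_coord_space: "space (coord_space X d A) = PiE A X"
  by (simp add: coord_space_def space_PiM)

lemma sets_metric_borel:
  assumes "Metric_space M \<delta>"
  shows "sets (metric_borel M \<delta>) = sigma_sets M {U. openin (Metric_space.mtopology M \<delta>) U}"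
proof -
  interpret Metric_space M \<delta> by fact
  show ?thesis
    unfolding metric_borel_def by (subst sets_measure_of) (auto dest!: openin_subset)
qed

lemma open_in_metric_borel:
  "\<lbrakk>Metric_space M \<delta>; openin (Metric_space.mtopology M \<delta>) U\<rbrakk> \<Longrightarrow> U \<in> sets (metric_borel M \<delta>)"
  by (auto simp: sets_metric_borel)

lemma Metric_space_euclid_dist:
  assumes "finite A" "\<And>v. v \<in> A \<Longrightarrow> Metric_space (X v) (d v)"
  shows "Metric_space (PiE A X) (euclid_dist d A)"
proof
  fix x y z
  show "0 \<le> euclid_dist d A x y"
    by (simp add: euclid_dist_def sum_nonneg)
  show "euclid_dist d A x y = euclid_dist d A y x"
    unfolding euclid_dist_def 
    by (intro arg_cong[of _ _ sqrt] sum.cong refl arg_cong[of _ _ "\<lambda>t. t\<^sup>2"]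
        Metric_space.commute[OF assms(2)])
  assume x: "x \<in> PiE A X" and y: "y \<in> PiE A X"
  have "euclid_dist d A x y = 0 \<longleftrightarrow> (\<forall>v\<in>A. d v (x v) (y v) = 0)"
    unfolding euclid_dist_def using assms(1) by (simp add: sum_nonneg_eq_0_iff)
  also have "\<dots> \<longleftrightarrow> (\<forall>v\<in>A. x v = y v)"
    using x y assms(2) by (intro ball_cong refl Metric_space.zero) auto
  also have "\<dots> \<longleftrightarrow> x = y"
    using x y by (metis PiE_ext)
  finally show "euclid_dist d A x y = 0 \<longleftrightarrow> x = y" .
  assume z: "z \<in> PiE A X"
  have "euclid_dist d A x z \<le> L2_set (\<lambda>v. d v (x v) (y v) + d v (y v) (z v)) A"
    unfolding euclid_dist_def L2_set_def[symmetric]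
  proof (rule L2_set_mono)
    fix v assume v: "v \<in> A"
    interpret Mv: Metric_space "X v" "d v" by (rule assms(2)[OF v])
    show "d v (x v) (z v) \<le> d v (x v) (y v) + d v (y v) (z v)"
      using x y z v by (intro Mv.triangle) auto
    show "0 \<le> d v (x v) (z v)" by simp
  qed
  also have "\<dots> \<le> euclid_dist d A x y + euclid_dist d A y z"
    unfolding euclid_dist_def L2_set_def[symmetric] by (rule L2_set_triangle_ineq)
  finally show "euclid_dist d A x z \<le> euclid_dist d A x y + euclid_dist d A y z" .
qed

lemma euclid_dist_coord_le:
  assumes "finite A" "v \<in> A"
  shows "d v (x v) (y v) \<le> euclid_dist d A x y"
proof -
  have "\<bar>d v (x v) (y v)\<bar> \<le> euclid_dist d A x y"
    unfolding euclid_dist_def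
    using member_le_sum[of v A "\<lambda>v. (d v (x v) (y v))\<^sup>2"] assms
    by (intro real_le_rsqrt) auto
  then show ?thesis by linarith
qed

lemma euclid_dist_le_sum:
  assumes "\<And>v. v \<in> A \<Longrightarrow> 0 \<le> d v (x v) (y v)"
  shows "euclid_dist d A x y \<le> (\<Sum>v\<in>A. d v (x v) (y v))"
  unfolding euclid_dist_def L2_set_def[symmetric]
  using assms by (intro L2_set_le_sum) auto

lemma sets_coord_space:
  assumes A: "finite A" and P: "\<And>v. v \<in> A \<Longrightarrow> polish_nontrivial (X v) (d v)"
  shows "sets (coord_space X d A) = sets (metric_borel (PiE A X) (euclid_dist d A))"
proof
  have M: "Metric_space (X v) (d v)" if "v \<in> A" for v
    using P[OF that] by (simp add: polish_nontrivial_def)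
  interpret N: Metric_space "PiE A X" "euclid_dist d A"
    by (rule Metric_space_euclid_dist[OF A M])
  show "sets (coord_space X d A) \<subseteq> sets (metric_borel (PiE A X) (euclid_dist d A))"
    unfolding coord_space_def
  proof (rule sets_PiM_in_sets)
    fix v S assume v: "v \<in> A" and S: "S \<in> sets (metric_borel (X v) (d v))"
    interpret Mv: Metric_space "X v" "d v" by (rule M[OF v])
    have "(\<lambda>x. x v) \<in> metric_borel (PiE A X) (euclid_dist d A) \<rightarrow>\<^sub>M metric_borel (X v) (d v)"
      unfolding metric_borel_def[of "X v"]
    proof (rule measurable_measure_of)
      show "{U. openin Mv.mtopology U} \<subseteq> Pow (X v)"
        using openin_subset by force
      show "(\<lambda>x. x v) \<in> space (metric_borel (PiE A X) (euclid_dist d A)) \<rightarrow> X v"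
        using v by auto
      fix U assume "U \<in> {U. openin Mv.mtopology U}"
      then have U: "\<And>a. a \<in> U \<Longrightarrow> \<exists>r>0. Mv.mball a r \<subseteq> U" and "U \<subseteq> X v"
        by (auto simp: Mv.openin_mtopology)
      have "openin N.mtopology ((\<lambda>x. x v) -` U \<inter> PiE A X)"
        unfolding N.openin_mtopology
      proof safe
        fix x assume "x v \<in> U" and x: "x \<in> PiE A X"
        then obtain r where r: "r > 0" "Mv.mball (x v) r \<subseteq> U" using U by blast
        have "N.mball x r \<subseteq> (\<lambda>x. x v) -` U \<inter> PiE A X"
        proof
          fix y assume y: "y \<in> N.mball x r"
          then have "y v \<in> Mv.mball (x v) r"
            using euclid_dist_coord_le[OF A v, of d x y] v by (auto simp: PiE_iff)
          then show "y \<in> (\<lambda>x. x v) -` U \<inter> PiE A X" using r y by auto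
        qed
        then show "\<exists>r>0. N.mball x r \<subseteq> (\<lambda>x. x v) -` U \<inter> PiE A X" using r by blast
      qed
      then show "(\<lambda>x. x v) -` U \<inter> space (metric_borel (PiE A X) (euclid_dist d A))
          \<in> sets (metric_borel (PiE A X) (euclid_dist d A))"
        by (simp add: open_in_metric_borel N.Metric_space_axioms)
    qed
    from measurable_sets[OF this S]
    have "(\<lambda>x. x v) -` S \<inter> space (metric_borel (PiE A X) (euclid_dist d A))
        \<in> sets (metric_borel (PiE A X) (euclid_dist d A))" .
    also have "(\<lambda>x. x v) -` S \<inter> space (metric_borel (PiE A X) (euclid_dist d A)) =
        {x \<in> space (metric_borel (PiE A X) (euclid_dist d A)). x v \<in> S}"
      by blast
    finally show "{x \<in> space (metric_borel (PiE A X) (euclid_dist d A)). x v \<in> S}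
        \<in> sets (metric_borel (PiE A X) (euclid_dist d A))"
      .
  qed simp
  have "\<exists>D. countable D \<and> D \<subseteq> X v \<and> Metric_space.mtopology (X v) (d v) closure_of D = X v"
    if v: "v \<in> A" for v
  proof -
    interpret Mv: Metric_space "X v" "d v" by (rule M[OF v])
    have "separable_space Mv.mtopology" using P[OF v] by (simp add: polish_nontrivial_def)
    then show ?thesis unfolding separable_space_def Mv.topspace_mtopology .
  qed
  then have "\<forall>v\<in>A. \<exists>D. countable D \<and> D \<subseteq> X v \<and>
      Metric_space.mtopology (X v) (d v) closure_of D = X v" by blast
  from bchoice[OF this] obtain D where D: "\<forall>v\<in>A. countable (D v) \<and> D v \<subseteq> X v \<and>
      Metric_space.mtopology (X v) (d v) closure_of (D v) = X v" ..
  define box where "box = (\<lambda>c q. PiE A (\<lambda>v. Metric_space.mball (X v) (d v) (c v) q))"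
  have box_sets: "box c q \<in> sets (coord_space X d A)" for c q
    unfolding box_def coord_space_def
    by (intro sets_PiM_I_finite A open_in_metric_borel M Metric_space.openin_mball)
  have "U \<in> sets (coord_space X d A)" if U: "openin N.mtopology U" for U
  proof -
    define I where "I = {cq \<in> PiE A D \<times> \<rat>. box (fst cq) (snd cq) \<subseteq> U}"
    have "countable I"
    proof (rule countable_subset)
      show "I \<subseteq> PiE A D \<times> \<rat>" by (auto simp: I_def)
      have "countable (PiE A D)" using A D by (intro countable_PiE) auto
      then show "countable (PiE A D \<times> (\<rat> :: real set))" by (intro countable_SIGMA countable_rat)
    qed
    moreover have "U = (\<Union>cq\<in>I. box (fst cq) (snd cq))"
    proof
      show "(\<Union>cq\<in>I. box (fst cq) (snd cq)) \<subseteq> U" by (auto simp: I_def)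
      show "U \<subseteq> (\<Union>cq\<in>I. box (fst cq) (snd cq))"
      proof
        fix x assume x: "x \<in> U"
        then have xX: "x \<in> PiE A X" using U unfolding N.openin_mtopology by blast
        obtain r where r: "r > 0" "N.mball x r \<subseteq> U"
          using U x unfolding N.openin_mtopology by blast
        have "0 < r / (2 * (real (card A) + 1))" using r by simp
        then obtain q where q: "q \<in> \<rat>" "0 < q" "q < r / (2 * (real (card A) + 1))"
          using Rats_dense_in_real by blast
        have "\<exists>c\<in>D v. c \<in> X v \<and> d v (x v) c < q" if v: "v \<in> A" for v
        proof -
          interpret Mv: Metric_space "X v" "d v" by (rule M[OF v])
          have "x v \<in> Mv.mtopology closure_of (D v)" using D v xX by auto
          then show ?thesis using q unfolding Mv.metric_closure_of by auto
        qed
        then have "\<forall>v\<in>A. \<exists>c. c \<in> D v \<and> c \<in> X v \<and> d v (x v) c < q" by blast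
        from bchoice[OF this] obtain c0
          where c0: "\<forall>v\<in>A. c0 v \<in> D v \<and> c0 v \<in> X v \<and> d v (x v) (c0 v) < q" ..
        define c where "c = restrict c0 A"
        have c: "c \<in> PiE A D" "\<And>v. v \<in> A \<Longrightarrow> c v \<in> X v \<and> d v (x v) (c v) < q"
          using c0 by (auto simp: c_def)
        have "x \<in> box c q"
          unfolding box_def
        proof (rule PiE_I)
          fix v assume v: "v \<in> A"
          interpret Mv: Metric_space "X v" "d v" by (rule M[OF v])
          show "x v \<in> Mv.mball (c v) q"
            using c(2)[OF v] xX v by (auto simp: Mv.commute)
        qed (use xX in auto)
        moreover have "box c q \<subseteq> U"
        proof
          fix y assume y: "y \<in> box c q"
          have yv: "y v \<in> X v \<and> d v (c v) (y v) < q" if "v \<in> A" for v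
          proof -
            interpret Mv: Metric_space "X v" "d v" by (rule M[OF that])
            have "y v \<in> Mv.mball (c v) q"
              using y that by (auto simp: box_def PiE_iff)
            then show ?thesis by simp
          qed
          then have yX: "y \<in> PiE A X" using y by (auto simp: box_def PiE_iff)
          have "d v (x v) (y v) \<le> 2 * q" if v: "v \<in> A" for v
            using Metric_space.triangle[OF M[OF v], of "x v" "c v" "y v"] yv[OF v] c(2)[OF v] xX v
            by (auto simp: PiE_iff)
          then have "(\<Sum>v\<in>A. d v (x v) (y v)) \<le> real (card A) * (2 * q)"
            by (rule sum_bounded_above)
          moreover have "euclid_dist d A x y \<le> (\<Sum>v\<in>A. d v (x v) (y v))"
            by (intro euclid_dist_le_sum Metric_space.nonneg[OF M])
          moreover have "real (card A) * (2 * q) < r"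
          proof -
            have "real (card A) * (2 * q) \<le> q * (2 * (real (card A) + 1))"
              using q by (simp add: algebra_simps)
            also have "\<dots> < r" using q by (simp add: pos_less_divide_eq)
            finally show ?thesis .
          qed
          ultimately have "y \<in> N.mball x r" using xX yX by simp
          then show "y \<in> U" using r by blast
        qed
        ultimately show "x \<in> (\<Union>cq\<in>I. box (fst cq) (snd cq))" using c(1) q(1) by (intro UN_I[of "(c, q)"]) (simp_all add: I_def)
      qed
    qed
    ultimately show ?thesis by (simp add: sets.countable_UN'' box_sets)
  qed
  then show "sets (metric_borel (PiE A X) (euclid_dist d A)) \<subseteq> sets (coord_space X d A)"
    unfolding sets_metric_borel[OF N.Metric_space_axioms]
    by (intro sets.sigma_sets_subset[of _ "coord_space X d A", unfolded space_coord_space] subsetI)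
      (rule \<open>\<And>U. openin N.mtopology U \<Longrightarrow> U \<in> sets (coord_space X d A)\<close>, simp)
qed


section \<open>Markov and faithful distributions\<close>

definition coord_event :: "('v \<Rightarrow> 'a) measure \<Rightarrow> 'v set \<Rightarrow> ('v \<Rightarrow> 'a) set \<Rightarrow> ('v \<Rightarrow> 'a) set" where
  "coord_event P A S = {x \<in> space P. restrict x A \<in> S}"

text \<open>The conditional probability of \<open>S\<close> given \<open>X\<^sub>C\<close>, as a function on the sample space.\<close>

definition cond_prob_given ::
  "('v \<Rightarrow> 'a set) \<Rightarrow> ('v \<Rightarrow> 'a \<Rightarrow> 'a \<Rightarrow> real) \<Rightarrow> ('v \<Rightarrow> 'a) measure \<Rightarrow> 'v set \<Rightarrow> ('v \<Rightarrow> 'a) set \<Rightarrow>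
    ('v \<Rightarrow> 'a) \<Rightarrow> real" where
  "cond_prob_given X d P C S =
     real_cond_exp P (vimage_algebra (space P) (\<lambda>x. restrict x C) (coord_space X d C)) (indicator S)"

definition cond_indep ::
  "('v \<Rightarrow> 'a set) \<Rightarrow> ('v \<Rightarrow> 'a \<Rightarrow> 'a \<Rightarrow> real) \<Rightarrow> ('v \<Rightarrow> 'a) measure \<Rightarrow>
    'v set \<Rightarrow> 'v set \<Rightarrow> 'v set \<Rightarrow> bool" where
  "cond_indep X d P A B C \<longleftrightarrow>
     (\<forall>S\<in>sets (coord_space X d A). \<forall>T\<in>sets (coord_space X d B). AE x in P.
        cond_prob_given X d P C (coord_event P A S \<inter> coord_event P B T) x =
        cond_prob_given X d P C (coord_event P A S) x * cond_prob_given X d P C (coord_event P B T) x)"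

definition markov_dists ::
  "'v set \<Rightarrow> ('v \<times> 'v) set \<Rightarrow> ('v \<Rightarrow> 'a set) \<Rightarrow> ('v \<Rightarrow> 'a \<Rightarrow> 'a \<Rightarrow> real) \<Rightarrow> ('v \<Rightarrow> 'a) measure set"
  where
  "markov_dists V E X d = {P. prob_space P \<and> sets P = sets (coord_space X d V) \<and>
     (\<forall>A B C. A \<subseteq> V \<and> B \<subseteq> V \<and> C \<subseteq> V \<and> d_separated V E A B C \<longrightarrow> cond_indep X d P A B C)}"

definition faithful_dists ::
  "'v set \<Rightarrow> ('v \<times> 'v) set \<Rightarrow> ('v \<Rightarrow> 'a set) \<Rightarrow> ('v \<Rightarrow> 'a \<Rightarrow> 'a \<Rightarrow> real) \<Rightarrow> ('v \<Rightarrow> 'a) measure set"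
  where
  "faithful_dists V E X d = {P \<in> markov_dists V E X d.
     \<forall>A B C. A \<subseteq> V \<and> B \<subseteq> V \<and> C \<subseteq> V \<and> \<not> d_separated V E A B C \<longrightarrow> \<not> cond_indep X d P A B C}"


section \<open>Bayesian networks\<close>

text \<open>A network assigns to each \<open>v \<in> V\<close> a Markov kernel from \<open>\<Prod>\<^sub>w\<^sub>\<in>\<^sub>p\<^sub>a\<^sub>(\<^sub>v\<^sub>) X\<^sub>w\<close> to \<open>X\<^sub>v\<close>. Kernels and
  families of kernels are extensional, so that a network is determined by its values on the
  relevant domains.\<close>

definition bayes_nets ::
  "'v set \<Rightarrow> ('v \<times> 'v) set \<Rightarrow> ('v \<Rightarrow> 'a set) \<Rightarrow> ('v \<Rightarrow> 'a \<Rightarrow> 'a \<Rightarrow> real) \<Rightarrow>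
    ('v \<Rightarrow> ('v \<Rightarrow> 'a) \<Rightarrow> 'a measure) set" where
  "bayes_nets V E X d = (\<Pi>\<^sub>E v\<in>V.
     (coord_space X d (parents E v) \<rightarrow>\<^sub>M prob_algebra (metric_borel (X v) (d v)))
       \<inter> extensional (PiE (parents E v) X))"

text \<open>The product of the kernels of the vertices in a list in reverse topological order (a vertex
  precedes its parents): sample \<open>x\<close> from the product for the tail, then sample the coordinate \<open>v\<close>
  from the kernel of \<open>v\<close> at the parent coordinates of \<open>x\<close>.\<close>

primrec kernel_product ::
  "('v \<times> 'v) set \<Rightarrow> ('v \<Rightarrow> 'a set) \<Rightarrow> ('v \<Rightarrow> 'a \<Rightarrow> 'a \<Rightarrow> real) \<Rightarrow>
    ('v \<Rightarrow> ('v \<Rightarrow> 'a) \<Rightarrow> 'a measure) \<Rightarrow> 'v list \<Rightarrow> ('v \<Rightarrow> 'a) measure" where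
  "kernel_product E X d m [] = return (coord_space X d {}) (\<lambda>_. undefined)"
| "kernel_product E X d m (v # vs) = kernel_product E X d m vs \<bind> (\<lambda>x.
     distr (m v (restrict x (parents E v))) (coord_space X d (set (v # vs))) (\<lambda>a. x(v := a)))"

primrec rev_topological :: "('v \<times> 'v) set \<Rightarrow> 'v list \<Rightarrow> bool" where
  "rev_topological E [] \<longleftrightarrow> True"
| "rev_topological E (v # vs) \<longleftrightarrow> v \<notin> set vs \<and> parents E v \<subseteq> set vs \<and> rev_topological E vs"

text \<open>By Fubini's theorem the product does not depend on the choice of the order.\<close>

definition dist_map ::
  "'v set \<Rightarrow> ('v \<times> 'v) set \<Rightarrow> ('v \<Rightarrow> 'a set) \<Rightarrow> ('v \<Rightarrow> 'a \<Rightarrow> 'a \<Rightarrow> real) \<Rightarrow>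
    ('v \<Rightarrow> ('v \<Rightarrow> 'a) \<Rightarrow> 'a measure) \<Rightarrow> ('v \<Rightarrow> 'a) measure" where
  "dist_map V E X d m = kernel_product E X d m (SOME vs. set vs = V \<and> rev_topological E vs)"

definition tv_dist :: "'b measure \<Rightarrow> 'b measure \<Rightarrow> real" where
  "tv_dist P Q = (SUP S\<in>sets P. \<bar>measure P S - measure Q S\<bar>)"

text \<open>The value outside \<open>bayes_nets\<close> is irrelevant; it is fixed because the library's metric spaces
  require a distance that is non-negative and symmetric on the whole type.\<close>

definition tv_circ ::
  "'v set \<Rightarrow> ('v \<times> 'v) set \<Rightarrow> ('v \<Rightarrow> 'a set) \<Rightarrow> ('v \<Rightarrow> 'a \<Rightarrow> 'a \<Rightarrow> real) \<Rightarrow>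
    ('v \<Rightarrow> ('v \<Rightarrow> 'a) \<Rightarrow> 'a measure) \<Rightarrow> ('v \<Rightarrow> ('v \<Rightarrow> 'a) \<Rightarrow> 'a measure) \<Rightarrow> real" where
  "tv_circ V E X d m m' = (if m \<in> bayes_nets V E X d \<and> m' \<in> bayes_nets V E X d
     then (\<Sum>v\<in>V. SUP y\<in>PiE (parents E v) X. tv_dist (m v y) (m' v y)) else 0)"


section \<open>Equicontinuous and bounded Bayesian networks\<close>

definition concave_modulus :: "(real \<Rightarrow> real) \<Rightarrow> bool" where
  "concave_modulus \<omega> \<longleftrightarrow> (\<forall>t\<ge>0. 0 \<le> \<omega> t) \<and> (\<exists>t\<ge>0. \<omega> t \<noteq> 0) \<and> \<omega> 0 = 0 \<and>
     (\<omega> \<longlongrightarrow> 0) (at_right 0) \<and> concave_on {0..} \<omega>"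

definition locally_finite_measure :: "'a set \<Rightarrow> ('a \<Rightarrow> 'a \<Rightarrow> real) \<Rightarrow> 'a measure \<Rightarrow> bool" where
  "locally_finite_measure M \<delta> \<nu> \<longleftrightarrow> sets \<nu> = sets (metric_borel M \<delta>) \<and>
     (\<forall>x\<in>M. \<exists>U. openin (Metric_space.mtopology M \<delta>) U \<and> x \<in> U \<and> emeasure \<nu> U < \<infinity>)"

definition eqb_nets ::
  "'v set \<Rightarrow> ('v \<times> 'v) set \<Rightarrow> ('v \<Rightarrow> 'a set) \<Rightarrow> ('v \<Rightarrow> 'a \<Rightarrow> 'a \<Rightarrow> real) \<Rightarrow>
    real \<Rightarrow> (real \<Rightarrow> real) \<Rightarrow> ('v \<Rightarrow> 'a measure) \<Rightarrow> ('v \<Rightarrow> ('v \<Rightarrow> 'a) \<Rightarrow> 'a measure) set" where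
  "eqb_nets V E X d K \<omega> \<mu> = {m \<in> bayes_nets V E X d. \<forall>v\<in>V. \<exists>p.
     (\<forall>y\<in>PiE (parents E v) X. m v y = density (\<mu> v) (\<lambda>x. ennreal (p x y))) \<and>
     (\<forall>x\<in>X v. \<forall>y\<in>PiE (parents E v) X. 0 \<le> p x y \<and> p x y \<le> K) \<and>
     (\<forall>x\<in>X v. \<forall>x'\<in>X v. \<forall>y\<in>PiE (parents E v) X. \<forall>y'\<in>PiE (parents E v) X.
        \<bar>p x y - p x' y'\<bar> \<le> \<omega> (prod_dist (d v) (euclid_dist d (parents E v)) (x, y) (x', y')))}"


section \<open>The metric space of Bayesian networks\<close>

lemma tv_dist_props:
  assumes "prob_space P" "prob_space Q" "sets P = sets Q"
  shows tv_dist_upper: "S \<in> sets P \<Longrightarrow> \<bar>measure P S - measure Q S\<bar> \<le> tv_dist P Q"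
    and tv_dist_nonneg: "0 \<le> tv_dist P Q"
    and tv_dist_le_1: "tv_dist P Q \<le> 1"
    and tv_dist_eq_0: "tv_dist P Q = 0 \<longleftrightarrow> P = Q"
proof -
  interpret P: prob_space P by fact
  interpret Q: prob_space Q by fact
  have le1: "\<bar>measure P S - measure Q S\<bar> \<le> 1" for S
    using P.prob_le_1[of S] Q.prob_le_1[of S] measure_nonneg[of P S] measure_nonneg[of Q S]
    by linarith
  have bdd: "bdd_above ((\<lambda>S. \<bar>measure P S - measure Q S\<bar>) ` sets P)"
    using le1 by (intro bdd_aboveI[of _ 1]) auto
  show up: "\<bar>measure P S - measure Q S\<bar> \<le> tv_dist P Q" if "S \<in> sets P" for S
    unfolding tv_dist_def by (rule cSUP_upper[OF that bdd])
  show "0 \<le> tv_dist P Q" using up[of "{}"] by simp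
  show "tv_dist P Q \<le> 1" unfolding tv_dist_def using le1 by (intro cSUP_least) auto
  show "tv_dist P Q = 0 \<longleftrightarrow> P = Q"
  proof
    assume "tv_dist P Q = 0"
    then show "P = Q" using up assms(3)
      by (intro measure_eqI) (auto simp: P.emeasure_eq_measure Q.emeasure_eq_measure)
  next
    assume "P = Q"
    moreover have "(\<lambda>S. 0 :: real) ` sets Q = {0}" using sets.top[of Q] by blast
    ultimately show "tv_dist P Q = 0" by (simp add: tv_dist_def)
  qed
qed

lemma tv_dist_commute: "sets P = sets Q \<Longrightarrow> tv_dist P Q = tv_dist Q P"
  by (simp add: tv_dist_def abs_minus_commute)

lemma tv_dist_triangle:
  assumes "prob_space P" "prob_space Q" "prob_space R" "sets P = sets Q" "sets Q = sets R"
  shows "tv_dist P R \<le> tv_dist P Q + tv_dist Q R"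
  unfolding tv_dist_def[of P R]
proof (rule cSUP_least)
  fix S assume "S \<in> sets P"
  then show "\<bar>measure P S - measure R S\<bar> \<le> tv_dist P Q + tv_dist Q R"
    using tv_dist_upper[of P Q S] tv_dist_upper[of Q R S] assms by auto
qed auto

lemma bayes_nets_kernel:
  assumes "m \<in> bayes_nets V E X d" "v \<in> V" "y \<in> PiE (parents E v) X"
  shows "prob_space (m v y)" "sets (m v y) = sets (metric_borel (X v) (d v))"
proof -
  have "m v \<in> coord_space X d (parents E v) \<rightarrow>\<^sub>M prob_algebra (metric_borel (X v) (d v))"
    using assms(1,2) by (auto simp: bayes_nets_def PiE_iff)
  then have "m v y \<in> space (prob_algebra (metric_borel (X v) (d v)))"
    using assms(3) by (auto simp: space_coord_space dest: measurable_space)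
  then show "prob_space (m v y)" "sets (m v y) = sets (metric_borel (X v) (d v))"
    by (auto simp: space_prob_algebra)
qed

lemma Metric_space_bayes_nets:
  assumes G: "dag V E" and P: "\<And>v. v \<in> V \<Longrightarrow> polish_nontrivial (X v) (d v)"
  shows "Metric_space (bayes_nets V E X d) (tv_circ V E X d)"
proof -
  let ?N = "bayes_nets V E X d"
  let ?Y = "\<lambda>v. PiE (parents E v) X"
  let ?s = "\<lambda>m m' v. SUP y\<in>?Y v. tv_dist (m v y) (m' v y)"
  have ne: "?Y v \<noteq> {}" for v
    using G P by (force simp: PiE_eq_empty_iff dag_def parents_def polish_nontrivial_def)
  note ker = bayes_nets_kernel
  have up: "tv_dist (m v y) (m' v y) \<le> ?s m m' v" if "m \<in> ?N" "m' \<in> ?N" "v \<in> V" "y \<in> ?Y v" for m m' v y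
    using that by (intro cSUP_upper bdd_aboveI[of _ 1]) (auto intro!: tv_dist_le_1 simp: ker)
  have s0: "0 \<le> ?s m m' v" if "m \<in> ?N" "m' \<in> ?N" "v \<in> V" for m m' v
  proof -
    obtain y where y: "y \<in> ?Y v" using ne by blast
    have "0 \<le> tv_dist (m v y) (m' v y)" using that y by (intro tv_dist_nonneg) (auto simp: ker)
    with up[OF that y] show ?thesis by linarith
  qed
  show ?thesis
  proof
    fix m m' m''
    show "0 \<le> tv_circ V E X d m m'"
      using s0 by (auto simp: tv_circ_def intro!: sum_nonneg)
    have "(\<Sum>v\<in>V. ?s m m' v) = (\<Sum>v\<in>V. ?s m' m v)" if "m \<in> ?N" "m' \<in> ?N"
      using that by (intro sum.cong refl arg_cong[of _ _ Sup] image_cong tv_dist_commute) (simp add: ker)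
    then show "tv_circ V E X d m m' = tv_circ V E X d m' m"
      by (simp add: tv_circ_def)
    assume m: "m \<in> ?N" and m': "m' \<in> ?N"
    show "tv_circ V E X d m m' = 0 \<longleftrightarrow> m = m'"
    proof
      assume "tv_circ V E X d m m' = 0"
      then have z: "?s m m' v = 0" if "v \<in> V" for v
        using m m' s0 G that by (auto simp: tv_circ_def dag_def sum_nonneg_eq_0_iff)
      have eq: "m v y = m' v y" if v: "v \<in> V" and y: "y \<in> ?Y v" for v y
      proof -
        have "tv_dist (m v y) (m' v y) \<le> 0" using up[OF m m' v y] z[OF v] by simp
        moreover have "0 \<le> tv_dist (m v y) (m' v y)"
          using m m' v y by (intro tv_dist_nonneg) (auto simp: ker)
        ultimately have "tv_dist (m v y) (m' v y) = 0" by simp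
        then show ?thesis using tv_dist_eq_0 ker[OF m v y] ker[OF m' v y] by metis
      qed
      have "m v = m' v" if v: "v \<in> V" for v
        using m m' v eq[OF v]
        by (intro extensionalityI[of _ "?Y v"]) (auto simp: bayes_nets_def PiE_iff)
      then show "m = m'"
        using m m' by (intro extensionalityI[of _ V]) (auto simp: bayes_nets_def PiE_iff)
    next
      assume "m = m'"
      have "?s m m v = 0" if v: "v \<in> V" for v
      proof -
        have "?s m m v = (SUP y\<in>?Y v. 0 :: real)"
          using ker[OF m v] by (intro arg_cong[of _ _ Sup] image_cong) (auto simp: tv_dist_eq_0)
        then show ?thesis using ne by simp
      qed
      then show "tv_circ V E X d m m' = 0" using m \<open>m = m'\<close> by (auto simp: tv_circ_def)
    qed
    assume m'': "m'' \<in> ?N"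
    have "?s m m'' v \<le> ?s m m' v + ?s m' m'' v" if v: "v \<in> V" for v
    proof (rule cSUP_least[OF ne])
      fix y assume y: "y \<in> ?Y v"
      have "tv_dist (m v y) (m'' v y) \<le> tv_dist (m v y) (m' v y) + tv_dist (m' v y) (m'' v y)"
        using m m' m'' v y by (intro tv_dist_triangle) (auto simp: ker)
      also have "\<dots> \<le> ?s m m' v + ?s m' m'' v"
        using up[OF m m' v y] up[OF m' m'' v y] by linarith
      finally show "tv_dist (m v y) (m'' v y) \<le> ?s m m' v + ?s m' m'' v" .
    qed
    then have "(\<Sum>v\<in>V. ?s m m'' v) \<le> (\<Sum>v\<in>V. ?s m m' v + ?s m' m'' v)"
      by (rule sum_mono)
    then show "tv_circ V E X d m m'' \<le> tv_circ V E X d m m' + tv_circ V E X d m' m''"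
      using m m' m'' by (simp add: tv_circ_def sum.distrib)
  qed
qed

end

(* Conditional independence is closed under convergence in total variation, because a version of the
   conditional probability under a nearby measure is an approximate version under the limit; as the
   distribution map does not increase distances from d_TV^o to d_TV, the faithful networks are open.
   For density, interpolate linearly between the kernels of a given network and those of a faithful
   one. The class is convex, and the joint law of the interpolation at time t is a combination of
   finitely many fixed laws with coefficients polynomial in t. Written with Radon-Nikodym densities,
   the conditional independence of two events is a quadratic equation in those densities, hence, at
   almost every point, a polynomial equation in t. If it holds for infinitely many t, it holds at
   the faithful endpoint, so each d-connected triple excludes only finitely many t. The global Markov
   property is proved by adding the vertices in topological order. *)

theory Submission
  imports Defs
begin

section \<open>Conditional independence of events given a random variable\<close>

text \<open>Conditional expectations are determined up to null sets of their own measure, whereas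
  both halves of the argument compare a whole family of measures. Versions are therefore functions
  on the value space of the conditioning variable, bounded by 1 everywhere, so that a version for
  one measure can be integrated under another. In the interpolation the same obstacle is met by a
  reference measure that does not depend on t, the law of the conditioning variable at time 1/2, and
  by using only countably many times, so that the exceptional null sets can be united. As
  \<open>V\<close> is finite there are finitely many triples: this gives a smallest radius for
  openness and a finite set of bad times for density. In the induction for the Markov property the
  delicate case is the one where the new vertex, a sink, is conditioned on: a purely graphical
  argument moves it to one of the two sides, and weak union brings it back.\<close>

text \<open>\<open>g\<close> is a version of P(S | Y) as a function on \<open>M\<close>, the value
  space of \<open>Y\<close>. The bound by 1 holds at every point and not only almost surely, so it
  survives a change of \<open>P\<close>; non-negative test functions \<open>h\<close> spare all
  integrability conditions.\<close>

definition cond_version ::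
  "'w measure \<Rightarrow> 'c measure \<Rightarrow> ('w \<Rightarrow> 'c) \<Rightarrow> 'w set \<Rightarrow> ('c \<Rightarrow> ennreal) \<Rightarrow> bool" where
  "cond_version P M Y S g \<longleftrightarrow> g \<in> borel_measurable M \<and> (\<forall>y. g y \<le> 1) \<and>
     (\<forall>h\<in>borel_measurable M.
        (\<integral>\<^sup>+w. h (Y w) * indicator S w \<partial>P) = (\<integral>\<^sup>+w. h (Y w) * g (Y w) \<partial>P))"

text \<open>By \<open>ci_eventsD\<close> the product rule then holds for every choice of versions;
  existential quantifiers make independence easier to establish.\<close>

definition ci_events ::
  "'w measure \<Rightarrow> 'c measure \<Rightarrow> ('w \<Rightarrow> 'c) \<Rightarrow> 'w set \<Rightarrow> 'w set \<Rightarrow> bool" where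
  "ci_events P M Y S T \<longleftrightarrow> (\<exists>g g'. cond_version P M Y S g \<and> cond_version P M Y T g' \<and>
     cond_version P M Y (S \<inter> T) (\<lambda>y. g y * g' y))"

lemma cond_versionI:
  assumes "g \<in> borel_measurable M" "\<And>y. g y \<le> 1"
    and "\<And>h. h \<in> borel_measurable M \<Longrightarrow>
      (\<integral>\<^sup>+w. h (Y w) * indicator S w \<partial>P) = (\<integral>\<^sup>+w. h (Y w) * g (Y w) \<partial>P)"
  shows "cond_version P M Y S g"
  using assms by (auto simp: cond_version_def)

lemma cond_versionD:
  assumes "cond_version P M Y S g"
  shows "g \<in> borel_measurable M" "g y \<le> 1"
    and "h \<in> borel_measurable M \<Longrightarrow>
      (\<integral>\<^sup>+w. h (Y w) * indicator S w \<partial>P) = (\<integral>\<^sup>+w. h (Y w) * g (Y w) \<partial>P)"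
  using assms by (auto simp: cond_version_def)

text \<open>Radon-Nikodym for the law of \<open>Y\<close> under \<open>P\<close> restricted to
  \<open>S\<close>. Its mass is finite, so the density is finite almost everywhere and may be made
  real-valued. The reference \<open>R\<close> is kept free because it is used twice: as the law of
  \<open>Y\<close> itself, and as the law at time 1/2 of an interpolation.\<close>

lemma event_density_exists:
  fixes Y :: "'w \<Rightarrow> 'c"
  assumes "finite_measure P" and Y[measurable]: "Y \<in> P \<rightarrow>\<^sub>M M" and S[measurable]: "S \<in> sets P"
    and "sigma_finite_measure R" and R[measurable_cong]: "sets R = sets M"
    and ac: "\<And>F. F \<in> sets M \<Longrightarrow> emeasure R F = 0 \<Longrightarrow> emeasure P (Y -` F \<inter> space P) = 0"
  shows "\<exists>r. r \<in> borel_measurable M \<and> (\<forall>y. 0 \<le> r y) \<and>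
    (\<forall>h\<in>borel_measurable M.
       (\<integral>\<^sup>+w. h (Y w) * indicator S w \<partial>P) = (\<integral>\<^sup>+y. h y * ennreal (r y) \<partial>R))"
proof -
  interpret P: finite_measure P by fact
  interpret R: sigma_finite_measure R by fact
  let ?N = "distr (density P (indicator S)) M Y"
  have N: "(\<integral>\<^sup>+y. h y \<partial>?N) = (\<integral>\<^sup>+w. h (Y w) * indicator S w \<partial>P)"
    if [measurable]: "h \<in> borel_measurable M" for h
    by (simp add: nn_integral_distr nn_integral_density mult.commute)
  have "absolutely_continuous R ?N"
    unfolding absolutely_continuous_def
  proof
    fix F assume "F \<in> null_sets R"
    then have F[measurable]: "F \<in> sets M" and "emeasure R F = 0" using R by auto
    then have 0: "emeasure P (Y -` F \<inter> space P) = 0" by (intro ac)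
    have "emeasure ?N F = (\<integral>\<^sup>+y. indicator F y \<partial>?N)" by simp
    also have "\<dots> = (\<integral>\<^sup>+w. indicator F (Y w) * indicator S w \<partial>P)" by (rule N) simp
    also have "\<dots> \<le> (\<integral>\<^sup>+w. indicator (Y -` F \<inter> space P) w \<partial>P)"
      by (intro nn_integral_mono) (auto split: split_indicator)
    also have "\<dots> = 0" using 0 by simp
    finally show "F \<in> null_sets ?N" using F by (auto simp: null_sets_def)
  qed
  then obtain f where f: "f \<in> borel_measurable R" and fN: "density R f = ?N"
    using R.Radon_Nikodym[of ?N] R by auto
  from f have fM[measurable]: "f \<in> borel_measurable M" using R by (simp cong: measurable_cong_sets)
  have eq: "(\<integral>\<^sup>+w. h (Y w) * indicator S w \<partial>P) = (\<integral>\<^sup>+y. f y * h y \<partial>R)"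
    if [measurable]: "h \<in> borel_measurable M" for h
    by (subst N[symmetric]) (simp_all add: fN[symmetric] nn_integral_density)
  have "(\<integral>\<^sup>+y. f y \<partial>R) = (\<integral>\<^sup>+w. indicator S w \<partial>P)"
    using eq[of "\<lambda>_. 1"] by simp
  then have "(\<integral>\<^sup>+y. f y \<partial>R) \<noteq> \<infinity>" by simp
  then have "AE y in R. f y \<noteq> \<infinity>" using f by (intro nn_integral_PInf_AE) auto
  then have fin: "AE y in R. f y = ennreal (enn2real (f y))"
    by eventually_elim (auto simp: less_top)
  have "(\<integral>\<^sup>+y. f y * h y \<partial>R) = (\<integral>\<^sup>+y. h y * ennreal (enn2real (f y)) \<partial>R)" for h
    by (rule nn_integral_cong_AE, use fin in eventually_elim) (metis mult.commute)
  then show ?thesis using eq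
    by (intro exI[of _ "\<lambda>y. enn2real (f y)"]) (auto intro!: measurable_compose[OF fM])
qed

lemma cond_version_exists:
  assumes "finite_measure P" and Y[measurable]: "Y \<in> P \<rightarrow>\<^sub>M M" and S[measurable]: "S \<in> sets P"
  shows "\<exists>g. cond_version P M Y S g"
proof -
  interpret P: finite_measure P by fact
  interpret R: finite_measure "distr P M Y" by (rule P.finite_measure_distr) fact
  obtain r where r[measurable]: "r \<in> borel_measurable M" and r0: "\<And>y. 0 \<le> r y"
    and eq: "\<And>h. h \<in> borel_measurable M \<Longrightarrow>
       (\<integral>\<^sup>+w. h (Y w) * indicator S w \<partial>P) = (\<integral>\<^sup>+y. h y * ennreal (r y) \<partial>distr P M Y)"
    using event_density_exists[OF assms R.sigma_finite_measure_axioms] by (auto simp: emeasure_distr)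
  \<comment> \<open>The density exceeds 1 only on a null set: the excess \<open>r - 1\<close>
    integrated over \<open>?F\<close>, plus the mass of \<open>?F\<close>, is the probability that
    \<open>S\<close> occurs and \<open>Y\<close> lies in \<open>?F\<close>. This is at most the mass
    of \<open>?F\<close>, a finite number that can be cancelled.\<close>
  let ?F = "{y \<in> space M. 1 < r y}"
  have F[measurable]: "?F \<in> sets M" by measurable
  have "(\<integral>\<^sup>+y. indicator ?F y * (ennreal (r y) - 1) \<partial>distr P M Y) + emeasure (distr P M Y) ?F =
      (\<integral>\<^sup>+y. indicator ?F y * (ennreal (r y) - 1) + indicator ?F y \<partial>distr P M Y)"
    by (subst nn_integral_add) auto
  also have "\<dots> = (\<integral>\<^sup>+y. indicator ?F y * ennreal (r y) \<partial>distr P M Y)"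
    by (intro nn_integral_cong)
      (auto split: split_indicator intro!: diff_add_cancel_ennreal)
  also have "\<dots> = (\<integral>\<^sup>+w. indicator ?F (Y w) * indicator S w \<partial>P)" by (rule eq[symmetric]) simp
  also have "\<dots> \<le> (\<integral>\<^sup>+w. indicator ?F (Y w) \<partial>P)"
    by (intro nn_integral_mono) (auto split: split_indicator)
  also have "\<dots> = (\<integral>\<^sup>+y. indicator ?F y \<partial>distr P M Y)" by (subst nn_integral_distr) auto
  also have "\<dots> = 0 + emeasure (distr P M Y) ?F" by simp
  finally have "(\<integral>\<^sup>+y. indicator ?F y * (ennreal (r y) - 1) \<partial>distr P M Y) = 0"
    using R.emeasure_finite[of ?F] by (simp add: ennreal_add_left_cancel_le add.commute[of _ "emeasure _ _"] top.not_eq_extremum flip: infinity_ennreal_def)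
  then have "AE y in distr P M Y. indicator ?F y * (ennreal (r y) - 1) = 0"
    by (subst (asm) nn_integral_0_iff_AE) auto
  then have le: "AE y in distr P M Y. ennreal (r y) = min 1 (ennreal (r y))"
    using AE_space
  proof eventually_elim
    case (elim y)
    show ?case
    proof (cases "1 < r y")
      case True
      with elim have "ennreal (r y) - ennreal 1 = 0" by simp
      with True show ?thesis by (simp add: ennreal_minus del: ennreal_1)
    next
      case False
      then have "ennreal (r y) \<le> 1" by (simp add: r0)
      then show ?thesis by (simp add: min_absorb2)
    qed
  qed
  show ?thesis
  proof (intro exI cond_versionI)
    show "(\<lambda>y. min 1 (ennreal (r y))) \<in> borel_measurable M" by measurable
    fix h :: "_ \<Rightarrow> ennreal" assume h[measurable]: "h \<in> borel_measurable M"
    have "(\<integral>\<^sup>+w. h (Y w) * indicator S w \<partial>P) = (\<integral>\<^sup>+y. h y * ennreal (r y) \<partial>distr P M Y)"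
      by (rule eq[OF h])
    also have "\<dots> = (\<integral>\<^sup>+y. h y * min 1 (ennreal (r y)) \<partial>distr P M Y)"
      by (rule nn_integral_cong_AE, use le in eventually_elim) metis
    finally show "(\<integral>\<^sup>+w. h (Y w) * indicator S w \<partial>P) = (\<integral>\<^sup>+w. h (Y w) * min 1 (ennreal (r (Y w))) \<partial>P)"
      by (simp add: nn_integral_distr)
  qed auto
qed

text \<open>Two versions are densities of the same measure with respect to the law of
  \<open>Y\<close>, which is finite, so they agree almost everywhere.\<close>

lemma cond_version_unique:
  assumes "finite_measure P" and Y[measurable]: "Y \<in> P \<rightarrow>\<^sub>M M"
    and g: "cond_version P M Y S g" and g': "cond_version P M Y S g'"
  shows "AE w in P. g (Y w) = g' (Y w)"
proof -
  interpret P: finite_measure P by fact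
  interpret R: finite_measure "distr P M Y" by (rule P.finite_measure_distr) fact
  note [measurable] = cond_versionD(1)[OF g] cond_versionD(1)[OF g']
  have "AE y in distr P M Y. g y = g' y"
  proof (rule R.density_unique_finite_measure)
    fix F assume "F \<in> sets (distr P M Y)"
    then have [measurable]: "F \<in> sets M" by simp
    have "(\<integral>\<^sup>+w. indicator F (Y w) * g (Y w) \<partial>P) = (\<integral>\<^sup>+w. indicator F (Y w) * g' (Y w) \<partial>P)"
      using cond_versionD(3)[OF g, of "indicator F"] cond_versionD(3)[OF g', of "indicator F"] by simp
    then show "(\<integral>\<^sup>+y. g y * indicator F y \<partial>distr P M Y) = (\<integral>\<^sup>+y. g' y * indicator F y \<partial>distr P M Y)"
      by (simp add: nn_integral_distr mult.commute)
  qed auto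
  then show ?thesis by (simp add: AE_distr_iff)
qed

lemma cond_version_cong:
  assumes Y[measurable]: "Y \<in> P \<rightarrow>\<^sub>M M" and g: "cond_version P M Y S g"
    and "g' \<in> borel_measurable M" "\<And>y. g' y \<le> 1" and eq: "AE w in P. g (Y w) = g' (Y w)"
  shows "cond_version P M Y S g'"
proof (rule cond_versionI)
  fix h :: "_ \<Rightarrow> ennreal" assume "h \<in> borel_measurable M"
  then have "(\<integral>\<^sup>+w. h (Y w) * indicator S w \<partial>P) = (\<integral>\<^sup>+w. h (Y w) * g (Y w) \<partial>P)"
    by (rule cond_versionD(3)[OF g])
  also have "\<dots> = (\<integral>\<^sup>+w. h (Y w) * g' (Y w) \<partial>P)"
    by (rule nn_integral_cong_AE, use eq in eventually_elim) simp
  finally show "(\<integral>\<^sup>+w. h (Y w) * indicator S w \<partial>P) = (\<integral>\<^sup>+w. h (Y w) * g' (Y w) \<partial>P)" .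
qed fact+

lemma mult_le_one_ennreal: "a \<le> 1 \<Longrightarrow> b \<le> 1 \<Longrightarrow> a * b \<le> (1 :: ennreal)"
  using mult_mono[of a 1 b 1] by simp

text \<open>Versions are almost surely unique, hence so are their products: a product rule found for
  one pair of versions passes to any given pair.\<close>

lemma ci_eventsD:
  assumes P: "finite_measure P" and Y[measurable]: "Y \<in> P \<rightarrow>\<^sub>M M" and ci: "ci_events P M Y S T"
    and g: "cond_version P M Y S g" and g': "cond_version P M Y T g'"
  shows "cond_version P M Y (S \<inter> T) (\<lambda>y. g y * g' y)"
proof -
  obtain k k' where k: "cond_version P M Y S k" and k': "cond_version P M Y T k'"
    and kk: "cond_version P M Y (S \<inter> T) (\<lambda>y. k y * k' y)"
    using ci by (auto simp: ci_events_def)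
  note [measurable] = cond_versionD(1)[OF g] cond_versionD(1)[OF g']
  have "AE w in P. k (Y w) * k' (Y w) = g (Y w) * g' (Y w)"
    using cond_version_unique[OF P Y k g] cond_version_unique[OF P Y k' g'] by eventually_elim simp
  then show ?thesis
    by (intro cond_version_cong[OF Y kk])
      (auto intro!: mult_le_one_ennreal cond_versionD(2)[OF g] cond_versionD(2)[OF g'])
qed

lemma ci_events_commute: "ci_events P M Y S T \<Longrightarrow> ci_events P M Y T S"
  unfolding ci_events_def by (metis (no_types, lifting) Int_commute mult.commute ext)

section \<open>Comparison with conditional expectations on the sample space\<close>

lemma subalgebra_vimage_algebra:
  assumes Y: "Y \<in> P \<rightarrow>\<^sub>M M"
  shows "subalgebra P (vimage_algebra (space P) Y M)"
proof -
  have "Y \<in> space P \<rightarrow> space M" using measurable_space[OF Y] by auto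
  from sets_vimage_algebra2[OF this] show ?thesis
    using measurable_sets[OF Y] by (auto simp: subalgebra_def)
qed

text \<open>\<open>real_cond_exp\<close> is the difference of the non-negative conditional
  expectations of the positive and the negative part. Sets of the generated sigma-algebra are
  preimages under \<open>Y\<close>, which identifies the first with \<open>g\<close> after
  \<open>Y\<close>; the second vanishes.\<close>

lemma real_cond_exp_indicator_eq:
  assumes P: "finite_measure P" and Y[measurable]: "Y \<in> P \<rightarrow>\<^sub>M M" and S[measurable]: "S \<in> sets P"
    and g: "cond_version P M Y S g"
  shows "AE w in P. real_cond_exp P (vimage_algebra (space P) Y M) (indicator S) w = enn2real (g (Y w))"
proof -
  interpret P: finite_measure P by fact
  let ?G = "vimage_algebra (space P) Y M"
  interpret G: finite_measure_subalgebra P ?G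
    by unfold_locales (rule subalgebra_vimage_algebra[OF Y])
  note gm[measurable] = cond_versionD(1)[OF g]
  have Y': "Y \<in> ?G \<rightarrow>\<^sub>M M"
    by (rule measurable_vimage_algebra1) (use measurable_space[OF Y] in auto)
  have "AE w in P. g (Y w) = nn_cond_exp P ?G (\<lambda>w. ennreal (indicator S w)) w"
  proof (rule G.nn_cond_exp_charact)
    fix A assume "A \<in> sets ?G"
    then obtain F where F[measurable]: "F \<in> sets M" and A: "A = Y -` F \<inter> space P"
      using measurable_space[OF Y] by (auto simp: sets_vimage_algebra2)
    have "(\<integral>\<^sup>+ w\<in>A. ennreal (indicator S w) \<partial>P) = (\<integral>\<^sup>+w. indicator F (Y w) * indicator S w \<partial>P)"
      by (intro nn_integral_cong) (auto simp: A split: split_indicator)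
    also have "\<dots> = (\<integral>\<^sup>+w. indicator F (Y w) * g (Y w) \<partial>P)" by (rule cond_versionD(3)[OF g]) simp
    also have "\<dots> = (\<integral>\<^sup>+ w\<in>A. g (Y w) \<partial>P)"
      by (intro nn_integral_cong) (auto simp: A split: split_indicator)
    finally show "(\<integral>\<^sup>+ w\<in>A. ennreal (indicator S w) \<partial>P) = (\<integral>\<^sup>+ w\<in>A. g (Y w) \<partial>P)" .
  qed (auto intro: measurable_compose[OF Y' gm])
  moreover have "AE w in P. 0 = nn_cond_exp P ?G (\<lambda>w. ennreal (- indicator S w)) w"
  proof (rule G.nn_cond_exp_charact)
    show "(\<integral>\<^sup>+ w\<in>A. ennreal (- indicator S w) \<partial>P) = (\<integral>\<^sup>+ w\<in>A. 0 \<partial>P)" for A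
      by (intro nn_integral_cong) (auto split: split_indicator simp: ennreal_neg)
  qed auto
  ultimately show ?thesis
    unfolding real_cond_exp_def
  proof eventually_elim
    case (elim w)
    show ?case by (simp only: elim[symmetric]) simp
  qed
qed

lemma ci_events_iff_real_cond_exp:
  assumes P: "finite_measure P" and Y[measurable]: "Y \<in> P \<rightarrow>\<^sub>M M"
    and S[measurable]: "S \<in> sets P" and T[measurable]: "T \<in> sets P"
  defines "G \<equiv> vimage_algebra (space P) Y M"
  shows "ci_events P M Y S T \<longleftrightarrow> (AE w in P. real_cond_exp P G (indicator (S \<inter> T)) w =
     real_cond_exp P G (indicator S) w * real_cond_exp P G (indicator T) w)"
proof -
  obtain g where g: "cond_version P M Y S g" using cond_version_exists[OF P Y S] by blast
  obtain g' where g': "cond_version P M Y T g'" using cond_version_exists[OF P Y T] by blast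
  have ST: "S \<inter> T \<in> sets P" by simp
  obtain k where k: "cond_version P M Y (S \<inter> T) k" using cond_version_exists[OF P Y ST] by blast
  note [measurable] = cond_versionD(1)[OF g] cond_versionD(1)[OF g'] cond_versionD(1)[OF k]
  note E = real_cond_exp_indicator_eq[OF P Y S g] real_cond_exp_indicator_eq[OF P Y T g']
    real_cond_exp_indicator_eq[OF P Y ST k]
  \<comment> \<open>All three values are at most 1, hence finite, so passing to real numbers loses
    nothing and respects the product.\<close>
  have inj: "enn2real (k y) = enn2real (g y) * enn2real (g' y) \<longleftrightarrow> k y = g y * g' y" for y
  proof -
    have "k y < top" "g y < top" "g' y < top"
      by (simp_all add: le_less_trans[OF cond_versionD(2)[OF g]] le_less_trans[OF cond_versionD(2)[OF g']]
          le_less_trans[OF cond_versionD(2)[OF k]])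
    then show ?thesis
      by (metis enn2real_mult ennreal_enn2real ennreal_mult_less_top)
  qed
  have "ci_events P M Y S T \<longleftrightarrow> (AE w in P. k (Y w) = g (Y w) * g' (Y w))"
  proof
    assume "ci_events P M Y S T"
    from cond_version_unique[OF P Y k ci_eventsD[OF P Y this g g']]
    show "AE w in P. k (Y w) = g (Y w) * g' (Y w)" .
  next
    assume "AE w in P. k (Y w) = g (Y w) * g' (Y w)"
    then have "cond_version P M Y (S \<inter> T) (\<lambda>y. g y * g' y)"
      by (intro cond_version_cong[OF Y k])
        (auto intro!: mult_le_one_ennreal cond_versionD(2)[OF g] cond_versionD(2)[OF g'])
    then show "ci_events P M Y S T" using g g' by (auto simp: ci_events_def)
  qed
  also have "\<dots> \<longleftrightarrow> (AE w in P. enn2real (k (Y w)) = enn2real (g (Y w)) * enn2real (g' (Y w)))"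
    by (simp add: inj)
  also have "\<dots> \<longleftrightarrow> (AE w in P. real_cond_exp P G (indicator (S \<inter> T)) w =
     real_cond_exp P G (indicator S) w * real_cond_exp P G (indicator T) w)"
    unfolding G_def
  proof
    assume "AE w in P. enn2real (k (Y w)) = enn2real (g (Y w)) * enn2real (g' (Y w))"
    with E show "AE w in P. real_cond_exp P (vimage_algebra (space P) Y M) (indicator (S \<inter> T)) w =
      real_cond_exp P (vimage_algebra (space P) Y M) (indicator S) w *
      real_cond_exp P (vimage_algebra (space P) Y M) (indicator T) w"
      by eventually_elim simp
  next
    assume "AE w in P. real_cond_exp P (vimage_algebra (space P) Y M) (indicator (S \<inter> T)) w =
      real_cond_exp P (vimage_algebra (space P) Y M) (indicator S) w *
      real_cond_exp P (vimage_algebra (space P) Y M) (indicator T) w"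
    with E show "AE w in P. enn2real (k (Y w)) = enn2real (g (Y w)) * enn2real (g' (Y w))"
      by eventually_elim simp
  qed
  finally show ?thesis .
qed

text \<open>Both sides are integrals of \<open>h\<close> against push-forwards to \<open>M\<close>,
  of the measures with densities \<open>indicator S\<close> and \<open>g\<close> after
  \<open>Y\<close>; agreement on sets gives agreement of all integrals.\<close>

lemma cond_versionI_sets:
  assumes P: "finite_measure P" and Y[measurable]: "Y \<in> P \<rightarrow>\<^sub>M M" and S[measurable]: "S \<in> sets P"
    and g[measurable]: "g \<in> borel_measurable M" and le: "\<And>y. g y \<le> 1"
    and eq: "\<And>F. F \<in> sets M \<Longrightarrow>
      (\<integral>\<^sup>+w. indicator F (Y w) * indicator S w \<partial>P) = (\<integral>\<^sup>+w. indicator F (Y w) * g (Y w) \<partial>P)"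
  shows "cond_version P M Y S g"
proof (rule cond_versionI[OF g le])
  fix h :: "_ \<Rightarrow> ennreal" assume h[measurable]: "h \<in> borel_measurable M"
  let ?N = "distr (density P (indicator S)) M Y" and ?N' = "distr (density P (\<lambda>w. g (Y w))) M Y"
  have N: "(\<integral>\<^sup>+y. h y \<partial>?N) = (\<integral>\<^sup>+w. h (Y w) * indicator S w \<partial>P)"
    "(\<integral>\<^sup>+y. h y \<partial>?N') = (\<integral>\<^sup>+w. h (Y w) * g (Y w) \<partial>P)"
    if [measurable]: "h \<in> borel_measurable M" for h
    by (simp_all add: nn_integral_distr nn_integral_density mult.commute)
  have "?N = ?N'"
  proof (rule measure_eqI)
    fix F assume "F \<in> sets ?N"
    then have [measurable]: "F \<in> sets M" by simp
    have "(\<integral>\<^sup>+y. indicator F y \<partial>?N) = (\<integral>\<^sup>+y. indicator F y \<partial>?N')"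
      by (simp only: N borel_measurable_indicator \<open>F \<in> sets M\<close> eq)
    then show "emeasure ?N F = emeasure ?N' F" by simp
  qed simp
  then show "(\<integral>\<^sup>+w. h (Y w) * indicator S w \<partial>P) = (\<integral>\<^sup>+w. h (Y w) * g (Y w) \<partial>P)"
    using N[OF h] by simp
qed

subsection \<open>Limits in total variation\<close>

text \<open>A number in [0,1] is the length of the set of levels in [0,1) below it. Keeping the
  levels in an interval of length 1 is what later bounds the error.\<close>

lemma layer_cake:
  fixes h :: ennreal
  assumes "h \<le> 1"
  shows "(\<integral>\<^sup>+u. indicator {0..<1} u * indicator {u. ennreal u < h} u \<partial>lborel) = h"
proof -
  obtain r where r: "h = ennreal r" "0 \<le> r" "r \<le> 1"
    using assms by (cases h) (auto simp: top_unique)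
  have "(\<integral>\<^sup>+u. indicator {0..<1} u * indicator {u. ennreal u < h} u \<partial>lborel) =
      (\<integral>\<^sup>+u. indicator {0..<r} u \<partial>lborel)"
    using r by (intro nn_integral_cong) (auto split: split_indicator simp: ennreal_less_iff)
  then show ?thesis using r by simp
qed

text \<open>Slicing \<open>h\<close> into superlevel sets reduces the integrals to probabilities.
  The levels fill an interval of length 1, so a setwise error \<epsilon> yields the same error
  \<epsilon> and not a multiple of it.\<close>

lemma nn_integral_le_add:
  assumes P: "prob_space P" and Q: "prob_space Q" and PQ[measurable_cong]: "sets Q = sets P"
    and le: "\<And>S. S \<in> sets P \<Longrightarrow> measure P S \<le> measure Q S + \<epsilon>" and e: "0 \<le> \<epsilon>"
    and h[measurable]: "h \<in> borel_measurable P" and h1: "\<And>x. x \<in> space P \<Longrightarrow> h x \<le> 1"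
  shows "(\<integral>\<^sup>+x. h x \<partial>P) \<le> (\<integral>\<^sup>+x. h x \<partial>Q) + ennreal \<epsilon>"
proof -
  interpret P: prob_space P by fact
  interpret Q: prob_space Q by fact
  have space: "space Q = space P" using PQ by (rule sets_eq_imp_space_eq)
  have *: "(\<integral>\<^sup>+x. h x \<partial>N) = (\<integral>\<^sup>+u. indicator {0..<1} u * emeasure N {x\<in>space P. ennreal u < h x} \<partial>lborel)"
    if N: "prob_space N" and sN[measurable_cong]: "sets N = sets P" for N
  proof -
    interpret N: prob_space N by fact
    interpret NL: pair_sigma_finite N "lborel :: real measure" ..
    have sp: "space N = space P" using sN by (rule sets_eq_imp_space_eq)
    have "(\<integral>\<^sup>+x. h x \<partial>N) =
        (\<integral>\<^sup>+x. \<integral>\<^sup>+u. indicator {0..<1} u * indicator {u. ennreal u < h x} u \<partial>lborel \<partial>N)"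
      by (intro nn_integral_cong) (simp add: layer_cake h1 sp)
    also have "\<dots> = (\<integral>\<^sup>+u. \<integral>\<^sup>+x. indicator {0..<1} u * indicator {u. ennreal u < h x} u \<partial>N \<partial>lborel)"
      by (rule NL.Fubini'[symmetric]) (simp add: indicator_def, measurable)
    also have "\<dots> = (\<integral>\<^sup>+u. indicator {0..<1} u * emeasure N {x\<in>space P. ennreal u < h x} \<partial>lborel)"
    proof (rule nn_integral_cong)
      fix u :: real
      have "(\<integral>\<^sup>+x. indicator {0..<1} u * indicator {u. ennreal u < h x} u \<partial>N) =
        (\<integral>\<^sup>+x. indicator {0..<1} u * indicator {x\<in>space P. ennreal u < h x} x \<partial>N)"
        by (intro nn_integral_cong) (auto simp: sp split: split_indicator)
      also have "\<dots> = indicator {0..<1} u * emeasure N {x\<in>space P. ennreal u < h x}"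
        by (subst nn_integral_cmult) auto
      finally show "(\<integral>\<^sup>+x. indicator {0..<1} u * indicator {u. ennreal u < h x} u \<partial>N) =
        indicator {0..<1} u * emeasure N {x\<in>space P. ennreal u < h x}" .
    qed
    finally show ?thesis .
  qed
  have m: "(\<lambda>u. emeasure Q {x\<in>space P. ennreal u < h x}) \<in> borel_measurable lborel"
    by (subst space[symmetric]) measurable
  have "(\<integral>\<^sup>+x. h x \<partial>P) \<le> (\<integral>\<^sup>+u. indicator {0..<1} u * emeasure Q {x\<in>space P. ennreal u < h x}
      + ennreal \<epsilon> * indicator {0..<1} u \<partial>lborel)"
    unfolding *[OF P refl]
  proof (rule nn_integral_mono)
    fix u :: real
    have "emeasure P {x\<in>space P. ennreal u < h x} \<le> emeasure Q {x\<in>space P. ennreal u < h x} + ennreal \<epsilon>"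
      using le[of "{x\<in>space P. ennreal u < h x}"] e
      by (simp add: P.emeasure_eq_measure Q.emeasure_eq_measure flip: ennreal_plus)
    then show "indicator {0..<1} u * emeasure P {x\<in>space P. ennreal u < h x}
      \<le> indicator {0..<1} u * emeasure Q {x\<in>space P. ennreal u < h x} + ennreal \<epsilon> * indicator {0..<1} u"
      by (auto split: split_indicator)
  qed
  also have "\<dots> = (\<integral>\<^sup>+x. h x \<partial>Q) + ennreal \<epsilon>"
    using m by (subst nn_integral_add) (simp_all add: *[OF Q PQ] nn_integral_cmult)
  finally show ?thesis .
qed

text \<open>With versions \<open>e\<close>, \<open>e'\<close> for \<open>P\<close> and
  \<open>q\<close>, \<open>q'\<close> for \<open>Q\<close>, always under the indicator of
  \<open>F\<close>: the product e e' has the same integral under \<open>P\<close> as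
  \<open>e\<close> on \<open>T\<close>; pass to \<open>Q\<close>, where \<open>e\<close> on
  \<open>T\<close> becomes e q'; pass back to \<open>P\<close>, where e q' becomes \<open>q'\<close>
  on \<open>S\<close>; pass to \<open>Q\<close>, where \<open>q'\<close> on \<open>S\<close> becomes
  q q' and, by independence under \<open>Q\<close>, the intersection; pass to \<open>P\<close>. The
  distance between \<open>e\<close> and \<open>q\<close> is never estimated. There are four
  passages, each with an integrand at most 1, whence \<epsilon>/4.\<close>

lemma ci_events_tv_closed:
  assumes P: "prob_space P" and Y[measurable]: "Y \<in> P \<rightarrow>\<^sub>M M"
    and S[measurable]: "S \<in> sets P" and T[measurable]: "T \<in> sets P"
    and near: "\<And>\<epsilon>. \<epsilon> > 0 \<Longrightarrow> \<exists>Q. prob_space Q \<and> sets Q = sets P \<and>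
      (\<forall>S\<in>sets P. \<bar>measure P S - measure Q S\<bar> \<le> \<epsilon>) \<and> ci_events Q M Y S T"
  shows "ci_events P M Y S T"
proof -
  interpret P: prob_space P by fact
  note fP = P.finite_measure_axioms
  obtain e where e: "cond_version P M Y S e" using cond_version_exists[OF fP Y S] by blast
  obtain e' where e': "cond_version P M Y T e'" using cond_version_exists[OF fP Y T] by blast
  note [measurable] = cond_versionD(1)[OF e] cond_versionD(1)[OF e']
  have le1: "indicator F x * a * indicator G y \<le> 1" if "a \<le> 1" for F G x y and a :: ennreal
    using that by (simp split: split_indicator)
  have "cond_version P M Y (S \<inter> T) (\<lambda>y. e y * e' y)"
  proof (rule cond_versionI_sets[OF fP Y])
    fix F assume F[measurable]: "F \<in> sets M"
    let ?A = "\<integral>\<^sup>+w. indicator F (Y w) * (e (Y w) * e' (Y w)) \<partial>P"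
    let ?B = "\<integral>\<^sup>+w. indicator F (Y w) * indicator (S \<inter> T) w \<partial>P"
    have AB: "?A \<le> ?B + ennreal \<epsilon> \<and> ?B \<le> ?A + ennreal \<epsilon>" if "0 < \<epsilon>" for \<epsilon>
    proof -
      from \<open>0 < \<epsilon>\<close> have pos: "0 < \<epsilon> / 4" by simp
      from near[OF pos] obtain Q where Q: "prob_space Q" and QP[measurable_cong]: "sets Q = sets P"
        and tv: "\<And>S. S \<in> sets P \<Longrightarrow> \<bar>measure P S - measure Q S\<bar> \<le> \<epsilon> / 4"
        and ci: "ci_events Q M Y S T" by blast
      interpret Q: prob_space Q by fact
      note fQ = Q.finite_measure_axioms
      have YQ[measurable]: "Y \<in> Q \<rightarrow>\<^sub>M M" by measurable
      have [measurable]: "S \<in> sets Q" "T \<in> sets Q" using QP by auto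
      obtain q where q: "cond_version Q M Y S q"
        using cond_version_exists[OF fQ YQ \<open>S \<in> sets Q\<close>] by blast
      obtain q' where q': "cond_version Q M Y T q'"
        using cond_version_exists[OF fQ YQ \<open>T \<in> sets Q\<close>] by blast
      note qq = ci_eventsD[OF fQ YQ ci q q']
      note [measurable] = cond_versionD(1)[OF q] cond_versionD(1)[OF q']
      define near where "near a b \<longleftrightarrow> a \<le> b + ennreal (\<epsilon> / 4) \<and> b \<le> a + ennreal (\<epsilon> / 4)" for a b
      have nearI: "near (\<integral>\<^sup>+w. h w \<partial>P) (\<integral>\<^sup>+w. h w \<partial>Q)"
        if [measurable]: "h \<in> borel_measurable P" and h1: "\<And>w. h w \<le> 1" for h
      proof -
        have b: "measure P S \<le> measure Q S + \<epsilon> / 4" "measure Q S \<le> measure P S + \<epsilon> / 4"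
          if "S \<in> sets P" for S using tv[OF that] by linarith+
        have "(\<integral>\<^sup>+w. h w \<partial>P) \<le> (\<integral>\<^sup>+w. h w \<partial>Q) + ennreal (\<epsilon> / 4)"
          using pos by (intro nn_integral_le_add[OF P Q QP] b h1) auto
        moreover have "(\<integral>\<^sup>+w. h w \<partial>Q) \<le> (\<integral>\<^sup>+w. h w \<partial>P) + ennreal (\<epsilon> / 4)"
          using pos QP by (intro nn_integral_le_add[OF Q P QP[symmetric]] b h1) auto
        ultimately show ?thesis by (simp add: near_def)
      qed
      let ?I1 = "\<integral>\<^sup>+w. indicator F (Y w) * e (Y w) * indicator T w \<partial>Q"
      let ?I2 = "\<integral>\<^sup>+w. indicator F (Y w) * q' (Y w) * indicator S w \<partial>P"
      let ?I3 = "\<integral>\<^sup>+w. indicator F (Y w) * indicator (S \<inter> T) w \<partial>Q"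
      have "?A = (\<integral>\<^sup>+w. (indicator F (Y w) * e (Y w)) * indicator T w \<partial>P)"
        by (subst cond_versionD(3)[OF e', of "\<lambda>y. indicator F y * e y"]) (simp_all add: mult_ac)
      then have 1: "near ?A ?I1"
        by (simp only:) (intro nearI le1 cond_versionD(2)[OF e]; measurable)
      have "?I1 = (\<integral>\<^sup>+w. indicator F (Y w) * e (Y w) * q' (Y w) \<partial>Q)"
        by (subst cond_versionD(3)[OF q', of "\<lambda>y. indicator F y * e y"]) simp_all
      moreover have "?I2 = (\<integral>\<^sup>+w. indicator F (Y w) * q' (Y w) * e (Y w) \<partial>P)"
        by (subst cond_versionD(3)[OF e, of "\<lambda>y. indicator F y * q' y"]) simp_all
      moreover have "near (\<integral>\<^sup>+w. indicator F (Y w) * (e (Y w) * q' (Y w)) \<partial>P)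
          (\<integral>\<^sup>+w. indicator F (Y w) * (e (Y w) * q' (Y w)) \<partial>Q)"
        by (intro nearI mult_le_one_ennreal cond_versionD(2)[OF e] cond_versionD(2)[OF q'])
          (measurable, simp add: indicator_def)
      ultimately have 2: "near ?I2 ?I1" by (simp add: mult_ac)
      have 3: "near ?I2 (\<integral>\<^sup>+w. indicator F (Y w) * q' (Y w) * indicator S w \<partial>Q)"
        by (intro nearI le1 cond_versionD(2)[OF q']; measurable)
      have "(\<integral>\<^sup>+w. indicator F (Y w) * q' (Y w) * indicator S w \<partial>Q) = ?I3"
        by (subst cond_versionD(3)[OF q, of "\<lambda>y. indicator F y * q' y"], measurable,
            subst cond_versionD(3)[OF qq, of "indicator F"]) (simp_all add: mult_ac)
      with 3 have 3: "near ?I2 ?I3" by simp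
      have 4: "near ?B ?I3"
        by (intro nearI) (measurable, simp add: indicator_def)
      have sum: "ennreal \<epsilon> = ennreal (\<epsilon> / 4) + ennreal (\<epsilon> / 4) + ennreal (\<epsilon> / 4) + ennreal (\<epsilon> / 4)"
        using pos by (simp flip: ennreal_plus)
      have ch: "a \<le> b + x \<Longrightarrow> b \<le> c + y \<Longrightarrow> a \<le> c + (y + x)" for a b c x y :: ennreal
        by (metis add.assoc add_right_mono order_trans)
      show ?thesis
        unfolding sum using 1 2 3 4 unfolding near_def
        by (auto simp: add.assoc intro: ch)
    qed
    show "?B = ?A"
      by (rule antisym; rule ennreal_le_epsilon; erule AB[THEN conjunct1] AB[THEN conjunct2])
  qed (auto intro!: mult_le_one_ennreal cond_versionD(2)[OF e] cond_versionD(2)[OF e'])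
  with e e' show ?thesis by (auto simp: ci_events_def)
qed

subsection \<open>Densities\<close>

text \<open>Here \<open>f\<close> is the density of the law of \<open>Y\<close> on \<open>S\<close>
  and \<open>f1\<close> that of the law of \<open>Y\<close>, so a version is the quotient f/f1; the
  product form avoids dividing where \<open>f1\<close> vanishes. Both directions rest on almost
  everywhere uniqueness of densities with respect to \<open>R\<close>.\<close>

lemma cond_version_iff_density:
  assumes P: "finite_measure P" and Y[measurable]: "Y \<in> P \<rightarrow>\<^sub>M M" and S[measurable]: "S \<in> sets P"
    and R: "sigma_finite_measure R" and RM[measurable_cong]: "sets R = sets M"
    and [measurable]: "f \<in> borel_measurable M" "f1 \<in> borel_measurable M"
    and f: "\<And>h. h \<in> borel_measurable M \<Longrightarrow>
        (\<integral>\<^sup>+w. h (Y w) * indicator S w \<partial>P) = (\<integral>\<^sup>+y. h y * f y \<partial>R)"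
    and f1: "\<And>h. h \<in> borel_measurable M \<Longrightarrow> (\<integral>\<^sup>+w. h (Y w) \<partial>P) = (\<integral>\<^sup>+y. h y * f1 y \<partial>R)"
    and g[measurable]: "g \<in> borel_measurable M" and le: "\<And>y. g y \<le> 1"
  shows "cond_version P M Y S g \<longleftrightarrow> (AE y in R. f y = g y * f1 y)"
proof
  interpret R: sigma_finite_measure R by fact
  assume v: "cond_version P M Y S g"
  have "density R f = density R (\<lambda>y. g y * f1 y)"
  proof (rule measure_eqI)
    fix F assume "F \<in> sets (density R f)"
    then have F[measurable]: "F \<in> sets M" using RM by simp
    have "(\<integral>\<^sup>+y. indicator F y * f y \<partial>R) = (\<integral>\<^sup>+y. (indicator F y * g y) * f1 y \<partial>R)"
      using f[of "indicator F"] f1[of "\<lambda>y. indicator F y * g y"] cond_versionD(3)[OF v, of "indicator F"]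
      by simp
    then show "emeasure (density R f) F = emeasure (density R (\<lambda>y. g y * f1 y)) F"
      by (simp add: emeasure_density mult_ac)
  qed simp
  then show "AE y in R. f y = g y * f1 y" by (subst (asm) R.density_unique_iff) auto
next
  assume ae: "AE y in R. f y = g y * f1 y"
  show "cond_version P M Y S g"
  proof (rule cond_versionI[OF g le])
    fix h :: "_ \<Rightarrow> ennreal" assume h[measurable]: "h \<in> borel_measurable M"
    have "(\<integral>\<^sup>+w. h (Y w) * indicator S w \<partial>P) = (\<integral>\<^sup>+y. h y * g y * f1 y \<partial>R)"
      unfolding f[OF h] by (rule nn_integral_cong_AE, use ae in eventually_elim) (simp add: mult_ac)
    also have "\<dots> = (\<integral>\<^sup>+w. h (Y w) * g (Y w) \<partial>P)" by (rule f1[symmetric]) simp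
    finally show "(\<integral>\<^sup>+w. h (Y w) * indicator S w \<partial>P) = (\<integral>\<^sup>+w. h (Y w) * g (Y w) \<partial>P)" .
  qed
qed

text \<open>Multiplying the rule for versions by the square of \<open>f (space P)\<close> leaves an
  equation in densities alone. Conversely this finite factor can be cancelled where it is not 0;
  where it is 0, the density of the intersection is 0 almost everywhere as well.\<close>

lemma ci_events_iff_density:
  assumes P: "finite_measure P" and Y[measurable]: "Y \<in> P \<rightarrow>\<^sub>M M"
    and S[measurable]: "S \<in> sets P" and T[measurable]: "T \<in> sets P"
    and R: "sigma_finite_measure R" and RM[measurable_cong]: "sets R = sets M"
    and fm[measurable]: "\<And>D. f D \<in> borel_measurable M"
    and f: "\<And>D h. D \<in> sets P \<Longrightarrow> h \<in> borel_measurable M \<Longrightarrow>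
        (\<integral>\<^sup>+w. h (Y w) * indicator D w \<partial>P) = (\<integral>\<^sup>+y. h y * f D y \<partial>R)"
    and fin: "\<And>y. f (space P) y \<noteq> \<infinity>"
  shows "ci_events P M Y S T \<longleftrightarrow>
    (AE y in R. f (S \<inter> T) y * f (space P) y = f S y * f T y)"
proof -
  have f1: "(\<integral>\<^sup>+w. h (Y w) \<partial>P) = (\<integral>\<^sup>+y. h y * f (space P) y \<partial>R)"
    if [measurable]: "h \<in> borel_measurable M" for h
  proof -
    have "(\<integral>\<^sup>+w. h (Y w) \<partial>P) = (\<integral>\<^sup>+w. h (Y w) * indicator (space P) w \<partial>P)"
      by (rule nn_integral_cong) simp
    also have "\<dots> = (\<integral>\<^sup>+y. h y * f (space P) y \<partial>R)" by (rule f) simp_all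
    finally show ?thesis .
  qed
  have iff: "cond_version P M Y D g \<longleftrightarrow> (AE y in R. f D y = g y * f (space P) y)"
    if D: "D \<in> sets P" and g: "g \<in> borel_measurable M" "\<And>y. g y \<le> 1" for D g
    using cond_version_iff_density[OF P Y D R RM fm[of D] fm[of "space P"] f[OF D] f1 g] .
  have ST: "S \<inter> T \<in> sets P" by simp
  obtain e where e: "cond_version P M Y S e" using cond_version_exists[OF P Y S] by blast
  obtain e' where e': "cond_version P M Y T e'" using cond_version_exists[OF P Y T] by blast
  obtain k where k: "cond_version P M Y (S \<inter> T) k" using cond_version_exists[OF P Y ST] by blast
  note [measurable] = cond_versionD(1)[OF e] cond_versionD(1)[OF e'] cond_versionD(1)[OF k]
  have ee: "e y * e' y \<le> 1" for y
    by (intro mult_le_one_ennreal cond_versionD(2)[OF e] cond_versionD(2)[OF e'])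
  have E: "AE y in R. f S y = e y * f (space P) y"
    using iff[OF S, of e] e cond_versionD(2)[OF e] by auto
  have E': "AE y in R. f T y = e' y * f (space P) y"
    using iff[OF T, of e'] e' cond_versionD(2)[OF e'] by auto
  have K: "AE y in R. f (S \<inter> T) y = k y * f (space P) y"
    using iff[OF ST, of k] k cond_versionD(2)[OF k] by auto
  have EE: "cond_version P M Y (S \<inter> T) (\<lambda>y. e y * e' y) \<longleftrightarrow>
      (AE y in R. f (S \<inter> T) y = e y * e' y * f (space P) y)"
    using iff[OF ST, of "\<lambda>y. e y * e' y"] ee by auto
  show ?thesis
  proof
    assume "ci_events P M Y S T"
    then have "AE y in R. f (S \<inter> T) y = e y * e' y * f (space P) y"
      using ci_eventsD[OF P Y _ e e'] EE by blast
    with E E' show "AE y in R. f (S \<inter> T) y * f (space P) y = f S y * f T y"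
      by eventually_elim (simp add: mult_ac)
  next
    assume "AE y in R. f (S \<inter> T) y * f (space P) y = f S y * f T y"
    with E E' K have "AE y in R. f (S \<inter> T) y = e y * e' y * f (space P) y"
    proof eventually_elim
      case (elim y)
      show ?case
      proof (cases "f (space P) y = 0")
        case False
        have "f (space P) y * f (S \<inter> T) y = f (space P) y * (e y * e' y * f (space P) y)"
          using elim by (simp add: mult_ac)
        then show ?thesis using False fin[of y] by (auto simp: ennreal_mult_cancel_left)
      qed (use elim in simp)
    qed
    then show "ci_events P M Y S T" using EE e e' by (auto simp: ci_events_def)
  qed
qed

subsection \<open>Polynomial families of measures\<close>

text \<open>The densities of all components refer to one measure \<open>R\<close> not involving
  \<open>t\<close>, so for fixed \<open>y\<close> the density of \<open>P t\<close> is a polynomial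
  in \<open>t\<close>, and so is the defect in the independence equation. Infinitely many roots make
  the defect the zero polynomial, so it vanishes also at \<open>t1\<close>, which may be an endpoint
  where some coefficients are 0.\<close>

lemma ci_events_polynomial:
  fixes L :: "(real poly \<times> 'w measure) list" and P :: "real \<Rightarrow> 'w measure"
  assumes P: "\<And>t. t \<in> {0..1} \<Longrightarrow> prob_space (P t)" and sP: "\<And>t. t \<in> {0..1} \<Longrightarrow> sets (P t) = sets N"
    and L: "\<And>p. p \<in> set L \<Longrightarrow> prob_space (snd p)" "\<And>p. p \<in> set L \<Longrightarrow> sets (snd p) = sets N"
      "\<And>p t. p \<in> set L \<Longrightarrow> t \<in> {0..1} \<Longrightarrow> 0 \<le> poly (fst p) t" "\<And>p. p \<in> set L \<Longrightarrow> 0 < poly (fst p) (1 / 2)"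
    and eq: "\<And>t h. t \<in> {0..1} \<Longrightarrow> h \<in> borel_measurable N \<Longrightarrow>
       (\<integral>\<^sup>+x. h x \<partial>P t) = (\<Sum>p\<leftarrow>L. ennreal (poly (fst p) t) * (\<integral>\<^sup>+x. h x \<partial>snd p))"
    and Y[measurable]: "Y \<in> N \<rightarrow>\<^sub>M M" and S[measurable]: "S \<in> sets N" and T[measurable]: "T \<in> sets N"
    and inf: "infinite {t \<in> {0..1}. ci_events (P t) M Y S T}" and t1: "t1 \<in> {0..1}"
  shows "ci_events (P t1) M Y S T"
proof -
  define n where "n = length L"
  define c where "c i = fst (L ! i)" for i
  define Q where "Q i = snd (L ! i)" for i
  have mem: "L ! i \<in> set L" if "i < n" for i using that by (simp add: n_def)
  have Q: "finite_measure (Q i)" "sets (Q i) = sets N" "t \<in> {0..1} \<Longrightarrow> 0 \<le> poly (c i) t" "0 < poly (c i) (1 / 2)"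
    if "i < n" for i t
    using L[OF mem[OF that]] by (auto simp: Q_def c_def prob_space.axioms)
  have eq': "(\<integral>\<^sup>+x. h x \<partial>P t) = (\<Sum>i<n. ennreal (poly (c i) t) * (\<integral>\<^sup>+x. h x \<partial>Q i))"
    if "t \<in> {0..1}" "h \<in> borel_measurable N" for t h
    using eq[OF that] by (simp add: sum_list_sum_nth n_def c_def Q_def atLeast0LessThan)
  have half: "1 / 2 \<in> {0..1 :: real}" by simp
  interpret H: prob_space "P (1 / 2)" by (rule P) simp
  define R where "R = distr (P (1 / 2)) M Y"
  have YP: "Y \<in> P t \<rightarrow>\<^sub>M M" if "t \<in> {0..1}" for t using Y sP[OF that] by (simp cong: measurable_cong_sets)
  interpret R: finite_measure R unfolding R_def by (rule H.finite_measure_distr[OF YP[OF half]])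
  have RM: "sets R = sets M" by (simp add: R_def)
  note Rm[measurable_cong] = RM
  have ac: "emeasure (Q i) (Y -` F \<inter> space (Q i)) = 0" if i: "i < n" and F: "F \<in> sets M" "emeasure R F = 0" for i F
  proof -
    have sp: "space (Q i) = space N" "space (P (1/2)) = space N"
      using sets_eq_imp_space_eq[OF Q(2)[OF i]] sets_eq_imp_space_eq[OF sP[OF half]] by simp_all
    have G: "Y -` F \<inter> space N \<in> sets N" using F(1) by measurable
    have "0 = emeasure (P (1 / 2)) (Y -` F \<inter> space N)"
      using F by (simp add: R_def emeasure_distr[OF YP[OF half]] sp)
    also have "\<dots> = (\<integral>\<^sup>+x. indicator (Y -` F \<inter> space N) x \<partial>P (1 / 2))"
      using G sP[OF half] by simp
    also have "\<dots> = (\<Sum>i<n. ennreal (poly (c i) (1 / 2)) * (\<integral>\<^sup>+x. indicator (Y -` F \<inter> space N) x \<partial>Q i))"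
      using G by (intro eq'[OF half]) simp
    finally have "ennreal (poly (c i) (1 / 2)) * (\<integral>\<^sup>+x. indicator (Y -` F \<inter> space N) x \<partial>Q i) = 0"
      using i by (auto simp: sum_eq_0_iff)
    moreover have "ennreal (poly (c i) (1 / 2)) \<noteq> 0" using Q(4)[OF i] by simp
    ultimately have "(\<integral>\<^sup>+x. indicator (Y -` F \<inter> space N) x \<partial>Q i) = 0" by simp
    then show ?thesis using G Q(2)[OF i] by (simp add: sp)
  qed
  \<comment> \<open>For a non-measurable \<open>D\<close> the integral identity is void and the zero
    function serves, so \<open>r i D\<close> is measurable for every \<open>D\<close>, as
    \<open>ci_events_iff_density\<close> demands of a family of densities.\<close>
  define is_dens where "is_dens i D r \<longleftrightarrow> r \<in> borel_measurable M \<and> (\<forall>y. 0 \<le> r y) \<and> (D \<in> sets N \<longrightarrow>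
    (\<forall>h\<in>borel_measurable M. (\<integral>\<^sup>+w. h (Y w) * indicator D w \<partial>Q i) = (\<integral>\<^sup>+y. h y * ennreal (r y) \<partial>R)))"
    for i D r
  have ex: "\<exists>r. is_dens i D r" if i: "i < n" for i D
  proof (cases "D \<in> sets N")
    case True
    have YQ: "Y \<in> Q i \<rightarrow>\<^sub>M M" using Y Q(2)[OF i] by (simp cong: measurable_cong_sets)
    have D: "D \<in> sets (Q i)" using True Q(2)[OF i] by simp
    from event_density_exists[OF Q(1)[OF i] YQ D R.sigma_finite_measure_axioms RM ac[OF i]]
    show ?thesis unfolding is_dens_def by blast
  next
    case False
    then show ?thesis unfolding is_dens_def by (intro exI[of _ "\<lambda>_. 0"]) simp
  qed
  define r where "r i D = (SOME r. is_dens i D r)" for i D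
  have "is_dens i D (r i D)" if "i < n" for i D
    unfolding r_def by (rule someI_ex[OF ex[OF that]])
  then have rm[measurable]: "\<And>i D. i < n \<Longrightarrow> r i D \<in> borel_measurable M"
    and r0: "\<And>i D y. i < n \<Longrightarrow> 0 \<le> r i D y"
    and req: "\<And>i D h. i < n \<Longrightarrow> D \<in> sets N \<Longrightarrow> h \<in> borel_measurable M \<Longrightarrow>
      (\<integral>\<^sup>+w. h (Y w) * indicator D w \<partial>Q i) = (\<integral>\<^sup>+y. h y * ennreal (r i D y) \<partial>R)"
    unfolding is_dens_def by blast+
  define q where "q D y = (\<Sum>i<n. smult (r i D y) (c i))" for D y
  define f where "f t D y = ennreal (poly (q D y) t)" for t D y
  have q: "poly (q D y) t = (\<Sum>i<n. r i D y * poly (c i) t)" for D y t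
    by (simp add: q_def poly_sum)
  have q0: "0 \<le> poly (q D y) t" if "t \<in> {0..1}" for D y t
    unfolding q using that by (intro sum_nonneg mult_nonneg_nonneg r0 Q(3)) auto
  have iff: "ci_events (P t) M Y S T \<longleftrightarrow>
      (AE y in R. poly (q (S \<inter> T) y * q (space N) y - q S y * q T y) t = 0)" if t: "t \<in> {0..1}" for t
  proof -
    interpret Pt: prob_space "P t" by (rule P[OF t])
    have sp: "space (P t) = space N" by (rule sets_eq_imp_space_eq[OF sP[OF t]])
    have "ci_events (P t) M Y S T \<longleftrightarrow>
      (AE y in R. f t (S \<inter> T) y * f t (space (P t)) y = f t S y * f t T y)"
    proof (rule ci_events_iff_density[OF Pt.finite_measure_axioms YP[OF t] _ _ R.sigma_finite_measure_axioms RM])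
      show "S \<in> sets (P t)" "T \<in> sets (P t)" using S T sP[OF t] by simp_all
      show "f t D \<in> borel_measurable M" for D unfolding f_def q by measurable
      show "f t (space (P t)) y \<noteq> \<infinity>" for y by (simp add: f_def)
      fix D and h :: "_ \<Rightarrow> ennreal" assume "D \<in> sets (P t)" and h[measurable]: "h \<in> borel_measurable M"
      then have D[measurable]: "D \<in> sets N" using sP[OF t] by simp
      have "(\<integral>\<^sup>+w. h (Y w) * indicator D w \<partial>P t) =
        (\<Sum>i<n. ennreal (poly (c i) t) * (\<integral>\<^sup>+w. h (Y w) * indicator D w \<partial>Q i))"
        by (rule eq'[OF t]) measurable
      also have "\<dots> = (\<Sum>i<n. \<integral>\<^sup>+y. ennreal (poly (c i) t) * (h y * ennreal (r i D y)) \<partial>R)"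
        by (intro sum.cong refl) (simp add: req D h nn_integral_cmult)
      also have "\<dots> = (\<integral>\<^sup>+y. (\<Sum>i<n. ennreal (poly (c i) t) * (h y * ennreal (r i D y))) \<partial>R)"
        by (rule nn_integral_sum[symmetric]) simp
      also have "\<dots> = (\<integral>\<^sup>+y. h y * f t D y \<partial>R)"
      proof (rule nn_integral_cong)
        fix y
        have "f t D y = (\<Sum>i<n. ennreal (r i D y * poly (c i) t))"
          unfolding f_def q using t by (intro sum_ennreal[symmetric] mult_nonneg_nonneg r0 Q(3)) auto
        also have "\<dots> = (\<Sum>i<n. ennreal (r i D y) * ennreal (poly (c i) t))"
          using t by (intro sum.cong refl ennreal_mult r0 Q(3)) auto
        finally show "(\<Sum>i<n. ennreal (poly (c i) t) * (h y * ennreal (r i D y))) = h y * f t D y"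
          by (simp add: sum_distrib_left mult_ac)
      qed
      finally show "(\<integral>\<^sup>+w. h (Y w) * indicator D w \<partial>P t) = (\<integral>\<^sup>+y. h y * f t D y \<partial>R)" .
    qed
    also have "\<dots> \<longleftrightarrow> (AE y in R. poly (q (S \<inter> T) y * q (space N) y - q S y * q T y) t = 0)"
    proof -
      have "f t (S \<inter> T) y * f t (space (P t)) y = f t S y * f t T y \<longleftrightarrow>
        poly (q (S \<inter> T) y * q (space N) y - q S y * q T y) t = 0" for y
        unfolding f_def sp using q0[OF t] by (simp add: ennreal_mult[symmetric])
      then show ?thesis by simp
    qed
    finally show ?thesis .
  qed
  \<comment> \<open>The exceptional null set depends on \<open>t\<close>; a countable infinite set
    of times is selected so that the quantifier over \<open>t\<close> can be moved inside the almost
    everywhere statement.\<close>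
  obtain C where C: "C \<subseteq> {t \<in> {0..1}. ci_events (P t) M Y S T}" "countable C" "infinite C"
    using infinite_countable_subset'[OF inf] by blast
  have "AE y in R. \<forall>t\<in>C. poly (q (S \<inter> T) y * q (space N) y - q S y * q T y) t = 0"
  proof (rule AE_ball_countable'[OF _ C(2)])
    fix t assume "t \<in> C"
    then show "AE y in R. poly (q (S \<inter> T) y * q (space N) y - q S y * q T y) t = 0"
      using C(1) iff[of t] by auto
  qed
  then have "AE y in R. poly (q (S \<inter> T) y * q (space N) y - q S y * q T y) t1 = 0"
  proof eventually_elim
    case (elim y)
    let ?p = "q (S \<inter> T) y * q (space N) y - q S y * q T y"
    have "C \<subseteq> {t. poly ?p t = 0}" using elim by auto
    then have "infinite {t. poly ?p t = 0}" using C(3) finite_subset by blast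
    then have "?p = 0" using poly_roots_finite by blast
    then show ?case by simp
  qed
  then show ?thesis using iff[OF t1] by simp
qed

section \<open>Active paths\<close>

text \<open>The collider condition without indices: \<open>x\<close> stands between the prefix
  \<open>l\<close> and the suffix \<open>r\<close>. When paths are cut and joined, the status of a
  vertex can be read off from \<open>last l\<close> and \<open>hd r\<close>.\<close>

definition collides :: "('v \<times> 'v) set \<Rightarrow> 'v list \<Rightarrow> 'v \<Rightarrow> 'v list \<Rightarrow> bool" where
  "collides E l x r \<longleftrightarrow> l \<noteq> [] \<and> r \<noteq> [] \<and> (last l, x) \<in> E \<and> (hd r, x) \<in> E"

lemma collider_split: "collider E (l @ x # r) (length l) \<longleftrightarrow> collides E l x r"
  by (cases l rule: rev_cases; cases r) (auto simp: collider_def collides_def nth_append)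

lemma blocked_iff_split:
  "blocked E C p \<longleftrightarrow> (\<exists>l x r. p = l @ x # r \<and> (collides E l x r \<and> x \<notin> ancestors E C \<or> \<not> collides E l x r \<and> x \<in> C))"
proof
  assume "blocked E C p"
  then obtain i where i: "i < length p"
    and b: "(collider E p i \<and> p ! i \<notin> ancestors E C) \<or> (\<not> collider E p i \<and> p ! i \<in> C)"
    by (auto simp: blocked_def)
  let ?l = "take i p" and ?r = "drop (Suc i) p"
  have p: "p = ?l @ p ! i # ?r" using i by (rule id_take_nth_drop)
  have "collider E p i \<longleftrightarrow> collides E ?l (p ! i) ?r"
    using collider_split[of E ?l "p ! i" ?r] p i by simp
  then show "\<exists>l x r. p = l @ x # r \<and> (collides E l x r \<and> x \<notin> ancestors E C \<or> \<not> collides E l x r \<and> x \<in> C)"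
    using b p by (intro exI[of _ ?l] exI[of _ "p ! i"] exI[of _ ?r]) auto
next
  assume "\<exists>l x r. p = l @ x # r \<and> (collides E l x r \<and> x \<notin> ancestors E C \<or> \<not> collides E l x r \<and> x \<in> C)"
  then obtain l x r where "p = l @ x # r" "collides E l x r \<and> x \<notin> ancestors E C \<or> \<not> collides E l x r \<and> x \<in> C"
    by blast
  then show "blocked E C p"
    using collider_split[of E l x r]
    by (auto simp: blocked_def intro!: exI[of _ "length l"] )
qed

lemma not_blockedD:
  assumes "\<not> blocked E C (l @ x # r)"
  shows "collides E l x r \<Longrightarrow> x \<in> ancestors E C" "\<not> collides E l x r \<Longrightarrow> x \<notin> C"
  using assms unfolding blocked_iff_split by blast+

lemma not_blockedI:
  assumes "\<And>l x r. p = l @ x # r \<Longrightarrow> collides E l x r \<Longrightarrow> x \<in> ancestors E C"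
    and "\<And>l x r. p = l @ x # r \<Longrightarrow> \<not> collides E l x r \<Longrightarrow> x \<notin> C"
  shows "\<not> blocked E C p"
  using assms unfolding blocked_iff_split by blast

lemma is_path_Cons:
  "is_path V E (x # p) \<longleftrightarrow> x \<in> V \<and> (p = [] \<or>
     x \<notin> set p \<and> is_path V E p \<and> ((x, hd p) \<in> E \<or> (hd p, x) \<in> E))"
proof (cases p)
  case (Cons y q)
  have "(\<forall>i. Suc i < length (x # p) \<longrightarrow> ((x # p) ! i, (x # p) ! Suc i) \<in> E \<or> ((x # p) ! Suc i, (x # p) ! i) \<in> E)
    \<longleftrightarrow> ((x, hd p) \<in> E \<or> (hd p, x) \<in> E) \<and>
      (\<forall>i. Suc i < length p \<longrightarrow> (p ! i, p ! Suc i) \<in> E \<or> (p ! Suc i, p ! i) \<in> E)"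
    (is "?L \<longleftrightarrow> ?R")
  proof
    assume L: ?L
    show ?R
      using L[rule_format, of 0] L[rule_format, of "Suc i" for i] Cons by auto
  next
    assume R: ?R
    show ?L
    proof (intro allI impI)
      fix i assume "Suc i < length (x # p)"
      then show "((x # p) ! i, (x # p) ! Suc i) \<in> E \<or> ((x # p) ! Suc i, (x # p) ! i) \<in> E"
        using R Cons by (cases i) auto
    qed
  qed
  then show ?thesis by (auto simp: is_path_def Cons)
qed (auto simp: is_path_def)

lemma is_path_append:
  "p \<noteq> [] \<Longrightarrow> q \<noteq> [] \<Longrightarrow> is_path V E (p @ q) \<longleftrightarrow> is_path V E p \<and> is_path V E q \<and>
     set p \<inter> set q = {} \<and> ((last p, hd q) \<in> E \<or> (hd q, last p) \<in> E)"
  by (induction p) (auto simp: is_path_Cons)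

lemma is_path_rev: "is_path V E (rev p) \<longleftrightarrow> is_path V E p"
proof (induction p)
  case (Cons x p)
  then show ?case
    by (cases "p = []") (auto simp: is_path_append is_path_Cons last_rev hd_rev)
qed simp

lemma blocked_rev: "blocked E C (rev p) \<longleftrightarrow> blocked E C p"
proof -
  have "blocked E C (rev p)" if "blocked E C p" for p
  proof -
    obtain l x r where p: "p = l @ x # r" "collides E l x r \<and> x \<notin> ancestors E C \<or> \<not> collides E l x r \<and> x \<in> C"
      using \<open>blocked E C p\<close> unfolding blocked_iff_split by blast
    have "collides E (rev r) x (rev l) \<longleftrightarrow> collides E l x r"
      by (auto simp: collides_def last_rev hd_rev)
    with p show ?thesis unfolding blocked_iff_split
      by (intro exI[of _ "rev r"] exI[of _ x] exI[of _ "rev l"]) simp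
  qed
  from this[of p] this[of "rev p"] show ?thesis by auto
qed

lemma d_separated_commute: "d_separated V E A B C \<Longrightarrow> d_separated V E B A C"
  unfolding d_separated_def
  by (metis blocked_rev is_path_rev hd_rev last_rev is_path_def)

lemma d_separated_mono:
  "d_separated V E A B C \<Longrightarrow> V' \<subseteq> V \<Longrightarrow> A' \<subseteq> A \<Longrightarrow> B' \<subseteq> B \<Longrightarrow> d_separated V' E A' B' C"
  unfolding d_separated_def is_path_def by blast

lemma ancestors_mono: "C \<subseteq> C' \<Longrightarrow> ancestors E C \<subseteq> ancestors E C'"
  by (auto simp: ancestors_def)

lemma ancestors_step: "(x, y) \<in> E \<Longrightarrow> y \<in> ancestors E C \<Longrightarrow> x \<in> ancestors E C"
  by (auto simp: ancestors_def intro: converse_rtrancl_into_rtrancl)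

lemma ancestors_self: "x \<in> C \<Longrightarrow> x \<in> ancestors E C"
  by (auto simp: ancestors_def)

section \<open>d-separation in the presence of a sink\<close>

lemma is_path_sink:
  assumes path: "is_path V E (l @ v # r)" and child: "\<And>w. w \<in> V \<Longrightarrow> (v, w) \<notin> E"
  shows "l \<noteq> [] \<Longrightarrow> (last l, v) \<in> E" "r \<noteq> [] \<Longrightarrow> (hd r, v) \<in> E"
proof -
  have V: "set l \<subseteq> V" "set r \<subseteq> V" using path by (auto simp: is_path_def)
  show "(last l, v) \<in> E" if l: "l \<noteq> []"
  proof -
    have "last l \<in> V" using V last_in_set[OF l] by blast
    then show ?thesis using path l child[of "last l"] by (subst (asm) is_path_append) auto
  qed
  show "(hd r, v) \<in> E" if r: "r \<noteq> []"
  proof -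
    have "is_path V E (v # r)"
      using path by (cases "l = []") (simp, subst (asm) is_path_append, auto)
    moreover have "hd r \<in> V" using V hd_in_set[OF r] by blast
    ultimately show ?thesis using r child[of "hd r"] by (auto simp: is_path_Cons)
  qed
qed

text \<open>A path from a parent of \<open>v\<close> is prolonged by \<open>v\<close> itself. The
  new endpoint is a non-collider outside \<open>C\<close>, and the parent remains a non-collider
  because \<open>v\<close> has no outgoing edge. So whatever blocks the longer path already blocks
  the shorter one.\<close>

lemma d_separated_parents:
  assumes sep: "d_separated (insert v U) E (insert v A) B C"
    and v: "v \<notin> U" "v \<notin> C" and child: "\<And>w. w \<in> insert v U \<Longrightarrow> (v, w) \<notin> E"
  shows "d_separated U E (A \<union> parents E v) B C"
  unfolding d_separated_def
proof (intro allI impI, elim conjE)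
  fix p assume p: "is_path U E p" and hd: "hd p \<in> A \<union> parents E v" and last: "last p \<in> B"
  have ne: "p \<noteq> []" using p by (auto simp: is_path_def)
  have p': "is_path (insert v U) E p" using p by (auto simp: is_path_def)
  show "blocked E C p"
  proof (cases "hd p \<in> A")
    case True
    then show ?thesis using sep last p' by (auto simp: d_separated_def)
  next
    case False
    then have E: "(hd p, v) \<in> E" using hd by (auto simp: parents_def)
    have "v \<notin> set p" using p v by (auto simp: is_path_def)
    then have "is_path (insert v U) E (v # p)" using p' E by (auto simp: is_path_Cons)
    then have "blocked E C (v # p)" using sep last ne by (auto simp: d_separated_def)
    then obtain l x r where eq: "v # p = l @ x # r"
      and b: "collides E l x r \<and> x \<notin> ancestors E C \<or> \<not> collides E l x r \<and> x \<in> C"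
      unfolding blocked_iff_split by blast
    show ?thesis
    proof (cases l)
      case Nil
      then show ?thesis using eq b v by (auto simp: collides_def)
    next
      case (Cons y l')
      with eq have y: "y = v" and p: "p = l' @ x # r" by auto
      have "x \<in> U" using p \<open>is_path U E _\<close> by (auto simp: is_path_def)
      then have "collides E l x r \<longleftrightarrow> collides E l' x r"
        using child by (cases "l' = []") (auto simp: Cons y collides_def)
      with b p show ?thesis unfolding blocked_iff_split by blast
    qed
  qed
qed

text \<open>The path leaves \<open>w\<close> forwards and follows edges forwards until it reaches
  its last vertex, which is in \<open>C'\<close>, or a collider, which is an ancestor of
  \<open>C\<close> since the path is active. In both cases \<open>w\<close> has a descendant in
  \<open>C'\<close>.\<close>

lemma directed_descent:
  assumes "is_path V E (l @ w # r)" "\<not> blocked E C (l @ w # r)" "r \<noteq> []" "(w, hd r) \<in> E"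
    and "last r \<in> C'" "C \<subseteq> C'"
  shows "w \<in> ancestors E C'"
  using assms
proof (induction r arbitrary: l w)
  case (Cons z r)
  show ?case
  proof (cases r)
    case Nil
    then show ?thesis using Cons.prems by (auto intro: ancestors_step ancestors_self)
  next
    case (Cons z2 r')
    have path: "is_path V E ((l @ [w]) @ z # r)" and nb: "\<not> blocked E C ((l @ [w]) @ z # r)"
      using Cons.prems by simp_all
    have "is_path V E (z # r)" using path by (subst (asm) is_path_append) auto
    then have adj: "(z, z2) \<in> E \<or> (z2, z) \<in> E" by (auto simp: is_path_Cons Cons)
    have wz: "(w, z) \<in> E" using Cons.prems by simp
    have "z \<in> ancestors E C'"
    proof (cases "(z2, z) \<in> E")
      case True
      then have "collides E (l @ [w]) z r" using wz by (auto simp: collides_def Cons)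
      then show ?thesis using not_blockedD(1)[OF nb] ancestors_mono[OF Cons.prems(6)] by blast
    next
      case False
      then show ?thesis using adj Cons Cons.prems by (intro Cons.IH[OF path nb]) auto
    qed
    then show ?thesis using wz by (rule ancestors_step[rotated])
  qed
qed simp

text \<open>A path active given \<open>C\<close> from \<open>A\<close> to the sink \<open>v\<close> and one from \<open>v\<close> to \<open>B\<close> are joined where the
  first path meets the second for the first time; the sink acts as an opened collider.\<close>

lemma d_separated_insert_sink:
  assumes sep: "d_separated (insert v U) E A B (insert v C)"
    and AB: "A \<subseteq> U" "B \<subseteq> U" and v: "v \<notin> U" "v \<notin> ancestors E C" and child: "\<And>w. w \<in> insert v U \<Longrightarrow> (v, w) \<notin> E"
  shows "d_separated (insert v U) E (insert v A) B C \<or> d_separated (insert v U) E A (insert v B) C"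
proof (rule ccontr)
  assume "\<not> ?thesis"
  then obtain s p where s: "is_path (insert v U) E s" "hd s \<in> insert v A" "last s \<in> B" "\<not> blocked E C s"
    and p: "is_path (insert v U) E p" "hd p \<in> A" "last p \<in> insert v B" "\<not> blocked E C p"
    by (auto simp: d_separated_def)
  have "C \<subseteq> insert v C" by blast
  note anc = ancestors_mono[OF this, of E]
  \<comment> \<open>A path between \<open>A\<close> and \<open>B\<close> can meet the sink only in
    its interior, where the sink is a collider. Conditioning on \<open>v\<close> opens it, so a path
    active given \<open>C\<close> would contradict \<open>sep\<close>. Hence \<open>s\<close> starts
    in \<open>v\<close> and \<open>p\<close> ends in \<open>v\<close>.\<close>
  have no_AB: False if q: "is_path (insert v U) E q" "hd q \<in> A" "last q \<in> B" "\<not> blocked E C q" for q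
  proof -
    have "\<not> blocked E (insert v C) q"
    proof (rule not_blockedI)
      fix l x r assume eq: "q = l @ x # r"
      note nb = not_blockedD[OF q(4)[unfolded eq]]
      show "x \<in> ancestors E (insert v C)" if "collides E l x r" using nb(1)[OF that] anc by blast
      show "x \<notin> insert v C" if c: "\<not> collides E l x r"
      proof
        assume "x \<in> insert v C"
        then have x: "x = v" using nb(2)[OF c] by simp
        have l: "l \<noteq> []" using q(2) x AB v by (auto simp: eq)
        have r: "r \<noteq> []" using q(3) x AB v by (auto simp: eq)
        from is_path_sink[OF q(1)[unfolded eq x] child] show False
          using c l r x by (auto simp: collides_def)
      qed
    qed
    then show False using sep q by (auto simp: d_separated_def)
  qed
  have hs: "hd s = v" using no_AB[OF s(1) _ s(3,4)] s(2) by blast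
  have lp: "last p = v" using no_AB[OF p(1,2) _ p(4)] p(3) by blast
  have sne: "s \<noteq> []" and pne: "p \<noteq> []" using s p by (auto simp: is_path_def)
  have "\<exists>w\<in>set p. w \<in> set s" using hs lp sne pne by (metis hd_in_set last_in_set)
  from split_list_first_prop[OF this] obtain p1 w p2
    where peq: "p = p1 @ w # p2" and ws: "w \<in> set s" and p1: "\<forall>y\<in>set p1. y \<notin> set s" by blast
  obtain s1 s2 where seq: "s = s1 @ w # s2" using ws by (meson split_list)
  let ?q = "p1 @ w # s2"
  have pw: "is_path (insert v U) E (w # p2)" "is_path (insert v U) E (w # s2)"
    using p(1) s(1) unfolding peq seq
    by (metis append_Nil is_path_append list.distinct(1))+
  have pq: "is_path (insert v U) E ?q"
  proof (cases "p1 = []")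
    case False
    then show ?thesis using p(1) pw p1 unfolding peq by (subst is_path_append; subst (asm) is_path_append) (auto simp: seq)
  qed (use pw in simp)
  have hq: "hd ?q \<in> A" using p(2) by (cases p1) (auto simp: peq)
  have lq: "last ?q \<in> B" using s(3) by (simp add: seq)
  note nbp = not_blockedD[OF p(4)[unfolded peq]] and nbs = not_blockedD[OF s(4)[unfolded seq]]
  have w_v: "p2 = [] \<longleftrightarrow> w = v" "s1 = [] \<longleftrightarrow> w = v"
    using lp hs p(1) s(1) by (cases p2 rule: rev_cases; cases s1; auto simp: peq seq is_path_def)+
  have v_or: "w = v \<Longrightarrow> collides E p1 w s2"
  proof -
    assume w: "w = v"
    have n: "p1 \<noteq> []" using p(2) w AB v by (auto simp: peq)
    have n2: "s2 \<noteq> []" using lq w AB v by auto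
    from is_path_sink[OF pq[unfolded w] child] show ?thesis using n n2 w by (auto simp: collides_def)
  qed
  \<comment> \<open>Joining may turn \<open>w\<close> into a collider that it was not on
    \<open>p\<close>. Then \<open>p\<close> left \<open>w\<close> by an outgoing edge, and
    descending along \<open>p\<close> leads to \<open>v\<close> or to an element of
    \<open>C\<close>.\<close>
  have w_coll: "w \<in> ancestors E (insert v C)" if c: "collides E p1 w s2"
  proof (cases "collides E p1 w p2")
    case True
    then show ?thesis using nbp(1) anc by blast
  next
    case False
    show ?thesis
    proof (cases "w = v")
      case False
      then have p2: "p2 \<noteq> []" using w_v by simp
      then have "(w, hd p2) \<in> E"
        using \<open>\<not> collides E p1 w p2\<close> c pw(1) by (auto simp: collides_def is_path_Cons)
      then show ?thesis
        using p p2 lp by (intro directed_descent[of "insert v U" E p1 w p2 C]) (auto simp: peq)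
    qed (simp add: ancestors_self)
  qed
  \<comment> \<open>On the joined path one of the edges at \<open>w\<close> is missing or does not
    point into \<open>w\<close>. The path that contributes this side, \<open>p\<close> on the left
    or \<open>s\<close> on the right, then already has \<open>w\<close> as a non-collider.\<close>
  have w_nc: "w \<notin> insert v C" if c: "\<not> collides E p1 w s2"
  proof -
    have "w \<noteq> v" using v_or c by blast
    moreover have "\<not> collides E p1 w p2 \<or> \<not> collides E s1 w s2"
      using c by (auto simp: collides_def)
    then have "w \<notin> C" using nbp(2) nbs(2) by blast
    ultimately show ?thesis by simp
  qed
  have inU: "x \<noteq> v" if "x \<in> set p1" for x
    using that p1 hs sne by (metis hd_in_set)
  have inU2: "x \<noteq> v" if "x \<in> set s2" for x
    using that s(1) hs by (cases s1) (auto simp: seq is_path_def)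
  have "\<not> blocked E (insert v C) ?q"
  proof -
    have *: "if collides E l x r then x \<in> ancestors E (insert v C) else x \<notin> insert v C"
      if eq: "?q = l @ x # r" for l x r
    proof -
      consider r' where "p1 = l @ x # r'" "r = r' @ w # s2" | "p1 = l" "x = w" "r = s2"
        | l' where "l = p1 @ w # l'" "s2 = l' @ x # r"
        using eq by (auto simp: append_eq_append_conv2 Cons_eq_append_conv append_eq_Cons_conv)
      then show ?thesis
      proof cases
        case 1
        have "collides E l x r \<longleftrightarrow> collides E l x (r' @ w # p2)"
          using 1 by (cases r') (auto simp: collides_def)
        moreover have "p = l @ x # (r' @ w # p2)" using 1 by (simp add: peq)
        ultimately show ?thesis
          using not_blockedD[of E C l x "r' @ w # p2"] p(4) anc inU[of x] 1 by auto
      next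
        case 2
        then show ?thesis using w_coll w_nc by auto
      next
        case 3
        have "collides E l x r \<longleftrightarrow> collides E (s1 @ w # l') x r"
          using 3 by (cases l' rule: rev_cases) (auto simp: collides_def)
        moreover have "s = (s1 @ w # l') @ x # r" using 3 by (simp add: seq)
        ultimately show ?thesis
          using not_blockedD[of E C "s1 @ w # l'" x r] s(4) anc inU2[of x] 3 by auto
      qed
    qed
    show ?thesis by (rule not_blockedI) (use * in \<open>metis\<close>)+
  qed
  then show False using sep pq hq lq by (auto simp: d_separated_def)
qed

section \<open>Conditional independence of coordinates\<close>

text \<open>This form of \<open>X\<^sub>A \<bottom> X\<^sub>B | X\<^sub>C\<close> says that \<open>P(X\<^sub>B \<in> T | X\<^sub>A, X\<^sub>C)\<close> is a function of \<open>X\<^sub>C\<close> alone.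
  It depends on \<open>A\<close> only through \<open>A \<union> C\<close>, which makes weak union immediate; symmetry is then the
  only nontrivial graphoid property.\<close>

definition coord_ci ::
  "('v \<Rightarrow> 'a set) \<Rightarrow> ('v \<Rightarrow> 'a \<Rightarrow> 'a \<Rightarrow> real) \<Rightarrow> ('v \<Rightarrow> 'a) measure \<Rightarrow> 'v set \<Rightarrow> 'v set \<Rightarrow> 'v set \<Rightarrow> bool"
  where
  "coord_ci X d P A B C \<longleftrightarrow> (\<forall>T\<in>sets (coord_space X d B). \<exists>g\<in>borel_measurable (coord_space X d C).
     (\<forall>y. g y \<le> (1 :: ennreal)) \<and> (\<forall>h\<in>borel_measurable (coord_space X d (A \<union> C)).
       (\<integral>\<^sup>+x. h (restrict x (A \<union> C)) * indicator T (restrict x B) \<partial>P) =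
       (\<integral>\<^sup>+x. h (restrict x (A \<union> C)) * g (restrict x C) \<partial>P)))"

lemma coord_ciE:
  assumes ci: "coord_ci X d P A B C" and T: "T \<in> sets (coord_space X d B)"
  obtains g where "g \<in> borel_measurable (coord_space X d C)" "\<forall>y. g y \<le> (1 :: ennreal)"
    "\<forall>h\<in>borel_measurable (coord_space X d (A \<union> C)).
       (\<integral>\<^sup>+x. h (restrict x (A \<union> C)) * indicator T (restrict x B) \<partial>P) =
       (\<integral>\<^sup>+x. h (restrict x (A \<union> C)) * g (restrict x C) \<partial>P)"
  using bspec[OF ci[unfolded coord_ci_def] T] by (elim bexE conjE)

lemma measurable_restrict_coord:
  "A \<subseteq> V \<Longrightarrow> (\<lambda>x. restrict x A) \<in> coord_space X d V \<rightarrow>\<^sub>M coord_space X d A"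
  unfolding coord_space_def by (rule measurable_restrict_subset)

lemma coord_event_sets:
  assumes "sets P = sets (coord_space X d V)" "A \<subseteq> V" "S \<in> sets (coord_space X d A)"
  shows "coord_event P A S \<in> sets P"
proof -
  have "(\<lambda>x. restrict x A) \<in> P \<rightarrow>\<^sub>M coord_space X d A"
    using measurable_restrict_coord[OF assms(2)] assms(1) by (simp cong: measurable_cong_sets)
  from measurable_sets[OF this assms(3)] show ?thesis
    by (simp add: coord_event_def vimage_def Int_def conj_commute)
qed

lemma cond_indep_iff_ci_events:
  assumes P: "prob_space P" and sP: "sets P = sets (coord_space X d V)"
    and ABC: "A \<subseteq> V" "B \<subseteq> V" "C \<subseteq> V"
  shows "cond_indep X d P A B C \<longleftrightarrow>
    (\<forall>S\<in>sets (coord_space X d A). \<forall>T\<in>sets (coord_space X d B).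
      ci_events P (coord_space X d C) (\<lambda>x. restrict x C) (coord_event P A S) (coord_event P B T))"
proof -
  interpret prob_space P by fact
  have "(\<lambda>x. restrict x C) \<in> P \<rightarrow>\<^sub>M coord_space X d C"
    using measurable_restrict_coord[OF ABC(3)] sP by (simp cong: measurable_cong_sets)
  from ci_events_iff_real_cond_exp[OF finite_measure_axioms this] show ?thesis
    unfolding cond_indep_def cond_prob_given_def
    using coord_event_sets[OF sP ABC(1)] coord_event_sets[OF sP ABC(2)] by simp
qed

text \<open>Boxes generate the product sigma-algebra and are closed under intersection, so the
  push-forwards of the measures with densities \<open>u\<close> and \<open>u'\<close> agree; the
  bound on \<open>u\<close> supplies the finiteness that this uniqueness argument requires.\<close>

lemma nn_integral_eq_on_boxes:
  assumes I: "finite I" and P: "finite_measure P"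
    and Y[measurable]: "(\<lambda>x. restrict x I) \<in> P \<rightarrow>\<^sub>M coord_space X d I"
    and u[measurable]: "u \<in> borel_measurable P" and u'[measurable]: "u' \<in> borel_measurable P"
    and u1: "\<And>x. u x \<le> (1 :: ennreal)"
    and eq: "\<And>F. (\<And>i. i \<in> I \<Longrightarrow> F i \<in> sets (metric_borel (X i) (d i))) \<Longrightarrow>
       (\<integral>\<^sup>+x. indicator (PiE I F) (restrict x I) * u x \<partial>P) =
       (\<integral>\<^sup>+x. indicator (PiE I F) (restrict x I) * u' x \<partial>P)"
    and h[measurable]: "h \<in> borel_measurable (coord_space X d I)"
  shows "(\<integral>\<^sup>+x. h (restrict x I) * u x \<partial>P) = (\<integral>\<^sup>+x. h (restrict x I) * u' x \<partial>P)"
proof -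
  interpret finite_measure P by fact
  let ?M = "\<lambda>u. distr (density P u) (coord_space X d I) (\<lambda>x. restrict x I)"
  have M: "(\<integral>\<^sup>+y. h y \<partial>?M u) = (\<integral>\<^sup>+x. h (restrict x I) * u x \<partial>P)"
    if [measurable]: "h \<in> borel_measurable (coord_space X d I)" "u \<in> borel_measurable P" for h u
    by (simp add: nn_integral_distr nn_integral_density mult.commute)
  have E: "emeasure (?M u) F = (\<integral>\<^sup>+x. indicator F (restrict x I) * u x \<partial>P)"
    if F[measurable]: "F \<in> sets (coord_space X d I)" and u: "u \<in> borel_measurable P" for F u
    using M[of "indicator F" u] u F by simp
  let ?B = "\<lambda>i. metric_borel (X i) (d i)"
  have box: "PiE I F \<in> sets (coord_space X d I)" if "\<And>i. i \<in> I \<Longrightarrow> F i \<in> sets (?B i)" for F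
    unfolding coord_space_def using that I by (intro sets_PiM_I_finite)
  have "?M u = ?M u'"
  proof (rule measure_eqI_PiM_finite[OF I])
    show "sets (?M u) = sets (PiM I ?B)" "sets (?M u') = sets (PiM I ?B)"
      by (simp_all add: coord_space_def)
    show "emeasure (?M u) (PiE I F) = emeasure (?M u') (PiE I F)" if "\<And>i. i \<in> I \<Longrightarrow> F i \<in> sets (?B i)" for F
      using that by (simp only: E box u u' eq)
    show "range (\<lambda>_::nat. PiE I X) \<subseteq> prod_algebra I ?B"
      using prod_algebraI_finite[OF I, of X ?B] sets.top[of "?B _"] by auto
    show "(\<Union>i::nat. PiE I X) = space (PiM I ?B)" by (simp add: space_PiM)
    have top: "PiE I X \<in> sets (coord_space X d I)" using sets.top[of "coord_space X d I"]
      by (simp add: space_coord_space)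
    have "emeasure (?M u) (PiE I X) \<le> (\<integral>\<^sup>+x. 1 \<partial>P)"
      unfolding E[OF top u] using u1
      by (intro nn_integral_mono mult_le_one_ennreal) (auto simp: indicator_def)
    also have "\<dots> < \<infinity>" by (simp add: less_top[symmetric])
    finally show "emeasure (?M u) (PiE I X) \<noteq> \<infinity>" by simp
  qed
  then show ?thesis using M[OF h u] M[OF h u'] by simp
qed

text \<open>From left to right, a function of X_C times the indicator of X_A in \<open>S\<close> is
  an admissible test function. From right to left, it suffices to test on boxes over
  \<open>A \<union> C\<close>, and these split into a factor over \<open>A\<close> and one over
  \<open>C\<close>, to which independence of events applies.\<close>

lemma coord_ci_iff_cond_indep:
  assumes V: "finite V" and P: "prob_space P" and sP: "sets P = sets (coord_space X d V)"
    and ABC: "A \<subseteq> V" "B \<subseteq> V" "C \<subseteq> V"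
  shows "coord_ci X d P A B C \<longleftrightarrow> cond_indep X d P A B C"
proof -
  interpret P: prob_space P by fact
  note fP = P.finite_measure_axioms
  let ?M = "coord_space X d"
  let ?Y = "\<lambda>A x. restrict x A"
  have Y[measurable]: "?Y A \<in> P \<rightarrow>\<^sub>M ?M A" if "A \<subseteq> V" for A
    using measurable_restrict_coord[OF that] sP by (simp cong: measurable_cong_sets)
  note Ym[measurable] = Y[OF ABC(1)] Y[OF ABC(2)] Y[OF ABC(3)]
  have ACV: "A \<union> C \<subseteq> V" using ABC by simp
  note [measurable] = Y[OF ACV]
  have ind: "indicator (coord_event P A S) x = (indicator S (?Y A x) :: ennreal)" if "x \<in> space P" for A S x
    using that by (simp add: coord_event_def indicator_def)
  have cv: "cond_version P (?M C) (?Y C) (coord_event P D S) g \<longleftrightarrow> g \<in> borel_measurable (?M C) \<and> (\<forall>y. g y \<le> 1) \<and>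
     (\<forall>h\<in>borel_measurable (?M C). (\<integral>\<^sup>+x. h (?Y C x) * indicator S (?Y D x) \<partial>P) = (\<integral>\<^sup>+x. h (?Y C x) * g (?Y C x) \<partial>P))"
    for D S g
    unfolding cond_version_def by (simp add: ind cong: nn_integral_cong)
  have cv2: "cond_version P (?M C) (?Y C) (coord_event P D S \<inter> coord_event P D' S') g \<longleftrightarrow> g \<in> borel_measurable (?M C) \<and> (\<forall>y. g y \<le> 1) \<and>
     (\<forall>h\<in>borel_measurable (?M C). (\<integral>\<^sup>+x. h (?Y C x) * (indicator S (?Y D x) * indicator S' (?Y D' x)) \<partial>P) = (\<integral>\<^sup>+x. h (?Y C x) * g (?Y C x) \<partial>P))"
    for D S D' S' g
    unfolding cond_version_def by (simp add: ind indicator_inter_arith cong: nn_integral_cong)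
  show ?thesis
    unfolding cond_indep_iff_ci_events[OF P sP ABC]
  proof (intro iffI ballI)
    fix S T assume ci: "coord_ci X d P A B C"
      and S[measurable]: "S \<in> sets (?M A)" and T[measurable]: "T \<in> sets (?M B)"
    obtain g where g[measurable]: "g \<in> borel_measurable (?M C)" and g1: "\<forall>y. g y \<le> (1 :: ennreal)"
      and eq: "\<forall>h\<in>borel_measurable (?M (A \<union> C)).
       (\<integral>\<^sup>+x. h (?Y (A \<union> C) x) * indicator T (?Y B x) \<partial>P) =
       (\<integral>\<^sup>+x. h (?Y (A \<union> C) x) * g (?Y C x) \<partial>P)"
      by (rule coord_ciE[OF ci T])
    note g1 = g1[rule_format] and eq = bspec[OF eq]
    have [measurable]: "?Y A \<in> ?M (A \<union> C) \<rightarrow>\<^sub>M ?M A" "?Y C \<in> ?M (A \<union> C) \<rightarrow>\<^sub>M ?M C"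
      by (auto intro: measurable_restrict_coord)
    have rr: "?Y A (?Y (A \<union> C) x) = ?Y A x" "?Y C (?Y (A \<union> C) x) = ?Y C x" for x :: "'a \<Rightarrow> 'b"
      by (auto simp: restrict_def)
    have T': "cond_version P (?M C) (?Y C) (coord_event P B T) g"
      unfolding cv
    proof (intro conjI ballI allI g g1)
      fix h :: "_ \<Rightarrow> ennreal" assume h[measurable]: "h \<in> borel_measurable (?M C)"
      from eq[of "\<lambda>x. h (?Y C x)"]
      show "(\<integral>\<^sup>+x. h (?Y C x) * indicator T (?Y B x) \<partial>P) = (\<integral>\<^sup>+x. h (?Y C x) * g (?Y C x) \<partial>P)"
        by (simp add: rr)
    qed
    obtain e where e: "cond_version P (?M C) (?Y C) (coord_event P A S) e"
      using cond_version_exists[OF fP Y[OF ABC(3)] coord_event_sets[OF sP ABC(1) S]] by blast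
    note em[measurable] = cond_versionD(1)[OF e]
    have "cond_version P (?M C) (?Y C) (coord_event P A S \<inter> coord_event P B T) (\<lambda>y. e y * g y)"
      unfolding cv2
    proof (intro conjI ballI allI mult_le_one_ennreal g1 cond_versionD(2)[OF e])
      fix h :: "_ \<Rightarrow> ennreal" assume h[measurable]: "h \<in> borel_measurable (?M C)"
      have "(\<integral>\<^sup>+x. h (?Y C x) * (indicator S (?Y A x) * indicator T (?Y B x)) \<partial>P)
        = (\<integral>\<^sup>+x. h (?Y C x) * indicator S (?Y A x) * g (?Y C x) \<partial>P)"
        using eq[of "\<lambda>x. h (?Y C x) * indicator S (?Y A x)"] by (simp add: rr mult.assoc)
      also have "\<dots> = (\<integral>\<^sup>+x. h (?Y C x) * (e (?Y C x) * g (?Y C x)) \<partial>P)"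
        using e unfolding cv by (auto dest!: bspec[of _ _ "\<lambda>y. h y * g y"] simp: mult_ac)
      finally show "(\<integral>\<^sup>+x. h (?Y C x) * (indicator S (?Y A x) * indicator T (?Y B x)) \<partial>P)
        = (\<integral>\<^sup>+x. h (?Y C x) * (e (?Y C x) * g (?Y C x)) \<partial>P)" .
    qed simp
    with e T' show "ci_events P (?M C) (?Y C) (coord_event P A S) (coord_event P B T)"
      by (auto simp: ci_events_def)
  next
    assume ci: "\<forall>S\<in>sets (?M A). \<forall>T\<in>sets (?M B). ci_events P (?M C) (?Y C) (coord_event P A S) (coord_event P B T)"
    show "coord_ci X d P A B C"
      unfolding coord_ci_def
    proof
      fix T assume T[measurable]: "T \<in> sets (?M B)"
      obtain g where g: "cond_version P (?M C) (?Y C) (coord_event P B T) g"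
        using cond_version_exists[OF fP Y[OF ABC(3)] coord_event_sets[OF sP ABC(2) T]] by blast
      note gm[measurable] = cond_versionD(1)[OF g]
      show "\<exists>g\<in>borel_measurable (?M C). (\<forall>y. g y \<le> (1 :: ennreal)) \<and> (\<forall>h\<in>borel_measurable (?M (A \<union> C)).
       (\<integral>\<^sup>+x. h (?Y (A \<union> C) x) * indicator T (?Y B x) \<partial>P) =
       (\<integral>\<^sup>+x. h (?Y (A \<union> C) x) * g (?Y C x) \<partial>P))"
      proof (intro bexI[of _ g] conjI allI ballI cond_versionD(2)[OF g] gm)
        fix h :: "('a \<Rightarrow> 'b) \<Rightarrow> ennreal" assume h: "h \<in> borel_measurable (?M (A \<union> C))"
        show "(\<integral>\<^sup>+x. h (?Y (A \<union> C) x) * indicator T (?Y B x) \<partial>P) =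
          (\<integral>\<^sup>+x. h (?Y (A \<union> C) x) * g (?Y C x) \<partial>P)"
        proof (rule nn_integral_eq_on_boxes[OF _ fP Y[OF ACV] _ _ _ _ h])
          show "finite (A \<union> C)" using V ABC by (auto intro: finite_subset)
          fix F assume F: "\<And>i. i \<in> A \<union> C \<Longrightarrow> F i \<in> sets (metric_borel (X i) (d i))"
          have fin: "finite A" "finite C" using V ABC by (auto intro: finite_subset)
          have A[measurable]: "PiE A F \<in> sets (?M A)" and C[measurable]: "PiE C F \<in> sets (?M C)"
            unfolding coord_space_def using F fin by (auto intro!: sets_PiM_I_finite)
          \<comment> \<open>\<open>A\<close> and \<open>C\<close> may overlap. The sides over common
            indices then occur in both factors, which is harmless as indicators are
            idempotent.\<close>
          have box: "indicator (PiE (A \<union> C) F) (?Y (A \<union> C) x) =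
              (indicator (PiE C F) (?Y C x) * indicator (PiE A F) (?Y A x) :: ennreal)" for x
            by (auto simp: indicator_def restrict_PiE_iff)
          obtain e where e: "cond_version P (?M C) (?Y C) (coord_event P A (PiE A F)) e"
            using cond_version_exists[OF fP Y[OF ABC(3)] coord_event_sets[OF sP ABC(1) A]] by blast
          note em[measurable] = cond_versionD(1)[OF e]
          have eg: "cond_version P (?M C) (?Y C) (coord_event P A (PiE A F) \<inter> coord_event P B T) (\<lambda>y. e y * g y)"
            using ci A T by (intro ci_eventsD[OF fP Y[OF ABC(3)] _ e g]) auto
          have "(\<integral>\<^sup>+x. indicator (PiE (A \<union> C) F) (?Y (A \<union> C) x) * indicator T (?Y B x) \<partial>P) =
            (\<integral>\<^sup>+x. indicator (PiE C F) (?Y C x) * (e (?Y C x) * g (?Y C x)) \<partial>P)"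
            using eg C unfolding cv2 by (auto simp: box mult.assoc)
          also have "\<dots> = (\<integral>\<^sup>+x. (indicator (PiE C F) (?Y C x) * g (?Y C x)) * indicator (PiE A F) (?Y A x) \<partial>P)"
            using e unfolding cv
            by (auto dest!: bspec[of _ _ "\<lambda>y. indicator (PiE C F) y * g y"] simp: mult_ac)
          finally show "(\<integral>\<^sup>+x. indicator (PiE (A \<union> C) F) (?Y (A \<union> C) x) * indicator T (?Y B x) \<partial>P) =
            (\<integral>\<^sup>+x. indicator (PiE (A \<union> C) F) (?Y (A \<union> C) x) * g (?Y C x) \<partial>P)"
            by (simp add: box mult_ac)
        qed (measurable, simp add: indicator_def)
      qed
    qed
  qed
qed

text \<open>The one-sided form hides the symmetry; it is read off from the form with two
  events.\<close>

lemma coord_ci_commute: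
  assumes V: "finite V" and P: "prob_space P" and sP: "sets P = sets (coord_space X d V)"
    and ABC: "A \<subseteq> V" "B \<subseteq> V" "C \<subseteq> V" and ci: "coord_ci X d P A B C"
  shows "coord_ci X d P B A C"
  using ci unfolding coord_ci_iff_cond_indep[OF V P sP ABC(1,2,3)]
    coord_ci_iff_cond_indep[OF V P sP ABC(2,1,3)]
    cond_indep_iff_ci_events[OF P sP ABC(1,2,3)] cond_indep_iff_ci_events[OF P sP ABC(2,1,3)]
  by (blast intro: ci_events_commute)

text \<open>The same \<open>g\<close> works, read as a function of the coordinates in
  \<open>C\<close>, and the test functions are among the former ones. Besides moving coordinates
  from \<open>A'\<close> into the conditioning set, this allows coordinates of the conditioning set
  to be added to \<open>A\<close>.\<close>

lemma coord_ci_weak_union: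
  assumes ci: "coord_ci X d P A' B C'" and C: "C' \<subseteq> C" "A \<union> C \<subseteq> A' \<union> C'"
  shows "coord_ci X d P A B C"
  unfolding coord_ci_def
proof
  let ?M = "coord_space X d"
  let ?Y = "\<lambda>A x. restrict x A"
  fix T assume T: "T \<in> sets (?M B)"
  obtain g where g[measurable]: "g \<in> borel_measurable (?M C')" and g1: "\<forall>y. g y \<le> (1 :: ennreal)"
    and eq: "\<forall>h\<in>borel_measurable (?M (A' \<union> C')).
     (\<integral>\<^sup>+x. h (?Y (A' \<union> C') x) * indicator T (?Y B x) \<partial>P) =
     (\<integral>\<^sup>+x. h (?Y (A' \<union> C') x) * g (?Y C' x) \<partial>P)"
    by (rule coord_ciE[OF ci T])
  note g1 = g1[rule_format] and eq = bspec[OF eq]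
  have [measurable]: "?Y C' \<in> ?M C \<rightarrow>\<^sub>M ?M C'" "?Y (A \<union> C) \<in> ?M (A' \<union> C') \<rightarrow>\<^sub>M ?M (A \<union> C)"
    using C by (auto intro!: measurable_restrict_coord)
  have rr: "?Y (A \<union> C) (?Y (A' \<union> C') x) = ?Y (A \<union> C) x" "?Y C' (?Y C x) = ?Y C' x" for x :: "'a \<Rightarrow> 'b"
    using C by (auto simp: Int_absorb1)
  show "\<exists>g\<in>borel_measurable (?M C). (\<forall>y. g y \<le> (1 :: ennreal)) \<and> (\<forall>h\<in>borel_measurable (?M (A \<union> C)).
       (\<integral>\<^sup>+x. h (?Y (A \<union> C) x) * indicator T (?Y B x) \<partial>P) =
       (\<integral>\<^sup>+x. h (?Y (A \<union> C) x) * g (?Y C x) \<partial>P))"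
  proof (intro bexI[of _ "\<lambda>y. g (?Y C' y)"] conjI allI ballI g1)
    fix h :: "_ \<Rightarrow> ennreal" assume [measurable]: "h \<in> borel_measurable (?M (A \<union> C))"
    show "(\<integral>\<^sup>+x. h (?Y (A \<union> C) x) * indicator T (?Y B x) \<partial>P) =
       (\<integral>\<^sup>+x. h (?Y (A \<union> C) x) * g (?Y C' (?Y C x)) \<partial>P)"
      using eq[of "\<lambda>x. h (?Y (A \<union> C) x)"] by (simp only: rr) measurable
  qed measurable
qed

section \<open>Products of kernels\<close>

text \<open>One step of \<open>kernel_product\<close>, with a kernel that may look at all
  coordinates in \<open>U\<close>; dependence on the parents alone is expressed by a restriction
  inside \<open>k\<close>.\<close>

definition extend_kernel ::
  "('v \<Rightarrow> 'a set) \<Rightarrow> ('v \<Rightarrow> 'a \<Rightarrow> 'a \<Rightarrow> real) \<Rightarrow> 'v set \<Rightarrow> 'v \<Rightarrow> (('v \<Rightarrow> 'a) \<Rightarrow> 'a measure) \<Rightarrow>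
    ('v \<Rightarrow> 'a) measure \<Rightarrow> ('v \<Rightarrow> 'a) measure" where
  "extend_kernel X d U v k P =
     P \<bind> (\<lambda>x. distr (k x) (coord_space X d (insert v U)) (\<lambda>a. x(v := a)))"

lemma kernel_product_Cons:
  "kernel_product E X d m (v # vs) =
     extend_kernel X d (set vs) v (\<lambda>x. m v (restrict x (parents E v))) (kernel_product E X d m vs)"
  by (simp add: extend_kernel_def)

lemma measurable_upd_restrict:
  assumes "K \<subseteq> insert v J"
  shows "(\<lambda>(x, a). restrict (x(v := a)) K) \<in> coord_space X d J \<Otimes>\<^sub>M metric_borel (X v) (d v) \<rightarrow>\<^sub>M coord_space X d K"
proof -
  have "(\<lambda>(x, a). x(v := a)) \<in> coord_space X d J \<Otimes>\<^sub>M metric_borel (X v) (d v) \<rightarrow>\<^sub>M coord_space X d (insert v J)"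
    unfolding coord_space_def by (rule measurable_add_dim)
  from measurable_compose[OF this measurable_restrict_coord[OF assms]]
  show ?thesis by (simp add: split_beta')
qed

lemma measurable_upd:
  "(\<lambda>(x, a). x(v := a)) \<in> coord_space X d U \<Otimes>\<^sub>M metric_borel (X v) (d v) \<rightarrow>\<^sub>M coord_space X d (insert v U)"
  unfolding coord_space_def by (rule measurable_add_dim)

lemma nn_integral_upd_measurable:
  assumes k: "k \<in> coord_space X d U \<rightarrow>\<^sub>M prob_algebra (metric_borel (X v) (d v))"
    and h: "h \<in> borel_measurable (coord_space X d (insert v U))"
  shows "(\<lambda>x. \<integral>\<^sup>+a. h (x(v := a)) \<partial>k x) \<in> borel_measurable (coord_space X d U)"
  by (rule nn_integral_measurable_subprob_algebra2[OF _ measurable_prob_algebraD[OF k]])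
    (use measurable_compose[OF measurable_upd h] in \<open>simp add: split_beta'\<close>)

lemma extend_kernel_measurable:
  assumes k: "k \<in> coord_space X d U \<rightarrow>\<^sub>M prob_algebra (metric_borel (X v) (d v))"
  shows "(\<lambda>x. distr (k x) (coord_space X d (insert v U)) (\<lambda>a. x(v := a)))
    \<in> coord_space X d U \<rightarrow>\<^sub>M prob_algebra (coord_space X d (insert v U))"
  by (rule measurable_distr_prob_space2[OF k measurable_upd])

lemma
  assumes P: "prob_space P" and sP: "sets P = sets (coord_space X d U)"
    and k: "k \<in> coord_space X d U \<rightarrow>\<^sub>M prob_algebra (metric_borel (X v) (d v))"
  shows prob_space_extend_kernel: "prob_space (extend_kernel X d U v k P)"
    and sets_extend_kernel: "sets (extend_kernel X d U v k P) = sets (coord_space X d (insert v U))"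
    and nn_integral_extend_kernel: "h \<in> borel_measurable (coord_space X d (insert v U)) \<Longrightarrow>
      (\<integral>\<^sup>+x. h x \<partial>extend_kernel X d U v k P) = (\<integral>\<^sup>+x. \<integral>\<^sup>+a. h (x(v := a)) \<partial>k x \<partial>P)"
proof -
  have "P \<in> space (prob_algebra (coord_space X d U))" using P sP by (simp add: space_prob_algebra)
  from prob_space_bind'[OF this extend_kernel_measurable[OF k]] sets_bind'[OF this extend_kernel_measurable[OF k]]
  show "prob_space (extend_kernel X d U v k P)" "sets (extend_kernel X d U v k P) = sets (coord_space X d (insert v U))"
    by (simp_all add: extend_kernel_def)
  assume h: "h \<in> borel_measurable (coord_space X d (insert v U))"
  have "(\<lambda>x. distr (k x) (coord_space X d (insert v U)) (\<lambda>a. x(v := a)))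
    \<in> P \<rightarrow>\<^sub>M subprob_algebra (coord_space X d (insert v U))"
    using measurable_prob_algebraD[OF extend_kernel_measurable[OF k]] sP by (simp cong: measurable_cong_sets)
  from nn_integral_bind[OF h this]
  have "(\<integral>\<^sup>+x. h x \<partial>extend_kernel X d U v k P) =
    (\<integral>\<^sup>+x. \<integral>\<^sup>+y. h y \<partial>distr (k x) (coord_space X d (insert v U)) (\<lambda>a. x(v := a)) \<partial>P)"
    by (simp add: extend_kernel_def)
  also have "\<dots> = (\<integral>\<^sup>+x. \<integral>\<^sup>+a. h (x(v := a)) \<partial>k x \<partial>P)"
  proof (rule nn_integral_cong)
    fix x assume "x \<in> space P"
    then have x: "x \<in> space (coord_space X d U)" using sets_eq_imp_space_eq[OF sP] by simp
    have "sets (k x) = sets (metric_borel (X v) (d v))"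
      using measurable_space[OF k x] by (simp add: space_prob_algebra)
    moreover have "(\<lambda>a. x(v := a)) \<in> metric_borel (X v) (d v) \<rightarrow>\<^sub>M coord_space X d (insert v U)"
      using measurable_compose[OF measurable_Pair1'[OF x] measurable_upd] by simp
    ultimately have "(\<lambda>a. x(v := a)) \<in> k x \<rightarrow>\<^sub>M coord_space X d (insert v U)"
      by (simp cong: measurable_cong_sets)
    then show "(\<integral>\<^sup>+y. h y \<partial>distr (k x) (coord_space X d (insert v U)) (\<lambda>a. x(v := a))) = (\<integral>\<^sup>+a. h (x(v := a)) \<partial>k x)"
      using h by (simp add: nn_integral_distr)
  qed
  finally show "(\<integral>\<^sup>+x. h x \<partial>extend_kernel X d U v k P) = (\<integral>\<^sup>+x. \<integral>\<^sup>+a. h (x(v := a)) \<partial>k x \<partial>P)" .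
qed

lemma restrict_upd_other: "v \<notin> A \<Longrightarrow> restrict (x(v := a)) A = restrict x A"
  by (auto simp: restrict_def)

text \<open>No integrand involves the coordinate \<open>v\<close> and the kernel has mass 1, so
  integrating \<open>v\<close> out brings back the integrals under \<open>P\<close>.\<close>

lemma coord_ci_extend_old:
  assumes P: "prob_space P" and sP: "sets P = sets (coord_space X d U)"
    and k: "k \<in> coord_space X d U \<rightarrow>\<^sub>M prob_algebra (metric_borel (X v) (d v))"
    and v: "v \<notin> U" and ABC: "A \<subseteq> U" "B \<subseteq> U" "C \<subseteq> U" and ci: "coord_ci X d P A B C"
  shows "coord_ci X d (extend_kernel X d U v k P) A B C"
  unfolding coord_ci_def
proof
  let ?M = "coord_space X d"
  fix T assume T[measurable]: "T \<in> sets (?M B)"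
  obtain g where g[measurable]: "g \<in> borel_measurable (?M C)" and g1: "\<forall>y. g y \<le> (1 :: ennreal)"
      and eq: "\<forall>h\<in>borel_measurable (?M (A \<union> C)).
       (\<integral>\<^sup>+x. h (restrict x (A \<union> C)) * indicator T (restrict x B) \<partial>P) =
       (\<integral>\<^sup>+x. h (restrict x (A \<union> C)) * g (restrict x C) \<partial>P)"
    by (rule coord_ciE[OF ci T])
  have r[measurable]: "(\<lambda>x. restrict x D) \<in> ?M (insert v U) \<rightarrow>\<^sub>M ?M D" if "D \<subseteq> U" for D
    using that by (intro measurable_restrict_coord) auto
  have ACU: "A \<union> C \<subseteq> U" using ABC by simp
  note [measurable] = r[OF ABC(1)] r[OF ABC(2)] r[OF ABC(3)] r[OF ACU]
  have nv: "v \<notin> A \<union> C" "v \<notin> B" "v \<notin> C" using v ABC by auto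
  have one: "emeasure (k x) (space (k x)) = 1" if "x \<in> space P" for x
  proof -
    have "x \<in> space (?M U)" using that sets_eq_imp_space_eq[OF sP] by simp
    then interpret prob_space "k x" using measurable_space[OF k] by (simp add: space_prob_algebra)
    show ?thesis by (rule emeasure_space_1)
  qed
  show "\<exists>g\<in>borel_measurable (?M C). (\<forall>y. g y \<le> (1 :: ennreal)) \<and> (\<forall>h\<in>borel_measurable (?M (A \<union> C)).
       (\<integral>\<^sup>+x. h (restrict x (A \<union> C)) * indicator T (restrict x B) \<partial>extend_kernel X d U v k P) =
       (\<integral>\<^sup>+x. h (restrict x (A \<union> C)) * g (restrict x C) \<partial>extend_kernel X d U v k P))"
  proof (intro bexI[of _ g] conjI g1 ballI)
    fix h :: "_ \<Rightarrow> ennreal" assume h[measurable]: "h \<in> borel_measurable (?M (A \<union> C))"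
    show "(\<integral>\<^sup>+x. h (restrict x (A \<union> C)) * indicator T (restrict x B) \<partial>extend_kernel X d U v k P) =
       (\<integral>\<^sup>+x. h (restrict x (A \<union> C)) * g (restrict x C) \<partial>extend_kernel X d U v k P)"
      using bspec[OF eq h]
      by (simp add: nn_integral_extend_kernel[OF P sP k] restrict_upd_other[OF nv(1)] restrict_upd_other[OF nv(2)]
          restrict_upd_other[OF nv(3)] one cong: nn_integral_cong)
  qed fact
qed

text \<open>Integrating \<open>v\<close> out of a test function leaves a function of the coordinates
  in \<open>A\<close>, \<open>D\<close> and \<open>C\<close>, because the kernel looks at
  \<open>D\<close> only. Independence for \<open>A \<union> D\<close> under \<open>P\<close> then
  provides the same \<open>g\<close>. In the application \<open>D\<close> is the set of parents of
  \<open>v\<close>.\<close>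

lemma coord_ci_extend_new:
  assumes P: "prob_space P" and sP: "sets P = sets (coord_space X d U)"
    and k: "k \<in> coord_space X d D \<rightarrow>\<^sub>M prob_algebra (metric_borel (X v) (d v))"
    and v: "v \<notin> U" and ABC: "A \<subseteq> U" "B \<subseteq> U" "C \<subseteq> U" and D: "D \<subseteq> U"
    and ci: "coord_ci X d P (A \<union> D) B C"
  shows "coord_ci X d (extend_kernel X d U v (\<lambda>x. k (restrict x D)) P) (insert v A) B C"
  unfolding coord_ci_def
proof
  let ?M = "coord_space X d" and ?J = "A \<union> D \<union> C" and ?K = "insert v A \<union> C"
  let ?P = "extend_kernel X d U v (\<lambda>x. k (restrict x D)) P"
  fix T assume T[measurable]: "T \<in> sets (?M B)"
  obtain g where g[measurable]: "g \<in> borel_measurable (?M C)" and g1: "\<forall>y. g y \<le> (1 :: ennreal)"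
      and eq: "\<forall>h\<in>borel_measurable (?M ?J).
       (\<integral>\<^sup>+x. h (restrict x ?J) * indicator T (restrict x B) \<partial>P) =
       (\<integral>\<^sup>+x. h (restrict x ?J) * g (restrict x C) \<partial>P)"
    by (rule coord_ciE[OF ci T])
  have r: "(\<lambda>x. restrict x D') \<in> ?M (insert v U) \<rightarrow>\<^sub>M ?M D'" if "D' \<subseteq> insert v U" for D'
    using that by (intro measurable_restrict_coord) auto
  have KU: "?K \<subseteq> insert v U" "C \<subseteq> insert v U" "B \<subseteq> insert v U" using ABC by auto
  note [measurable] = r[OF KU(1)] r[OF KU(2)] r[OF KU(3)]
  have nv: "v \<notin> B" "v \<notin> C" using v ABC by auto
  have kJ: "(\<lambda>z. k (restrict z D)) \<in> ?M J \<rightarrow>\<^sub>M prob_algebra (metric_borel (X v) (d v))" if "D \<subseteq> J" for J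
    using measurable_compose[OF measurable_restrict_coord[OF that] k] .
  show "\<exists>g\<in>borel_measurable (?M C). (\<forall>y. g y \<le> (1 :: ennreal)) \<and> (\<forall>h\<in>borel_measurable (?M ?K).
       (\<integral>\<^sup>+x. h (restrict x ?K) * indicator T (restrict x B) \<partial>?P) =
       (\<integral>\<^sup>+x. h (restrict x ?K) * g (restrict x C) \<partial>?P))"
  proof (intro bexI[of _ g] conjI g1 ballI)
    fix h :: "_ \<Rightarrow> ennreal" assume h[measurable]: "h \<in> borel_measurable (?M ?K)"
    define H where "H z = (\<integral>\<^sup>+a. h (restrict (z(v := a)) ?K) \<partial>k (restrict z D))" for z
    have H: "H \<in> borel_measurable (?M ?J)"
    proof -
      have K: "?K \<subseteq> insert v ?J" by auto
      have "D \<subseteq> ?J" by auto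
      from nn_integral_upd_measurable[OF kJ[OF this] measurable_compose[OF measurable_restrict_coord[OF K] h]]
      show ?thesis unfolding H_def .
    qed
    have HJ: "H (restrict x ?J) = (\<integral>\<^sup>+a. h (restrict (x(v := a)) ?K) \<partial>k (restrict x D))" for x
    proof -
      have 1: "restrict (restrict x ?J) D = restrict x D" by (auto simp: restrict_def)
      have 2: "restrict ((restrict x ?J)(v := a)) ?K = restrict (x(v := a)) ?K" for a
        by (auto simp: restrict_def)
      show ?thesis unfolding H_def 1 2 ..
    qed
    have step: "(\<integral>\<^sup>+x. h (restrict x ?K) * w x \<partial>?P) = (\<integral>\<^sup>+x. H (restrict x ?J) * w x \<partial>P)"
      if [measurable]: "w \<in> borel_measurable (?M (insert v U))" and w: "\<And>x a. w (x(v := a)) = w x" for w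
    proof -
      have "(\<lambda>x. h (restrict x ?K) * w x) \<in> borel_measurable (?M (insert v U))" by measurable
      from nn_integral_extend_kernel[OF P sP kJ[OF D] this]
      have "(\<integral>\<^sup>+x. h (restrict x ?K) * w x \<partial>?P) =
          (\<integral>\<^sup>+x. \<integral>\<^sup>+a. h (restrict (x(v := a)) ?K) * w x \<partial>k (restrict x D) \<partial>P)"
        by (simp only: w)
      also have "\<dots> = (\<integral>\<^sup>+x. H (restrict x ?J) * w x \<partial>P)"
      proof (rule nn_integral_cong)
        fix x assume "x \<in> space P"
        then have x: "x \<in> space (?M U)" using sets_eq_imp_space_eq[OF sP] by simp
        have "sets (k (restrict x D)) = sets (metric_borel (X v) (d v))"
          using measurable_space[OF kJ[OF D] x] by (simp add: space_prob_algebra)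
        moreover have "(\<lambda>a. h (restrict (x(v := a)) ?K)) \<in> borel_measurable (metric_borel (X v) (d v))"
          using measurable_compose[OF measurable_compose[OF measurable_Pair1'[OF x] measurable_upd_restrict[OF KU(1)]] h]
          by simp
        ultimately have "(\<lambda>a. h (restrict (x(v := a)) ?K)) \<in> borel_measurable (k (restrict x D))"
          by (simp cong: measurable_cong_sets)
        then show "(\<integral>\<^sup>+a. h (restrict (x(v := a)) ?K) * w x \<partial>k (restrict x D)) = H (restrict x ?J) * w x"
          unfolding HJ by (rule nn_integral_multc)
      qed
      finally show ?thesis .
    qed
    show "(\<integral>\<^sup>+x. h (restrict x ?K) * indicator T (restrict x B) \<partial>?P) =
       (\<integral>\<^sup>+x. h (restrict x ?K) * g (restrict x C) \<partial>?P)"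
      using bspec[OF eq H]
      by (subst (1 2) step) (simp_all add: restrict_upd_other[OF nv(1)] restrict_upd_other[OF nv(2)])
  qed fact
qed

subsection \<open>The global Markov property\<close>

lemma rev_topological_parents: "rev_topological E vs \<Longrightarrow> v \<in> set vs \<Longrightarrow> parents E v \<subseteq> set vs"
  by (induction vs) auto

text \<open>Used to see that the vertex added next is not an ancestor of a set of earlier vertices,
  as \<open>d_separated_insert_sink\<close> requires.\<close>

lemma rev_topological_ancestors:
  assumes "rev_topological E vs" "C \<subseteq> set vs"
  shows "ancestors E C \<subseteq> set vs"
proof
  fix w assume "w \<in> ancestors E C"
  then obtain c where c: "c \<in> C" and wc: "(w, c) \<in> E\<^sup>*" by (auto simp: ancestors_def)
  from wc show "w \<in> set vs"
  proof (induction rule: converse_rtrancl_induct)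
    case base
    then show ?case using c assms by auto
  next
    case (step y z)
    then show ?case using rev_topological_parents[OF assms(1) step.IH] by (auto simp: parents_def)
  qed
qed

lemma kernel_product_prob:
  assumes "rev_topological E vs"
    and "\<And>v. v \<in> set vs \<Longrightarrow> m v \<in> coord_space X d (parents E v) \<rightarrow>\<^sub>M prob_algebra (metric_borel (X v) (d v))"
  shows "prob_space (kernel_product E X d m vs) \<and> sets (kernel_product E X d m vs) = sets (coord_space X d (set vs))"
  using assms
proof (induction vs)
  case Nil
  have "(\<lambda>_. undefined) \<in> space (coord_space X d {})" by (simp add: space_coord_space)
  then show ?case by (simp add: prob_space_return)
next
  case (Cons v vs)
  have pa: "parents E v \<subseteq> set vs"
    and mv: "m v \<in> coord_space X d (parents E v) \<rightarrow>\<^sub>M prob_algebra (metric_borel (X v) (d v))"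
    using Cons.prems by simp_all
  note k = measurable_compose[OF measurable_restrict_coord[OF pa] mv]
  have IH: "prob_space (kernel_product E X d m vs)" "sets (kernel_product E X d m vs) = sets (coord_space X d (set vs))"
    using Cons by simp_all
  show ?case
    unfolding kernel_product_Cons using prob_space_extend_kernel[OF IH k] sets_extend_kernel[OF IH k] by simp
qed

text \<open>The vertex \<open>v\<close> added last is a sink among the vertices present. If it is
  not in \<open>C\<close>, it lies in at most one of \<open>A\<close> and \<open>B\<close>: either
  its kernel is integrated out, or \<open>v\<close> is replaced by its parents on the side where it
  occurs. If it is in \<open>C\<close>, the separation is traded for one with \<open>v\<close> on a
  side and a smaller conditioning set.\<close>

theorem kernel_product_markov:
  assumes "rev_topological E vs"
    and "\<And>v. v \<in> set vs \<Longrightarrow> m v \<in> coord_space X d (parents E v) \<rightarrow>\<^sub>M prob_algebra (metric_borel (X v) (d v))"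
    and "A \<subseteq> set vs" "B \<subseteq> set vs" "C \<subseteq> set vs" and "d_separated (set vs) E A B C"
  shows "coord_ci X d (kernel_product E X d m vs) A B C"
  using assms
proof (induction vs arbitrary: A B C)
  case Nil
  then have [simp]: "A = {}" "B = {}" "C = {}" by simp_all
  show ?case
    unfolding coord_ci_def
  proof
    fix T assume T: "T \<in> sets (coord_space X d B)"
    show "\<exists>g\<in>borel_measurable (coord_space X d C).
      (\<forall>y. g y \<le> (1 :: ennreal)) \<and> (\<forall>h\<in>borel_measurable (coord_space X d (A \<union> C)).
       (\<integral>\<^sup>+x. h (restrict x (A \<union> C)) * indicator T (restrict x B) \<partial>kernel_product E X d m []) =
       (\<integral>\<^sup>+x. h (restrict x (A \<union> C)) * g (restrict x C) \<partial>kernel_product E X d m []))"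
      using T by (intro bexI[of _ "indicator T"]) (auto simp: indicator_def)
  qed
next
  case (Cons v vs)
  let ?U = "set vs" and ?P = "kernel_product E X d m vs" and ?P' = "kernel_product E X d m (v # vs)"
  let ?k = "\<lambda>x. m v (restrict x (parents E v))"
  have top: "rev_topological E vs" "v \<notin> ?U" "parents E v \<subseteq> ?U" using Cons.prems(1) by auto
  have mv: "m v \<in> coord_space X d (parents E v) \<rightarrow>\<^sub>M prob_algebra (metric_borel (X v) (d v))"
    using Cons.prems(2) by simp
  have k: "?k \<in> coord_space X d ?U \<rightarrow>\<^sub>M prob_algebra (metric_borel (X v) (d v))"
    using measurable_compose[OF measurable_restrict_coord[OF top(3)] mv] .
  have P: "prob_space ?P" "sets ?P = sets (coord_space X d ?U)"
    using kernel_product_prob[OF top(1), of m X d] Cons.prems(2) by simp_all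
  have P': "prob_space ?P'" "sets ?P' = sets (coord_space X d (insert v ?U))"
    using kernel_product_prob[OF Cons.prems(1,2)] by simp_all
  have fin: "finite (insert v ?U)" by simp
  have child: "(v, w) \<notin> E" if "w \<in> insert v ?U" for w
    using that top rev_topological_parents[OF top(1), of w] by (auto simp: parents_def)
  have IH: "coord_ci X d ?P A B C"
    if "A \<subseteq> ?U" "B \<subseteq> ?U" "C \<subseteq> ?U" "d_separated ?U E A B C" for A B C
    using Cons.IH[OF top(1) _ that] Cons.prems(2) by simp
  note comm = coord_ci_commute[OF fin P', rotated 3]
  have left: "coord_ci X d ?P' (insert v A) B C"
    if sub: "A \<subseteq> ?U" "B \<subseteq> ?U" "C \<subseteq> ?U" and sep: "d_separated (insert v ?U) E (insert v A) B C" for A B C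
  proof -
    have "d_separated ?U E (A \<union> parents E v) B C"
      using sub top by (intro d_separated_parents[OF sep _ _ child]) auto
    then have "coord_ci X d ?P (A \<union> parents E v) B C" using sub top by (intro IH) auto
    then show ?thesis
      unfolding kernel_product_Cons by (rule coord_ci_extend_new[OF P mv top(2) sub top(3)])
  qed
  have not_C: "coord_ci X d ?P' A B C"
    if sub: "A \<subseteq> insert v ?U" "B \<subseteq> insert v ?U" "C \<subseteq> ?U" and sep: "d_separated (insert v ?U) E A B C" for A B C
  proof -
    have vC: "v \<notin> C" using sub top by auto
    \<comment> \<open>The trivial path at \<open>v\<close> is active because \<open>v\<close> is not
      in \<open>C\<close>; separation therefore excludes that \<open>v\<close> lies in both
      \<open>A\<close> and \<open>B\<close>.\<close>
    have nb: "\<not> blocked E C [v]"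
      by (rule not_blockedI) (auto simp: collides_def append_eq_Cons_conv Cons_eq_append_conv vC)
    have "is_path (insert v ?U) E [v]" by (simp add: is_path_def)
    with sep nb have AB: "\<not> (v \<in> A \<and> v \<in> B)" by (auto simp: d_separated_def)
    consider "v \<in> A" "B \<subseteq> ?U" | "v \<in> B" "A \<subseteq> ?U" | "A \<subseteq> ?U" "B \<subseteq> ?U"
      using AB sub by auto
    then show ?thesis
    proof cases
      case 1
      then show ?thesis using left[of "A - {v}" B C] sub sep by (auto simp: insert_absorb)
    next
      case 2
      then have "coord_ci X d ?P' B A C"
        using left[of "B - {v}" A C] sub d_separated_commute[OF sep] by (auto simp: insert_absorb)
      then show ?thesis by (rule comm) (use sub in auto)
    next
      case 3
      have "d_separated ?U E A B C" by (rule d_separated_mono[OF sep]) auto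
      then have "coord_ci X d ?P A B C" using 3 sub by (intro IH) auto
      then show ?thesis
        unfolding kernel_product_Cons using 3 sub by (intro coord_ci_extend_old[OF P k top(2)]) auto
    qed
  qed
  show ?case
  proof (cases "v \<in> C")
    case False
    then show ?thesis using Cons.prems by (intro not_C) auto
  next
    case True
    \<comment> \<open>\<open>A\<close> and \<open>B\<close> may contain \<open>v\<close> too. It is
      removed from both before the sink lemma is applied; at the end it is restored by weak union,
      which allows it since \<open>v\<close> is conditioned on.\<close>
    define A0 B0 C0 where "A0 = A - {v}" and "B0 = B - {v}" and "C0 = C - {v}"
    have sub: "A0 \<subseteq> ?U" "B0 \<subseteq> ?U" "C0 \<subseteq> ?U" using Cons.prems by (auto simp: A0_def B0_def C0_def)
    have C: "C = insert v C0" using True by (auto simp: C0_def)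
    have sep: "d_separated (insert v ?U) E A0 B0 (insert v C0)"
      using d_separated_mono[OF Cons.prems(6)] C by (auto simp: A0_def B0_def)
    have "v \<notin> ancestors E C0" using rev_topological_ancestors[OF top(1) sub(3)] top(2) by auto
    from d_separated_insert_sink[OF sep sub(1,2) top(2) this child]
    have "coord_ci X d ?P' A0 B0 C"
    proof
      assume "d_separated (insert v ?U) E (insert v A0) B0 C0"
      then have "coord_ci X d ?P' (insert v A0) B0 C0" using sub by (intro not_C) auto
      then show ?thesis by (rule coord_ci_weak_union) (auto simp: C)
    next
      assume "d_separated (insert v ?U) E A0 (insert v B0) C0"
      from d_separated_commute[OF this] have "coord_ci X d ?P' (insert v B0) A0 C0"
        using sub by (intro not_C) auto
      then have "coord_ci X d ?P' B0 A0 C" by (rule coord_ci_weak_union) (auto simp: C)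
      then show ?thesis by (rule comm) (use sub in \<open>auto simp: C\<close>)
    qed
    then have "coord_ci X d ?P' A B0 C" by (rule coord_ci_weak_union) (auto simp: C A0_def)
    then have "coord_ci X d ?P' B0 A C" by (rule comm) (use Cons.prems sub in auto)
    then have "coord_ci X d ?P' B A C" by (rule coord_ci_weak_union) (auto simp: C B0_def)
    then show ?thesis by (rule comm) (use Cons.prems in auto)
  qed
qed

subsection \<open>Lipschitz continuity and mixtures\<close>

text \<open>Two exchanges: \<open>k\<close> is replaced by \<open>l\<close> under \<open>P\<close>
  at the cost \<delta>, then \<open>P\<close> by \<open>Q\<close> at the cost \<epsilon>. In the
  second the integrand is the inner integral, which again has values in [0,1].\<close>

lemma measure_extend_kernel_le:
  assumes P: "prob_space P" "sets P = sets (coord_space X d U)"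
    and Q: "prob_space Q" "sets Q = sets (coord_space X d U)"
    and k: "k \<in> coord_space X d U \<rightarrow>\<^sub>M prob_algebra (metric_borel (X v) (d v))"
    and l: "l \<in> coord_space X d U \<rightarrow>\<^sub>M prob_algebra (metric_borel (X v) (d v))"
    and PQ: "\<And>S. S \<in> sets (coord_space X d U) \<Longrightarrow> measure P S \<le> measure Q S + \<epsilon>" and e: "0 \<le> \<epsilon>"
    and kl: "\<And>x S. x \<in> space (coord_space X d U) \<Longrightarrow> S \<in> sets (metric_borel (X v) (d v)) \<Longrightarrow>
      measure (k x) S \<le> measure (l x) S + \<delta>" and de: "0 \<le> \<delta>"
    and S: "S \<in> sets (coord_space X d (insert v U))"
  shows "measure (extend_kernel X d U v k P) S \<le> measure (extend_kernel X d U v l Q) S + (\<delta> + \<epsilon>)"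
proof -
  let ?P = "extend_kernel X d U v k P" and ?Q = "extend_kernel X d U v l Q"
  interpret P: prob_space P by fact
  interpret P': prob_space ?P by (rule prob_space_extend_kernel[OF P k])
  interpret Q': prob_space ?Q by (rule prob_space_extend_kernel[OF Q l])
  have ind: "(\<lambda>x. indicator S x :: ennreal) \<in> borel_measurable (coord_space X d (insert v U))" using S by simp
  note H = nn_integral_upd_measurable[OF l ind]
  have lx: "prob_space (l x)" "sets (l x) = sets (metric_borel (X v) (d v))" if "x \<in> space (coord_space X d U)" for x
    using measurable_space[OF l that] by (simp_all add: space_prob_algebra)
  have kx: "prob_space (k x)" "sets (k x) = sets (metric_borel (X v) (d v))" if "x \<in> space (coord_space X d U)" for x
    using measurable_space[OF k that] by (simp_all add: space_prob_algebra)
  have le1: "(\<integral>\<^sup>+a. indicator S (x(v := a)) \<partial>l x) \<le> 1" if "x \<in> space (coord_space X d U)" for x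
  proof -
    interpret prob_space "l x" by (rule lx[OF that])
    have "(\<integral>\<^sup>+a. indicator S (x(v := a)) \<partial>l x) \<le> (\<integral>\<^sup>+a. 1 \<partial>l x)"
      by (intro nn_integral_mono) (simp add: indicator_def)
    then show ?thesis by (simp add: emeasure_space_1)
  qed
  have sp: "space P = space (coord_space X d U)" by (rule sets_eq_imp_space_eq[OF P(2)])
  have "emeasure ?P S = (\<integral>\<^sup>+x. indicator S x \<partial>?P)"
    using S sets_extend_kernel[OF P k] by simp
  also have "\<dots> = (\<integral>\<^sup>+x. \<integral>\<^sup>+a. indicator S (x(v := a)) \<partial>k x \<partial>P)"
    by (rule nn_integral_extend_kernel[OF P k ind])
  also have "\<dots> \<le> (\<integral>\<^sup>+x. (\<integral>\<^sup>+a. indicator S (x(v := a)) \<partial>l x) + ennreal \<delta> \<partial>P)"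
  proof (rule nn_integral_mono)
    fix x assume "x \<in> space P"
    then have x: "x \<in> space (coord_space X d U)" using sp by simp
    have "(\<lambda>a. indicator S (x(v := a)) :: ennreal) \<in> borel_measurable (metric_borel (X v) (d v))"
      using measurable_compose[OF measurable_compose[OF measurable_Pair1'[OF x] measurable_upd] ind] by simp
    then have m: "(\<lambda>a. indicator S (x(v := a)) :: ennreal) \<in> borel_measurable (k x)"
      using kx[OF x] by (simp cong: measurable_cong_sets)
    show "(\<integral>\<^sup>+a. indicator S (x(v := a)) \<partial>k x) \<le> (\<integral>\<^sup>+a. indicator S (x(v := a)) \<partial>l x) + ennreal \<delta>"
      by (rule nn_integral_le_add[OF kx(1)[OF x] lx(1)[OF x] _ _ de m])
        (use kx[OF x] lx[OF x] kl[OF x] in \<open>auto simp: indicator_def\<close>)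
  qed
  also have "\<dots> = (\<integral>\<^sup>+x. \<integral>\<^sup>+a. indicator S (x(v := a)) \<partial>l x \<partial>P) + ennreal \<delta>"
    using H P(2) by (subst nn_integral_add) (simp_all add: P.emeasure_space_1 cong: measurable_cong_sets)
  also have "(\<integral>\<^sup>+x. \<integral>\<^sup>+a. indicator S (x(v := a)) \<partial>l x \<partial>P) \<le>
      (\<integral>\<^sup>+x. \<integral>\<^sup>+a. indicator S (x(v := a)) \<partial>l x \<partial>Q) + ennreal \<epsilon>"
    by (rule nn_integral_le_add[OF P(1) Q(1) _ _ e])
      (use P(2) Q(2) PQ H le1 sp in \<open>auto cong: measurable_cong_sets\<close>)
  also have "(\<integral>\<^sup>+x. \<integral>\<^sup>+a. indicator S (x(v := a)) \<partial>l x \<partial>Q) = (\<integral>\<^sup>+x. indicator S x \<partial>?Q)"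
    by (rule nn_integral_extend_kernel[OF Q l ind, symmetric])
  also have "\<dots> = emeasure ?Q S"
    using S sets_extend_kernel[OF Q l] by simp
  finally have "emeasure ?P S \<le> emeasure ?Q S + ennreal \<epsilon> + ennreal \<delta>" by (simp add: add_right_mono)
  also have "\<dots> = ennreal (measure ?Q S + (\<delta> + \<epsilon>))"
    using e de by (simp add: Q'.emeasure_eq_measure add_ac)
  finally show ?thesis using e de by (simp add: P'.emeasure_eq_measure del: ennreal_plus)
qed

text \<open>Every vertex contributes the uniform error of its kernel once, and the kernels applied
  afterwards do not amplify it. The bound is one-sided; exchanging the networks gives the other
  side.\<close>

lemma kernel_product_measure_le:
  assumes "rev_topological E vs"
    and "\<And>v. v \<in> set vs \<Longrightarrow> m v \<in> coord_space X d (parents E v) \<rightarrow>\<^sub>M prob_algebra (metric_borel (X v) (d v))"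
    and "\<And>v. v \<in> set vs \<Longrightarrow> m' v \<in> coord_space X d (parents E v) \<rightarrow>\<^sub>M prob_algebra (metric_borel (X v) (d v))"
    and "\<And>v y S. v \<in> set vs \<Longrightarrow> y \<in> PiE (parents E v) X \<Longrightarrow> S \<in> sets (metric_borel (X v) (d v)) \<Longrightarrow>
      measure (m v y) S \<le> measure (m' v y) S + \<delta> v"
    and "\<And>v. v \<in> set vs \<Longrightarrow> 0 \<le> \<delta> v"
    and "S \<in> sets (coord_space X d (set vs))"
  shows "measure (kernel_product E X d m vs) S \<le> measure (kernel_product E X d m' vs) S + sum \<delta> (set vs)"
  using assms
proof (induction vs arbitrary: S)
  case (Cons v vs)
  have top: "rev_topological E vs" "v \<notin> set vs" "parents E v \<subseteq> set vs" using Cons.prems(1) by auto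
  have k: "(\<lambda>x. n v (restrict x (parents E v))) \<in> coord_space X d (set vs) \<rightarrow>\<^sub>M prob_algebra (metric_borel (X v) (d v))"
    if "n v \<in> coord_space X d (parents E v) \<rightarrow>\<^sub>M prob_algebra (metric_borel (X v) (d v))" for n
    using measurable_compose[OF measurable_restrict_coord[OF top(3)] that] .
  have P: "prob_space (kernel_product E X d m vs)" "sets (kernel_product E X d m vs) = sets (coord_space X d (set vs))"
    "prob_space (kernel_product E X d m' vs)" "sets (kernel_product E X d m' vs) = sets (coord_space X d (set vs))"
    using kernel_product_prob[OF top(1), of m X d] kernel_product_prob[OF top(1), of m' X d] Cons.prems by simp_all
  have "measure (kernel_product E X d m (v # vs)) S \<le>
    measure (kernel_product E X d m' (v # vs)) S + (\<delta> v + sum \<delta> (set vs))"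
    unfolding kernel_product_Cons
  proof (rule measure_extend_kernel_le[OF P(1,2,3,4) k k])
    show "measure (m v (restrict x (parents E v))) S \<le> measure (m' v (restrict x (parents E v))) S + \<delta> v"
      if "x \<in> space (coord_space X d (set vs))" "S \<in> sets (metric_borel (X v) (d v))" for x S
      using that top by (intro Cons.prems(4)) (auto simp: space_coord_space)
    show "measure (kernel_product E X d m vs) S \<le> measure (kernel_product E X d m' vs) S + sum \<delta> (set vs)"
      if "S \<in> sets (coord_space X d (set vs))" for S
      using Cons.prems top(1) that by (intro Cons.IH) auto
  qed (use Cons.prems in \<open>auto intro!: sum_nonneg\<close>)
  then show ?case using top by simp
qed simp

text \<open>Positivity of the coefficients at \<open>1/2\<close> makes the law at time \<open>1/2\<close> dominate all components.\<close>

lemma kernel_product_mixture: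
  fixes mt :: "real \<Rightarrow> 'v \<Rightarrow> ('v \<Rightarrow> 'a) \<Rightarrow> 'a measure"
  assumes "rev_topological E vs"
    and "\<And>v. v \<in> set vs \<Longrightarrow> m0 v \<in> coord_space X d (parents E v) \<rightarrow>\<^sub>M prob_algebra (metric_borel (X v) (d v))"
    and "\<And>v. v \<in> set vs \<Longrightarrow> m1 v \<in> coord_space X d (parents E v) \<rightarrow>\<^sub>M prob_algebra (metric_borel (X v) (d v))"
    and "\<And>t v. t \<in> {0..1} \<Longrightarrow> v \<in> set vs \<Longrightarrow> mt t v \<in> coord_space X d (parents E v) \<rightarrow>\<^sub>M prob_algebra (metric_borel (X v) (d v))"
    and "\<And>t v y h. t \<in> {0..1} \<Longrightarrow> v \<in> set vs \<Longrightarrow> y \<in> PiE (parents E v) X \<Longrightarrow>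
      h \<in> borel_measurable (metric_borel (X v) (d v)) \<Longrightarrow>
      (\<integral>\<^sup>+a. h a \<partial>mt t v y) = ennreal (1 - t) * (\<integral>\<^sup>+a. h a \<partial>m0 v y) + ennreal t * (\<integral>\<^sup>+a. h a \<partial>m1 v y)"
  shows "\<exists>L :: (real poly \<times> ('v \<Rightarrow> 'a) measure) list.
    (\<forall>p\<in>set L. prob_space (snd p) \<and> sets (snd p) = sets (coord_space X d (set vs)) \<and>
       (\<forall>t\<in>{0..1}. 0 \<le> poly (fst p) t) \<and> 0 < poly (fst p) (1 / 2)) \<and>
    (\<forall>t\<in>{0..1}. \<forall>h\<in>borel_measurable (coord_space X d (set vs)).
       (\<integral>\<^sup>+x. h x \<partial>kernel_product E X d (mt t) vs) =
       (\<Sum>p\<leftarrow>L. ennreal (poly (fst p) t) * (\<integral>\<^sup>+x. h x \<partial>snd p)))"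
  using assms
proof (induction vs)
  case Nil
  have "(\<lambda>_. undefined) \<in> space (coord_space X d {})" by (simp add: space_coord_space)
  then have "prob_space (return (coord_space X d {}) (\<lambda>_. undefined))" by (rule prob_space_return)
  then show ?case
    by (intro exI[of _ "[(1, return (coord_space X d {}) (\<lambda>_. undefined))]"]) simp
next
  case (Cons v vs)
  let ?U = "set vs" and ?M = "coord_space X d"
  let ?k = "\<lambda>n x. n v (restrict x (parents E v))"
  have top: "rev_topological E vs" "v \<notin> ?U" "parents E v \<subseteq> ?U" using Cons.prems(1) by auto
  have "\<exists>L :: (real poly \<times> ('v \<Rightarrow> 'a) measure) list.
    (\<forall>p\<in>set L. prob_space (snd p) \<and> sets (snd p) = sets (?M ?U) \<and>
       (\<forall>t\<in>{0..1}. 0 \<le> poly (fst p) t) \<and> 0 < poly (fst p) (1 / 2)) \<and>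
    (\<forall>t\<in>{0..1}. \<forall>h\<in>borel_measurable (?M ?U).
       (\<integral>\<^sup>+x. h x \<partial>kernel_product E X d (mt t) vs) =
       (\<Sum>p\<leftarrow>L. ennreal (poly (fst p) t) * (\<integral>\<^sup>+x. h x \<partial>snd p)))"
    by (rule Cons.IH[OF top(1)]) (use Cons.prems(2-5) in auto)
  then obtain L :: "(real poly \<times> ('v \<Rightarrow> 'a) measure) list" where
    props: "\<forall>p\<in>set L. prob_space (snd p) \<and> sets (snd p) = sets (?M ?U) \<and>
       (\<forall>t\<in>{0..1}. 0 \<le> poly (fst p) t) \<and> 0 < poly (fst p) (1 / 2)"
    and eq: "\<forall>t\<in>{0..1}. \<forall>h\<in>borel_measurable (?M ?U).
       (\<integral>\<^sup>+x. h x \<partial>kernel_product E X d (mt t) vs) =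
       (\<Sum>p\<leftarrow>L. ennreal (poly (fst p) t) * (\<integral>\<^sup>+x. h x \<partial>snd p))"
    by (elim exE conjE)
  have L: "\<And>p. p \<in> set L \<Longrightarrow> prob_space (snd p)" "\<And>p. p \<in> set L \<Longrightarrow> sets (snd p) = sets (?M ?U)"
      "\<And>p t. p \<in> set L \<Longrightarrow> t \<in> {0..1} \<Longrightarrow> 0 \<le> poly (fst p) t" "\<And>p. p \<in> set L \<Longrightarrow> 0 < poly (fst p) (1 / 2)"
    using props by blast+
  note eq = bspec[OF bspec[OF eq]]
  have k: "?k n \<in> ?M ?U \<rightarrow>\<^sub>M prob_algebra (metric_borel (X v) (d v))"
    if "n v \<in> ?M (parents E v) \<rightarrow>\<^sub>M prob_algebra (metric_borel (X v) (d v))" for n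
    using measurable_compose[OF measurable_restrict_coord[OF top(3)] that] .
  have k0: "?k m0 \<in> ?M ?U \<rightarrow>\<^sub>M prob_algebra (metric_borel (X v) (d v))"
    and k1: "?k m1 \<in> ?M ?U \<rightarrow>\<^sub>M prob_algebra (metric_borel (X v) (d v))"
    and kt: "\<And>t. t \<in> {0..1} \<Longrightarrow> ?k (mt t) \<in> ?M ?U \<rightarrow>\<^sub>M prob_algebra (metric_borel (X v) (d v))"
    using Cons.prems by (auto intro!: k)
  \<comment> \<open>The vertex \<open>v\<close> doubles the list: \<open>[:1, -1:]\<close> is the
    weight 1 - t of the kernel from \<open>m0\<close>, and \<open>[:0, 1:]\<close> the weight t of
    the one from \<open>m1\<close>. In the end there is one law for each choice of an endpoint at
    every vertex, weighted by a product of factors t and 1 - t.\<close>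
  define L0 where "L0 = map (\<lambda>p. ([:1, -1:] * fst p, extend_kernel X d ?U v (?k m0) (snd p))) L"
  define L1 where "L1 = map (\<lambda>p. ([:0, 1:] * fst p, extend_kernel X d ?U v (?k m1) (snd p))) L"
  have props: "prob_space (snd p) \<and> sets (snd p) = sets (?M (insert v ?U)) \<and>
       (\<forall>t\<in>{0..1}. 0 \<le> poly (fst p) t) \<and> 0 < poly (fst p) (1 / 2)" if "p \<in> set (L0 @ L1)" for p
  proof -
    have pol: "poly ([:1, -1:] * c) t = (1 - t) * poly c t" "poly ([:0, 1:] * c) t = t * poly c t"
      for c :: "real poly" and t by (simp_all add: algebra_simps)
    consider p' where "p' \<in> set L" "p = ([:1, -1:] * fst p', extend_kernel X d ?U v (?k m0) (snd p'))"
      | p' where "p' \<in> set L" "p = ([:0, 1:] * fst p', extend_kernel X d ?U v (?k m1) (snd p'))"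
      using \<open>p \<in> set (L0 @ L1)\<close> unfolding L0_def L1_def set_append set_map by blast
    then show ?thesis
    proof cases
      case 1
      show ?thesis
        unfolding 1(2) fst_conv snd_conv pol
        using prob_space_extend_kernel[OF L(1,2)[OF 1(1)] k0] sets_extend_kernel[OF L(1,2)[OF 1(1)] k0]
          L(3,4)[OF 1(1)] by simp
    next
      case 2
      show ?thesis
        unfolding 2(2) fst_conv snd_conv pol
        using prob_space_extend_kernel[OF L(1,2)[OF 2(1)] k1] sets_extend_kernel[OF L(1,2)[OF 2(1)] k1]
          L(3,4)[OF 2(1)] by simp
    qed
  qed
  have "(\<integral>\<^sup>+x. h x \<partial>kernel_product E X d (mt t) (v # vs)) =
       (\<Sum>p\<leftarrow>L0 @ L1. ennreal (poly (fst p) t) * (\<integral>\<^sup>+x. h x \<partial>snd p))"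
    if t: "t \<in> {0..1}" and h: "h \<in> borel_measurable (?M (insert v ?U))" for t h
  proof -
    define h0 where "h0 x = (\<integral>\<^sup>+a. h (x(v := a)) \<partial>?k m0 x)" for x
    define h1 where "h1 x = (\<integral>\<^sup>+a. h (x(v := a)) \<partial>?k m1 x)" for x
    have hm: "h0 \<in> borel_measurable (?M ?U)" "h1 \<in> borel_measurable (?M ?U)"
      using nn_integral_upd_measurable[OF k0 h] nn_integral_upd_measurable[OF k1 h]
      by (simp_all add: h0_def[abs_def] h1_def[abs_def])
    have P: "prob_space (kernel_product E X d (mt t) vs)"
      "sets (kernel_product E X d (mt t) vs) = sets (?M ?U)"
      using kernel_product_prob[OF top(1), of "mt t" X d] Cons.prems(4)[OF t] by simp_all
    have "(\<integral>\<^sup>+x. h x \<partial>kernel_product E X d (mt t) (v # vs)) =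
      (\<integral>\<^sup>+x. \<integral>\<^sup>+a. h (x(v := a)) \<partial>?k (mt t) x \<partial>kernel_product E X d (mt t) vs)"
      unfolding kernel_product_Cons by (rule nn_integral_extend_kernel[OF P kt[OF t] h])
    also have "\<dots> = (\<integral>\<^sup>+x. ennreal (1 - t) * h0 x + ennreal t * h1 x \<partial>kernel_product E X d (mt t) vs)"
    proof (rule nn_integral_cong)
      fix x assume "x \<in> space (kernel_product E X d (mt t) vs)"
      then have x: "x \<in> space (?M ?U)" using sets_eq_imp_space_eq[OF P(2)] by simp
      then have "restrict x (parents E v) \<in> PiE (parents E v) X"
        using top by (auto simp: space_coord_space)
      moreover have "(\<lambda>a. h (x(v := a))) \<in> borel_measurable (metric_borel (X v) (d v))"
        using measurable_compose[OF measurable_compose[OF measurable_Pair1'[OF x] measurable_upd] h] by simp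
      ultimately show "(\<integral>\<^sup>+a. h (x(v := a)) \<partial>?k (mt t) x) = ennreal (1 - t) * h0 x + ennreal t * h1 x"
        unfolding h0_def h1_def using t by (intro Cons.prems(5)) auto
    qed
    also have "\<dots> = (\<Sum>p\<leftarrow>L. ennreal (poly (fst p) t) * (\<integral>\<^sup>+x. ennreal (1 - t) * h0 x + ennreal t * h1 x \<partial>snd p))"
      using hm by (intro eq t) simp
    also have "\<dots> = (\<Sum>p\<leftarrow>L. ennreal (poly ([:1, -1:] * fst p) t) * (\<integral>\<^sup>+x. h x \<partial>extend_kernel X d ?U v (?k m0) (snd p)) +
        ennreal (poly ([:0, 1:] * fst p) t) * (\<integral>\<^sup>+x. h x \<partial>extend_kernel X d ?U v (?k m1) (snd p)))"
    proof (intro arg_cong[of _ _ sum_list] map_cong refl)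
      fix p assume p: "p \<in> set L"
      have hp: "h0 \<in> borel_measurable (snd p)" "h1 \<in> borel_measurable (snd p)"
        using hm L(2)[OF p] by (simp_all cong: measurable_cong_sets)
      have "(\<integral>\<^sup>+x. h x \<partial>extend_kernel X d ?U v (?k m0) (snd p)) = (\<integral>\<^sup>+x. h0 x \<partial>snd p)"
        "(\<integral>\<^sup>+x. h x \<partial>extend_kernel X d ?U v (?k m1) (snd p)) = (\<integral>\<^sup>+x. h1 x \<partial>snd p)"
        unfolding h0_def h1_def
        by (rule nn_integral_extend_kernel[OF L(1,2)[OF p] k0 h] nn_integral_extend_kernel[OF L(1,2)[OF p] k1 h])+
      moreover have "(\<integral>\<^sup>+x. ennreal (1 - t) * h0 x + ennreal t * h1 x \<partial>snd p) =
          ennreal (1 - t) * (\<integral>\<^sup>+x. h0 x \<partial>snd p) + ennreal t * (\<integral>\<^sup>+x. h1 x \<partial>snd p)"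
        using hp by (simp add: nn_integral_add nn_integral_cmult)
      moreover have "ennreal (poly ([:1, -1:] * fst p) t) = ennreal (poly (fst p) t) * ennreal (1 - t)"
        "ennreal (poly ([:0, 1:] * fst p) t) = ennreal (poly (fst p) t) * ennreal t"
        using t L(3)[OF p t] by (auto simp: ennreal_mult[symmetric] algebra_simps)
      ultimately show "ennreal (poly (fst p) t) * (\<integral>\<^sup>+x. ennreal (1 - t) * h0 x + ennreal t * h1 x \<partial>snd p) =
        ennreal (poly ([:1, -1:] * fst p) t) * (\<integral>\<^sup>+x. h x \<partial>extend_kernel X d ?U v (?k m0) (snd p)) +
        ennreal (poly ([:0, 1:] * fst p) t) * (\<integral>\<^sup>+x. h x \<partial>extend_kernel X d ?U v (?k m1) (snd p))"
        by (simp only: distrib_left mult.assoc)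
    qed
    also have "\<dots> = (\<Sum>p\<leftarrow>L0 @ L1. ennreal (poly (fst p) t) * (\<integral>\<^sup>+x. h x \<partial>snd p))"
      by (simp add: L0_def L1_def sum_list_addf o_def)
    finally show ?thesis .
  qed
  with props show ?case by (intro exI[of _ "L0 @ L1"]) auto
qed

section \<open>The distribution map on Bayesian networks\<close>

text \<open>Among the vertices not yet listed, one that is minimal for the edge relation has all its
  parents in the list and can be put in front. It exists since a finite acyclic relation is
  well-founded.\<close>

lemma rev_topological_exists:
  assumes "dag V E"
  shows "\<exists>vs. set vs = V \<and> rev_topological E vs"
proof -
  have V: "finite V" and EV: "E \<subseteq> V \<times> V" and ac: "acyclic E" using assms by (auto simp: dag_def)
  have "finite E" using V EV by (meson finite_SigmaI finite_subset)
  then have wf: "wf E" using ac by (rule finite_acyclic_wf)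
  have "\<exists>vs. length vs = n \<and> set vs \<subseteq> V \<and> distinct vs \<and> rev_topological E vs" if "n \<le> card V" for n
    using that
  proof (induction n)
    case (Suc n)
    then obtain vs where vs: "length vs = n" "set vs \<subseteq> V" "distinct vs" "rev_topological E vs" by auto
    have "card (set vs) < card V" using vs Suc.prems by (simp add: distinct_card)
    then have "set vs \<noteq> V" by auto
    then obtain x where "x \<in> V - set vs" using vs(2) by blast
    from wf[unfolded wf_eq_minimal, rule_format, OF this]
    obtain z where z: "z \<in> V - set vs" "\<forall>y. (y, z) \<in> E \<longrightarrow> y \<notin> V - set vs" by blast
    have "parents E z \<subseteq> set vs" using z EV by (auto simp: parents_def)
    then show ?case using vs z by (intro exI[of _ "z # vs"]) auto
  qed simp
  from this[of "card V"] obtain vs where vs: "length vs = card V" "set vs \<subseteq> V" "distinct vs" "rev_topological E vs"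
    by auto
  then have "set vs = V" using V by (simp add: card_subset_eq distinct_card)
  with vs show ?thesis by blast
qed

text \<open>The order chosen in \<open>dist_map\<close> depends on \<open>V\<close> and
  \<open>E\<close> only, so a single list serves all networks, which can then be compared vertex by
  vertex.\<close>

lemma dist_map_eq:
  assumes "dag V E"
  obtains vs where "set vs = V" "rev_topological E vs" "\<And>m. dist_map V E X d m = kernel_product E X d m vs"
  using someI_ex[OF rev_topological_exists[OF assms]] by (auto simp: dist_map_def)

lemma bayes_nets_measurable:
  "m \<in> bayes_nets V E X d \<Longrightarrow> v \<in> V \<Longrightarrow>
    m v \<in> coord_space X d (parents E v) \<rightarrow>\<^sub>M prob_algebra (metric_borel (X v) (d v))"
  by (auto simp: bayes_nets_def PiE_iff)

lemma
  assumes "dag V E" and m: "m \<in> bayes_nets V E X d"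
  shows prob_space_dist_map: "prob_space (dist_map V E X d m)"
    and sets_dist_map: "sets (dist_map V E X d m) = sets (coord_space X d V)"
    and dist_map_markov: "dist_map V E X d m \<in> markov_dists V E X d"
proof -
  have V: "finite V" using assms by (simp add: dag_def)
  obtain vs where vs: "set vs = V" "rev_topological E vs" "\<And>m. dist_map V E X d m = kernel_product E X d m vs"
    using dist_map_eq[OF assms(1)] by blast
  note ker = bayes_nets_measurable[OF m]
  have P: "prob_space (dist_map V E X d m)" "sets (dist_map V E X d m) = sets (coord_space X d V)"
    using kernel_product_prob[OF vs(2), of m X d] ker vs(1) by (simp_all add: vs(3))
  then show "prob_space (dist_map V E X d m)" "sets (dist_map V E X d m) = sets (coord_space X d V)" by auto
  have "cond_indep X d (dist_map V E X d m) A B C"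
    if ABC: "A \<subseteq> V" "B \<subseteq> V" "C \<subseteq> V" and sep: "d_separated V E A B C" for A B C
  proof -
    have "coord_ci X d (dist_map V E X d m) A B C"
      using kernel_product_markov[OF vs(2), of m X d A B C] ker ABC sep vs(1) by (simp add: vs(3))
    then show ?thesis using coord_ci_iff_cond_indep[OF V P ABC] by simp
  qed
  then show "dist_map V E X d m \<in> markov_dists V E X d"
    using P by (simp add: markov_dists_def)
qed

lemma measure_dist_map_le:
  assumes "dag V E" and ne: "\<And>v. v \<in> V \<Longrightarrow> X v \<noteq> {}"
    and m: "m \<in> bayes_nets V E X d" and m': "m' \<in> bayes_nets V E X d"
    and S: "S \<in> sets (coord_space X d V)"
  shows "measure (dist_map V E X d m) S \<le> measure (dist_map V E X d m') S + tv_circ V E X d m m'"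
proof -
  obtain vs where vs: "set vs = V" "rev_topological E vs" "\<And>m. dist_map V E X d m = kernel_product E X d m vs"
    using dist_map_eq[OF assms(1)] by blast
  define \<delta> where "\<delta> v = (SUP y\<in>PiE (parents E v) X. tv_dist (m v y) (m' v y))" for v
  note ker = bayes_nets_kernel[OF m] bayes_nets_kernel[OF m']
  have tv: "tv_dist (m v y) (m' v y) \<le> \<delta> v" if "v \<in> V" "y \<in> PiE (parents E v) X" for v y
    unfolding \<delta>_def using that
    by (intro cSUP_upper bdd_aboveI[of _ 1]) (auto intro!: tv_dist_le_1 simp: ker)
  have "measure (m v y) S \<le> measure (m' v y) S + \<delta> v"
    if "v \<in> V" "y \<in> PiE (parents E v) X" "S \<in> sets (metric_borel (X v) (d v))" for v y S
  proof -
    have "\<bar>measure (m v y) S - measure (m' v y) S\<bar> \<le> tv_dist (m v y) (m' v y)"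
      using that by (intro tv_dist_upper) (simp_all add: ker)
    with tv[OF that(1,2)] show ?thesis by linarith
  qed
  moreover have "0 \<le> \<delta> v" if "v \<in> V" for v
  proof -
    have "parents E v \<subseteq> V" using assms(1) by (auto simp: dag_def parents_def)
    then have "PiE (parents E v) X \<noteq> {}" using ne by (auto simp: PiE_eq_empty_iff)
    then obtain y where "y \<in> PiE (parents E v) X" by blast
    moreover have "0 \<le> tv_dist (m v y) (m' v y)"
      using that calculation by (intro tv_dist_nonneg) (simp_all add: ker)
    ultimately show ?thesis using tv[OF that] order_trans by blast
  qed
  ultimately have "measure (kernel_product E X d m vs) S \<le> measure (kernel_product E X d m' vs) S + sum \<delta> (set vs)"
    using S vs(1) bayes_nets_measurable[OF m] bayes_nets_measurable[OF m']
    by (intro kernel_product_measure_le[OF vs(2)]) auto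
  then show ?thesis using m m' by (simp add: vs(1,3) tv_circ_def \<delta>_def)
qed

text \<open>Closeness of networks becomes closeness of their laws in total variation, and the
  closedness for pairs of events applies to each pair. Both orders of the arguments are controlled
  in \<open>near\<close> because the bound on the laws is one-sided.\<close>

lemma cond_indep_closed:
  assumes dag: "dag V E" and ne: "\<And>v. v \<in> V \<Longrightarrow> X v \<noteq> {}" and m: "m \<in> bayes_nets V E X d"
    and ABC: "A \<subseteq> V" "B \<subseteq> V" "C \<subseteq> V"
    and near: "\<And>\<epsilon>. \<epsilon> > 0 \<Longrightarrow> \<exists>m'\<in>bayes_nets V E X d. tv_circ V E X d m m' < \<epsilon> \<and>
      tv_circ V E X d m' m < \<epsilon> \<and> cond_indep X d (dist_map V E X d m') A B C"
  shows "cond_indep X d (dist_map V E X d m) A B C"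
proof -
  note P = prob_space_dist_map[OF dag m] sets_dist_map[OF dag m]
  have Y: "(\<lambda>x. restrict x C) \<in> dist_map V E X d m \<rightarrow>\<^sub>M coord_space X d C"
    using measurable_restrict_coord[OF ABC(3)] P(2) by (simp cong: measurable_cong_sets)
  have "ci_events (dist_map V E X d m) (coord_space X d C) (\<lambda>x. restrict x C)
    (coord_event (dist_map V E X d m) A S) (coord_event (dist_map V E X d m) B T)"
    if S: "S \<in> sets (coord_space X d A)" and T: "T \<in> sets (coord_space X d B)" for S T
  proof (rule ci_events_tv_closed[OF P(1) Y coord_event_sets[OF P(2) ABC(1) S] coord_event_sets[OF P(2) ABC(2) T]])
    fix \<epsilon> :: real assume "0 < \<epsilon>"
    from near[OF this] obtain m' where m': "m' \<in> bayes_nets V E X d"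
      and tv: "tv_circ V E X d m m' < \<epsilon>" "tv_circ V E X d m' m < \<epsilon>"
      and ci: "cond_indep X d (dist_map V E X d m') A B C" by blast
    note P' = prob_space_dist_map[OF dag m'] sets_dist_map[OF dag m']
    have sp: "space (dist_map V E X d m') = space (dist_map V E X d m)"
      using P(2) P'(2) by (intro sets_eq_imp_space_eq) simp
    have "\<bar>measure (dist_map V E X d m) S - measure (dist_map V E X d m') S\<bar> \<le> \<epsilon>"
      if "S \<in> sets (dist_map V E X d m)" for S
      using measure_dist_map_le[OF dag ne m m', of S] measure_dist_map_le[OF dag ne m' m, of S] that tv P(2)
      by (simp add: abs_le_iff)
    \<comment> \<open>Both laws have the same underlying space, so \<open>coord_event\<close> is the
      same set for both.\<close>
    moreover have "ci_events (dist_map V E X d m') (coord_space X d C) (\<lambda>x. restrict x C)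
        (coord_event (dist_map V E X d m) A S) (coord_event (dist_map V E X d m) B T)"
      using ci S T unfolding cond_indep_iff_ci_events[OF P' ABC] by (simp add: coord_event_def sp)
    ultimately show "\<exists>Q. prob_space Q \<and> sets Q = sets (dist_map V E X d m) \<and>
      (\<forall>S\<in>sets (dist_map V E X d m). \<bar>measure (dist_map V E X d m) S - measure Q S\<bar> \<le> \<epsilon>) \<and>
      ci_events Q (coord_space X d C) (\<lambda>x. restrict x C)
        (coord_event (dist_map V E X d m) A S) (coord_event (dist_map V E X d m) B T)"
      using P P' by (intro exI[of _ "dist_map V E X d m'"]) simp
  qed
  then show ?thesis using cond_indep_iff_ci_events[OF P ABC] by blast
qed

section \<open>Convexity of the class of equicontinuous and bounded networks\<close>

text \<open>Since \<omega> tends to 0 at 0, superlevel sets are open. This supplies the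
  measurability of the densities in \<open>eqb_nets\<close>, whose definition states only bounds and
  a modulus.\<close>

lemma modulus_borel_measurable:
  assumes M: "Metric_space M \<delta>" and mod: "concave_modulus \<omega>"
    and f: "\<And>x x'. x \<in> M \<Longrightarrow> x' \<in> M \<Longrightarrow> \<bar>f x - f x'\<bar> \<le> \<omega> (\<delta> x x')"
  shows "f \<in> borel_measurable (metric_borel M \<delta>)"
proof (rule borel_measurableI_greater)
  interpret Metric_space M \<delta> by fact
  have w0: "\<omega> 0 = 0" and lim: "(\<omega> \<longlongrightarrow> 0) (at_right 0)" using mod unfolding concave_modulus_def by blast+
  fix a :: real
  have "openin mtopology {x \<in> M. a < f x}"
    unfolding openin_mtopology
  proof (intro conjI allI impI)
    fix x assume x: "x \<in> {x \<in> M. a < f x}"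
    have "eventually (\<lambda>t. \<omega> t < f x - a) (at_right 0)"
      using x by (intro order_tendstoD(2)[OF lim]) simp
    then obtain b where b: "b > 0" "\<And>t. 0 < t \<Longrightarrow> t < b \<Longrightarrow> \<omega> t < f x - a"
      unfolding eventually_at_right_field by blast
    have "mball x b \<subseteq> {x \<in> M. a < f x}"
    proof
      fix y assume y: "y \<in> mball x b"
      then have "\<omega> (\<delta> x y) < f x - a"
        using b(2)[of "\<delta> x y"] w0 x by (cases "\<delta> x y = 0") (simp_all add: order_less_le)
      moreover have "\<bar>f x - f y\<bar> \<le> \<omega> (\<delta> x y)" using f[of x y] y by simp
      ultimately show "y \<in> {x \<in> M. a < f x}" using y by auto
    qed
    then show "\<exists>r>0. mball x r \<subseteq> {x \<in> M. a < f x}" using b by blast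
  qed blast
  then show "{x \<in> space (metric_borel M \<delta>). a < f x} \<in> sets (metric_borel M \<delta>)"
    by (simp add: open_in_metric_borel M)
qed

text \<open>The densities are mixed pointwise; the bounds 0 and \<open>K\<close> and the modulus
  \<omega> are convex conditions and persist. The formula for integrals is the only trace of the
  densities in the rest of the argument.\<close>

lemma eqb_nets_mixture:
  assumes dag: "dag V E" and Pol: "\<And>v. v \<in> V \<Longrightarrow> polish_nontrivial (X v) (d v)"
    and mod: "concave_modulus \<omega>"
    and loc: "\<And>v. v \<in> V \<Longrightarrow> locally_finite_measure (X v) (d v) (\<mu> v)"
    and m0: "m0 \<in> eqb_nets V E X d K \<omega> \<mu>" and m1: "m1 \<in> eqb_nets V E X d K \<omega> \<mu>"
  shows "\<exists>mt. \<forall>t\<in>{0..1}. mt t \<in> eqb_nets V E X d K \<omega> \<mu> \<and>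
    (\<forall>v\<in>V. \<forall>y\<in>PiE (parents E v) X. \<forall>h\<in>borel_measurable (metric_borel (X v) (d v)).
      (\<integral>\<^sup>+a. h a \<partial>mt t v y) = ennreal (1 - t) * (\<integral>\<^sup>+a. h a \<partial>m0 v y) + ennreal t * (\<integral>\<^sup>+a. h a \<partial>m1 v y))"
proof -
  define Y where "Y v = PiE (parents E v) X" for v
  define \<rho> where "\<rho> v = prod_dist (d v) (euclid_dist d (parents E v))" for v
  define is_dens where "is_dens m v p \<longleftrightarrow>
     (\<forall>y\<in>Y v. m v y = density (\<mu> v) (\<lambda>x. ennreal (p x y))) \<and>
     (\<forall>x\<in>X v. \<forall>y\<in>Y v. 0 \<le> p x y \<and> p x y \<le> K) \<and>
     (\<forall>x\<in>X v. \<forall>x'\<in>X v. \<forall>y\<in>Y v. \<forall>y'\<in>Y v. \<bar>p x y - p x' y'\<bar> \<le> \<omega> (\<rho> v (x, y) (x', y')))"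
    for m :: "'a \<Rightarrow> ('a \<Rightarrow> 'b) \<Rightarrow> 'b measure" and v p
  have eqb: "m \<in> eqb_nets V E X d K \<omega> \<mu> \<longleftrightarrow> m \<in> bayes_nets V E X d \<and> (\<forall>v\<in>V. \<exists>p. is_dens m v p)" for m
    unfolding eqb_nets_def is_dens_def Y_def \<rho>_def by blast
  obtain p0 where p0: "\<And>v. v \<in> V \<Longrightarrow> is_dens m0 v (p0 v)" using m0 unfolding eqb by metis
  obtain p1 where p1: "\<And>v. v \<in> V \<Longrightarrow> is_dens m1 v (p1 v)" using m1 unfolding eqb by metis
  have bn: "m0 \<in> bayes_nets V E X d" "m1 \<in> bayes_nets V E X d" using m0 m1 unfolding eqb by auto
  have pV: "parents E v \<subseteq> V" for v using dag by (auto simp: dag_def parents_def)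
  have met: "Metric_space (X v) (d v)" if "v \<in> V" for v using Pol[OF that] by (simp add: polish_nontrivial_def)
  have s\<mu>: "sets (\<mu> v) = sets (metric_borel (X v) (d v))" if "v \<in> V" for v
    using loc[OF that] by (simp add: locally_finite_measure_def)
  then have sp\<mu>: "space (\<mu> v) = X v" if "v \<in> V" for v
    using that by (metis sets_eq_imp_space_eq space_metric_borel)
  \<comment> \<open>With the parent configuration fixed, the product distance reduces to
    \<open>d v\<close>, so each section of a density has the modulus \<omega> on
    \<open>X v\<close>.\<close>
  have euclid0: "euclid_dist d (parents E v) y y = 0" if "y \<in> Y v" for v y
  proof -
    have "d w (y w) (y w) = 0" if "w \<in> parents E v" for w
      using that \<open>y \<in> Y v\<close> pV[of v] Metric_space.zero[OF met[of w], of "y w" "y w"] by (auto simp: Y_def)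
    then show ?thesis by (simp add: euclid_dist_def)
  qed
  have meas: "(\<lambda>x. p x y) \<in> borel_measurable (metric_borel (X v) (d v))"
    if v: "v \<in> V" and dens: "is_dens m v p" and y: "y \<in> Y v" for m v p y
  proof (rule modulus_borel_measurable[OF met[OF v] mod])
    fix x x' assume x: "x \<in> X v" "x' \<in> X v"
    have "\<rho> v (x, y) (x', y) = d v x x'"
      using euclid0[OF y] Metric_space.nonneg[OF met[OF v]] by (simp add: \<rho>_def prod_dist_def)
    then show "\<bar>p x y - p x' y\<bar> \<le> \<omega> (d v x x')" using dens x y unfolding is_dens_def by metis
  qed
  define pt where "pt t v x y = (1 - t) * p0 v x y + t * p1 v x y" for t v x y
  \<comment> \<open>Restricting to \<open>V\<close> and to \<open>Y v\<close> makes the family and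
    its kernels extensional, as \<open>bayes_nets\<close> requires.\<close>
  define mt where "mt t = (\<lambda>v\<in>V. \<lambda>y\<in>Y v. density (\<mu> v) (\<lambda>x. ennreal (pt t v x y)))" for t
  have mix: "(\<integral>\<^sup>+a. h a \<partial>mt t v y) = ennreal (1 - t) * (\<integral>\<^sup>+a. h a \<partial>m0 v y) + ennreal t * (\<integral>\<^sup>+a. h a \<partial>m1 v y)"
    if t: "t \<in> {0..1}" and v: "v \<in> V" and y: "y \<in> Y v" and h: "h \<in> borel_measurable (metric_borel (X v) (d v))"
    for t v y h
  proof -
    note [measurable_cong] = s\<mu>[OF v]
    note [measurable] = meas[OF v p0[OF v] y] meas[OF v p1[OF v] y] h
    have m: "m0 v y = density (\<mu> v) (\<lambda>x. ennreal (p0 v x y))" "m1 v y = density (\<mu> v) (\<lambda>x. ennreal (p1 v x y))"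
      using p0[OF v] p1[OF v] y by (auto simp: is_dens_def)
    have "(\<integral>\<^sup>+a. h a \<partial>mt t v y) = (\<integral>\<^sup>+x. ennreal (pt t v x y) * h x \<partial>\<mu> v)"
      using v y by (simp add: mt_def pt_def nn_integral_density)
    also have "\<dots> = (\<integral>\<^sup>+x. ennreal (1 - t) * (ennreal (p0 v x y) * h x) + ennreal t * (ennreal (p1 v x y) * h x) \<partial>\<mu> v)"
    proof (rule nn_integral_cong)
      fix x assume "x \<in> space (\<mu> v)"
      then have "0 \<le> p0 v x y" "0 \<le> p1 v x y"
        using p0[OF v] p1[OF v] y sp\<mu>[OF v] by (auto simp: is_dens_def)
      then have "ennreal (pt t v x y) = ennreal (1 - t) * ennreal (p0 v x y) + ennreal t * ennreal (p1 v x y)"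
        using t by (simp add: pt_def ennreal_mult[symmetric])
      then show "ennreal (pt t v x y) * h x =
        ennreal (1 - t) * (ennreal (p0 v x y) * h x) + ennreal t * (ennreal (p1 v x y) * h x)"
        by (simp add: distrib_right mult.assoc)
    qed
    also have "\<dots> = ennreal (1 - t) * (\<integral>\<^sup>+a. h a \<partial>m0 v y) + ennreal t * (\<integral>\<^sup>+a. h a \<partial>m1 v y)"
      by (simp add: nn_integral_add nn_integral_cmult nn_integral_density m)
    finally show ?thesis .
  qed
  have "mt t \<in> eqb_nets V E X d K \<omega> \<mu>" if t: "t \<in> {0..1}" for t
    unfolding eqb
  proof (intro conjI ballI)
    have "mt t v \<in> coord_space X d (parents E v) \<rightarrow>\<^sub>M prob_algebra (metric_borel (X v) (d v))" if v: "v \<in> V" for v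
    proof -
      have sets: "sets (mt t v y) = sets (metric_borel (X v) (d v))" if "y \<in> Y v" for y
        using that v s\<mu>[OF v] by (simp add: mt_def)
      have em: "emeasure (mt t v y) S = ennreal (1 - t) * emeasure (m0 v y) S + ennreal t * emeasure (m1 v y) S"
        if y: "y \<in> Y v" and S: "S \<in> sets (metric_borel (X v) (d v))" for y S
        using mix[OF t v y, of "indicator S"] S sets[OF y]
          bayes_nets_kernel(2)[OF bn(1) v y[unfolded Y_def]] bayes_nets_kernel(2)[OF bn(2) v y[unfolded Y_def]]
        by simp
      have prob: "prob_space (mt t v y)" if y: "y \<in> Y v" for y
      proof (rule prob_spaceI)
        interpret A: prob_space "m0 v y" by (rule bayes_nets_kernel(1)[OF bn(1) v y[unfolded Y_def]])
        interpret B: prob_space "m1 v y" by (rule bayes_nets_kernel(1)[OF bn(2) v y[unfolded Y_def]])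
        have sp: "space (mt t v y) = X v" "space (m0 v y) = X v" "space (m1 v y) = X v"
          using sets_eq_imp_space_eq[OF sets[OF y]]
            sets_eq_imp_space_eq[OF bayes_nets_kernel(2)[OF bn(1) v y[unfolded Y_def]]]
            sets_eq_imp_space_eq[OF bayes_nets_kernel(2)[OF bn(2) v y[unfolded Y_def]]] by simp_all
        have "X v \<in> sets (metric_borel (X v) (d v))" using sets.top[of "metric_borel (X v) (d v)"] by simp
        from em[OF y this] show "emeasure (mt t v y) (space (mt t v y)) = 1"
          using A.emeasure_space_1 B.emeasure_space_1 t by (simp add: sp flip: ennreal_plus)
      qed
      show ?thesis
      proof (rule measurable_prob_algebraI[OF _ measurable_subprob_algebra])
        fix y assume "y \<in> space (coord_space X d (parents E v))"
        then have y: "y \<in> Y v" by (simp add: space_coord_space Y_def)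
        show "prob_space (mt t v y)" by (rule prob[OF y])
        then show "subprob_space (mt t v y)" by (rule prob_space_imp_subprob_space)
        show "sets (mt t v y) = sets (metric_borel (X v) (d v))" by (rule sets[OF y])
      next
        fix S assume S: "S \<in> sets (metric_borel (X v) (d v))"
        \<comment> \<open>Measurability in the parent configuration is inherited from the kernels of
          \<open>m0\<close> and \<open>m1\<close>, whose probabilities are combined linearly by
          \<open>em\<close>.\<close>
        have k: "(\<lambda>y. emeasure (m v y) S) \<in> borel_measurable (coord_space X d (parents E v))"
          if "m \<in> bayes_nets V E X d" for m
          by (rule measurable_compose[OF measurable_prob_algebraD[OF bayes_nets_measurable[OF that v]]
                measurable_emeasure_subprob_algebra[OF S]])
        have "(\<lambda>y. ennreal (1 - t) * emeasure (m0 v y) S + ennreal t * emeasure (m1 v y) S)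
            \<in> borel_measurable (coord_space X d (parents E v))"
          using k[OF bn(1)] k[OF bn(2)] by simp
        then show "(\<lambda>y. emeasure (mt t v y) S) \<in> borel_measurable (coord_space X d (parents E v))"
          by (rule measurable_cong[THEN iffD2, rotated]) (simp add: em S space_coord_space Y_def)
      qed
    qed
    then show "mt t \<in> bayes_nets V E X d"
      unfolding bayes_nets_def by (auto simp: PiE_iff mt_def Y_def)
    fix v assume v: "v \<in> V"
    have "is_dens (mt t) v (pt t v)"
      unfolding is_dens_def
    proof (intro conjI ballI)
      show "mt t v y = density (\<mu> v) (\<lambda>x. ennreal (pt t v x y))" if "y \<in> Y v" for y
        using that v by (simp add: mt_def)
      fix x y assume xy: "x \<in> X v" "y \<in> Y v"
      have b0: "0 \<le> p0 v x y" "p0 v x y \<le> K" and b1: "0 \<le> p1 v x y" "p1 v x y \<le> K"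
        using p0[OF v] p1[OF v] xy by (auto simp: is_dens_def)
      show "0 \<le> pt t v x y" using b0 b1 t by (simp add: pt_def)
      show "pt t v x y \<le> K" unfolding pt_def using b0 b1 t by (intro convex_bound_le) auto
    next
      fix x x' y y' assume xy: "x \<in> X v" "x' \<in> X v" "y \<in> Y v" "y' \<in> Y v"
      let ?w = "\<omega> (\<rho> v (x, y) (x', y'))"
      have b: "\<bar>p0 v x y - p0 v x' y'\<bar> \<le> ?w" "\<bar>p1 v x y - p1 v x' y'\<bar> \<le> ?w"
        using p0[OF v] p1[OF v] xy unfolding is_dens_def by blast+
      have "\<bar>pt t v x y - pt t v x' y'\<bar> =
          \<bar>(1 - t) * (p0 v x y - p0 v x' y') + t * (p1 v x y - p1 v x' y')\<bar>"
        by (simp add: pt_def algebra_simps)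
      also have "\<dots> \<le> (1 - t) * \<bar>p0 v x y - p0 v x' y'\<bar> + t * \<bar>p1 v x y - p1 v x' y'\<bar>"
        using t by (intro order_trans[OF abs_triangle_ineq]) (simp add: abs_mult)
      also have "\<dots> \<le> ?w" using b t by (intro convex_bound_le) auto
      finally show "\<bar>pt t v x y - pt t v x' y'\<bar> \<le> ?w" .
    qed
    then show "\<exists>p. is_dens (mt t) v p" by blast
  qed
  with mix show ?thesis by (intro exI[of _ mt]) (auto simp: Y_def)
qed


text \<open>For each pair of events, the times at which the pair is independent include the
  infinitely many times of the hypothesis, so the polynomial argument can be applied to every pair
  separately.\<close>

lemma cond_indep_of_infinitely_many_mixtures:
  assumes dag: "dag V E"
    and m0: "m0 \<in> bayes_nets V E X d" and m1: "m1 \<in> bayes_nets V E X d"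
    and mt: "\<And>t. t \<in> {0..1} \<Longrightarrow> mt t \<in> bayes_nets V E X d"
    and mix: "\<And>t v y h. t \<in> {0..1} \<Longrightarrow> v \<in> V \<Longrightarrow> y \<in> PiE (parents E v) X \<Longrightarrow>
      h \<in> borel_measurable (metric_borel (X v) (d v)) \<Longrightarrow>
      (\<integral>\<^sup>+a. h a \<partial>mt t v y) = ennreal (1 - t) * (\<integral>\<^sup>+a. h a \<partial>m0 v y) + ennreal t * (\<integral>\<^sup>+a. h a \<partial>m1 v y)"
    and ABC: "A \<subseteq> V" "B \<subseteq> V" "C \<subseteq> V"
    and inf: "infinite {t \<in> {0..1}. cond_indep X d (dist_map V E X d (mt t)) A B C}"
    and t1: "t1 \<in> {0..1}"
  shows "cond_indep X d (dist_map V E X d (mt t1)) A B C"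
proof -
  obtain vs where vs: "set vs = V" "rev_topological E vs" "\<And>m. dist_map V E X d m = kernel_product E X d m vs"
    using dist_map_eq[OF dag] by blast
  let ?P = "\<lambda>t. dist_map V E X d (mt t)" and ?N = "coord_space X d V" and ?Y = "\<lambda>x. restrict x C"
  note P = prob_space_dist_map[OF dag mt] sets_dist_map[OF dag mt]
  have sp: "space (?P t) = PiE V X" if "t \<in> {0..1}" for t
    using sets_eq_imp_space_eq[OF P(2)[OF that]] by (simp add: space_coord_space)
  have "\<exists>L :: (real poly \<times> ('a \<Rightarrow> 'b) measure) list.
    (\<forall>p\<in>set L. prob_space (snd p) \<and> sets (snd p) = sets (coord_space X d (set vs)) \<and>
       (\<forall>t\<in>{0..1}. 0 \<le> poly (fst p) t) \<and> 0 < poly (fst p) (1 / 2)) \<and>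
    (\<forall>t\<in>{0..1}. \<forall>h\<in>borel_measurable (coord_space X d (set vs)).
       (\<integral>\<^sup>+x. h x \<partial>kernel_product E X d (mt t) vs) =
       (\<Sum>p\<leftarrow>L. ennreal (poly (fst p) t) * (\<integral>\<^sup>+x. h x \<partial>snd p)))"
    using mix bayes_nets_measurable[OF m0] bayes_nets_measurable[OF m1] bayes_nets_measurable[OF mt]
    by (intro kernel_product_mixture[OF vs(2)]) (simp_all only: vs(1))
  then obtain L :: "(real poly \<times> ('a \<Rightarrow> 'b) measure) list" where
    props: "\<forall>p\<in>set L. prob_space (snd p) \<and> sets (snd p) = sets ?N \<and>
       (\<forall>t\<in>{0..1}. 0 \<le> poly (fst p) t) \<and> 0 < poly (fst p) (1 / 2)"
    and eq: "\<forall>t\<in>{0..1}. \<forall>h\<in>borel_measurable ?N.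
       (\<integral>\<^sup>+x. h x \<partial>?P t) = (\<Sum>p\<leftarrow>L. ennreal (poly (fst p) t) * (\<integral>\<^sup>+x. h x \<partial>snd p))"
    unfolding vs(1,3) by (elim exE conjE)
  have L: "\<And>p. p \<in> set L \<Longrightarrow> prob_space (snd p)" "\<And>p. p \<in> set L \<Longrightarrow> sets (snd p) = sets ?N"
      "\<And>p t. p \<in> set L \<Longrightarrow> t \<in> {0..1} \<Longrightarrow> 0 \<le> poly (fst p) t" "\<And>p. p \<in> set L \<Longrightarrow> 0 < poly (fst p) (1 / 2)"
    using props by blast+
  \<comment> \<open>All these laws live on one space, so the events can be written without
    \<open>t\<close>; the polynomial argument requires them to be fixed.\<close>
  define ev where "ev D S = {x \<in> PiE V X. restrict x D \<in> S}" for D S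
  have ev: "coord_event (?P t) D S = ev D S" if "t \<in> {0..1}" for t D S
    by (simp add: coord_event_def ev_def sp[OF that])
  have evs: "ev D S \<in> sets ?N" if "D \<subseteq> V" "S \<in> sets (coord_space X d D)" for D S
    using coord_event_sets[OF refl that] by (simp add: coord_event_def ev_def space_coord_space)
  have iff: "cond_indep X d (?P t) A B C \<longleftrightarrow> (\<forall>S\<in>sets (coord_space X d A). \<forall>T\<in>sets (coord_space X d B).
      ci_events (?P t) (coord_space X d C) ?Y (ev A S) (ev B T))" if "t \<in> {0..1}" for t
    using cond_indep_iff_ci_events[OF P[OF that] ABC] by (simp add: ev[OF that])
  show ?thesis
    unfolding iff[OF t1]
  proof (intro ballI)
    fix S T assume S: "S \<in> sets (coord_space X d A)" and T: "T \<in> sets (coord_space X d B)"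
    have "{t \<in> {0..1}. cond_indep X d (?P t) A B C} \<subseteq>
      {t \<in> {0..1}. ci_events (?P t) (coord_space X d C) ?Y (ev A S) (ev B T)}"
      using iff S T by blast
    then have "infinite {t \<in> {0..1}. ci_events (?P t) (coord_space X d C) ?Y (ev A S) (ev B T)}"
      using inf finite_subset by blast
    from ci_events_polynomial[where P = ?P and N = ?N and L = L, OF P L bspec[OF bspec[OF eq]]
        measurable_restrict_coord[OF ABC(3)] evs[OF ABC(1) S] evs[OF ABC(2) T] this t1]
    show "ci_events (?P t1) (coord_space X d C) ?Y (ev A S) (ev B T)" .
  qed
qed

section \<open>Openness and density of the faithful networks\<close>

theorem mainTheorem5:
  fixes V :: "'v set" and E :: "('v \<times> 'v) set"
    and X :: "'v \<Rightarrow> 'a set" and d :: "'v \<Rightarrow> 'a \<Rightarrow> 'a \<Rightarrow> real"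
    and K :: real and \<omega> :: "real \<Rightarrow> real" and \<mu> :: "'v \<Rightarrow> 'a measure"
  assumes "dag V E"
    and "\<And>v. v \<in> V \<Longrightarrow> polish_nontrivial (X v) (d v)"
    and "K > 0"
    and "concave_modulus \<omega>"
    and "\<And>v. v \<in> V \<Longrightarrow> locally_finite_measure (X v) (d v) (\<mu> v)"
    and "\<exists>m\<in>eqb_nets V E X d K \<omega> \<mu>. dist_map V E X d m \<in> faithful_dists V E X d"
  shows "openin (Metric_space.mtopology (eqb_nets V E X d K \<omega> \<mu>) (tv_circ V E X d))
           {m \<in> eqb_nets V E X d K \<omega> \<mu>. dist_map V E X d m \<in> faithful_dists V E X d} \<and>
         Metric_space.mtopology (eqb_nets V E X d K \<omega> \<mu>) (tv_circ V E X d) closure_of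
           {m \<in> eqb_nets V E X d K \<omega> \<mu>. dist_map V E X d m \<in> faithful_dists V E X d}
         = eqb_nets V E X d K \<omega> \<mu>"
proof -
  let ?eqb = "eqb_nets V E X d K \<omega> \<mu>" and ?D = "dist_map V E X d" and ?\<rho> = "tv_circ V E X d"
  let ?F = "{m \<in> ?eqb. ?D m \<in> faithful_dists V E X d}"
  note dag = assms(1) and Pol = assms(2)
  have fin: "finite V" using dag by (simp add: dag_def)
  have ne: "X v \<noteq> {}" if "v \<in> V" for v using Pol[OF that] by (auto simp: polish_nontrivial_def)
  have sub: "?eqb \<subseteq> bayes_nets V E X d" by (auto simp: eqb_nets_def)
  interpret B: Metric_space "bayes_nets V E X d" ?\<rho> by (rule Metric_space_bayes_nets[OF dag Pol])
  interpret N: Metric_space ?eqb ?\<rho> by (rule B.subspace[OF sub])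
  \<comment> \<open>The d-connected triples. As the law of a network is Markov, the network is
    faithful exactly when none of these triples is conditionally independent.\<close>
  define I where "I = {(A, B, C). A \<subseteq> V \<and> B \<subseteq> V \<and> C \<subseteq> V \<and> \<not> d_separated V E A B C}"
  define ci where "ci m = (\<lambda>(A, B, C). cond_indep X d (?D m) A B C)" for m
  have "I \<subseteq> Pow V \<times> Pow V \<times> Pow V" by (auto simp: I_def)
  then have finI: "finite I" using fin by (meson finite_Pow_iff finite_SigmaI finite_subset)
  have faithful: "?D m \<in> faithful_dists V E X d \<longleftrightarrow> (\<forall>i\<in>I. \<not> ci m i)" if "m \<in> ?eqb" for m
    using dist_map_markov[OF dag, of m X d] that sub by (auto simp: faithful_dists_def I_def ci_def)
  \<comment> \<open>If no radius worked, networks arbitrarily close to \<open>m\<close> would have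
    the independence, and by closedness \<open>m\<close> would have it too.\<close>
  have open_ci: "\<exists>r>0. \<forall>m'\<in>?eqb. ?\<rho> m m' < r \<longrightarrow> \<not> ci m' i" if m: "m \<in> ?eqb" and i: "i \<in> I" and nci: "\<not> ci m i" for m i
  proof (rule ccontr)
    assume neg: "\<not> ?thesis"
    obtain A B C where i': "i = (A, B, C)" and ABC: "A \<subseteq> V" "B \<subseteq> V" "C \<subseteq> V" using i by (auto simp: I_def)
    have "cond_indep X d (?D m) A B C"
    proof (rule cond_indep_closed[OF dag ne _ ABC])
      show "m \<in> bayes_nets V E X d" using m sub by blast
      fix \<epsilon> :: real assume "0 < \<epsilon>"
      then obtain m' where "m' \<in> ?eqb" "?\<rho> m m' < \<epsilon>" "ci m' i" using neg by blast
      then show "\<exists>m'\<in>bayes_nets V E X d. ?\<rho> m m' < \<epsilon> \<and> ?\<rho> m' m < \<epsilon> \<and> cond_indep X d (?D m') A B C"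
        using sub by (auto simp: ci_def i' B.commute[of m' m] intro!: bexI[of _ m'])
    qed
    then show False using nci by (simp add: ci_def i')
  qed
  have "openin N.mtopology ?F"
    unfolding N.openin_mtopology
  proof (intro conjI allI impI)
    fix m assume "m \<in> ?F"
    then have m: "m \<in> ?eqb" and nci: "\<And>i. i \<in> I \<Longrightarrow> \<not> ci m i" using faithful by auto
    have "\<forall>i\<in>I. \<exists>r>0. \<forall>m'\<in>?eqb. ?\<rho> m m' < r \<longrightarrow> \<not> ci m' i" using open_ci[OF m _ nci] by blast
    then obtain r where r: "\<And>i. i \<in> I \<Longrightarrow> r i > 0"
      "\<And>i m'. i \<in> I \<Longrightarrow> m' \<in> ?eqb \<Longrightarrow> ?\<rho> m m' < r i \<Longrightarrow> \<not> ci m' i" by metis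
    \<comment> \<open>A radius for all triples at once; the 1 covers the case that \<open>I\<close>
      is empty.\<close>
    define s where "s = Min (insert 1 (r ` I))"
    have s: "s > 0" "\<And>i. i \<in> I \<Longrightarrow> s \<le> r i" using r(1) finI by (auto simp: s_def)
    have "N.mball m s \<subseteq> ?F"
    proof
      fix m' assume m': "m' \<in> N.mball m s"
      then have "\<not> ci m' i" if "i \<in> I" for i using r(2)[OF that, of m'] s(2)[OF that] by auto
      then show "m' \<in> ?F" using faithful m' by auto
    qed
    then show "\<exists>r>0. N.mball m r \<subseteq> ?F" using s(1) by blast
  qed blast
  moreover have "N.mtopology closure_of ?F = ?eqb"
  proof -
    obtain m1 where m1: "m1 \<in> ?eqb" "?D m1 \<in> faithful_dists V E X d" using assms(6) by blast
    have "\<exists>m'\<in>?F. m' \<in> N.mball m r" if m: "m \<in> ?eqb" and r: "r > 0" for m r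
    proof -
      obtain mt where eqb: "\<And>t. t \<in> {0..1} \<Longrightarrow> mt t \<in> ?eqb"
        and mix: "\<And>t v y h. t \<in> {0..1} \<Longrightarrow> v \<in> V \<Longrightarrow> y \<in> PiE (parents E v) X \<Longrightarrow>
          h \<in> borel_measurable (metric_borel (X v) (d v)) \<Longrightarrow>
          (\<integral>\<^sup>+a. h a \<partial>mt t v y) = ennreal (1 - t) * (\<integral>\<^sup>+a. h a \<partial>m v y) + ennreal t * (\<integral>\<^sup>+a. h a \<partial>m1 v y)"
        using eqb_nets_mixture[OF dag Pol assms(4,5) m m1(1)] by metis
      have bn: "m \<in> bayes_nets V E X d" "m1 \<in> bayes_nets V E X d" "\<And>t. t \<in> {0..1} \<Longrightarrow> mt t \<in> bayes_nets V E X d"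
        using m m1(1) eqb sub by blast+
      note ker = bayes_nets_kernel[OF bn(1)] bayes_nets_kernel[OF bn(2)] bayes_nets_kernel[OF bn(3)]
      have meas: "measure (mt t v y) S = (1 - t) * measure (m v y) S + t * measure (m1 v y) S"
        if t: "t \<in> {0..1}" and v: "v \<in> V" and y: "y \<in> PiE (parents E v) X"
          and S: "S \<in> sets (metric_borel (X v) (d v))" for t v y S
      proof -
        interpret M0: prob_space "m v y" by (rule ker(1)[OF v y])
        interpret M1: prob_space "m1 v y" by (rule ker(3)[OF v y])
        interpret Mt: prob_space "mt t v y" by (rule ker(5)[OF t v y])
        have "emeasure (mt t v y) S = ennreal (1 - t) * emeasure (m v y) S + ennreal t * emeasure (m1 v y) S"
          using mix[OF t v y, of "indicator S"] S ker(2)[OF v y] ker(4)[OF v y] ker(6)[OF t v y] by simp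
        also have "\<dots> = ennreal ((1 - t) * measure (m v y) S + t * measure (m1 v y) S)"
          using t by (simp add: M0.emeasure_eq_measure M1.emeasure_eq_measure ennreal_mult)
        finally show ?thesis using t by (simp add: Mt.emeasure_eq_measure del: ennreal_plus)
      qed
      \<comment> \<open>Only the integrals of the interpolation are known here, so
        \<open>mt 1\<close> is identified with \<open>m1\<close> through probabilities of sets and
        extensionality.\<close>
      have "mt 1 v = m1 v" if v: "v \<in> V" for v
      proof (rule extensionalityI[of _ "PiE (parents E v) X"])
        show "mt 1 v \<in> extensional (PiE (parents E v) X)" "m1 v \<in> extensional (PiE (parents E v) X)"
          using bn(2) bn(3)[of 1] v by (auto simp: bayes_nets_def PiE_iff)
        fix y assume y: "y \<in> PiE (parents E v) X"
        have one: "1 \<in> {0..1 :: real}" by simp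
        interpret M1: prob_space "m1 v y" by (rule ker(3)[OF v y])
        interpret Mt: prob_space "mt 1 v y" by (rule ker(5)[OF one v y])
        show "mt 1 v y = m1 v y"
          using meas[OF one v y] ker(4)[OF v y] ker(6)[OF one v y]
          by (intro measure_eqI) (auto simp: M1.emeasure_eq_measure Mt.emeasure_eq_measure)
      qed
      then have mt1: "mt 1 = m1"
        using bn(2) bn(3)[of 1] by (intro extensionalityI[of _ V]) (auto simp: bayes_nets_def PiE_iff)
      \<comment> \<open>The kernels of \<open>m\<close> and \<open>mt t\<close> differ by t times
        the difference of those of \<open>m\<close> and \<open>m1\<close>, so each vertex
        contributes at most t.\<close>
      have dist: "?\<rho> m (mt t) \<le> real (card V) * t" if t: "t \<in> {0..1}" for t
      proof -
        have "(SUP y\<in>PiE (parents E v) X. tv_dist (m v y) (mt t v y)) \<le> t" if v: "v \<in> V" for v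
        proof (rule cSUP_least)
          have "parents E v \<subseteq> V" using dag by (auto simp: dag_def parents_def)
          then show "PiE (parents E v) X \<noteq> {}" using ne by (auto simp: PiE_eq_empty_iff)
          fix y assume y: "y \<in> PiE (parents E v) X"
          interpret M0: prob_space "m v y" by (rule ker(1)[OF v y])
          interpret M1: prob_space "m1 v y" by (rule ker(3)[OF v y])
          show "tv_dist (m v y) (mt t v y) \<le> t"
            unfolding tv_dist_def
          proof (rule cSUP_least)
            fix S assume "S \<in> sets (m v y)"
            then have S: "S \<in> sets (metric_borel (X v) (d v))" using ker(2)[OF v y] by simp
            have "measure (m v y) S - measure (mt t v y) S = t * (measure (m v y) S - measure (m1 v y) S)"
              by (simp add: meas[OF t v y S] algebra_simps)
            then have "\<bar>measure (m v y) S - measure (mt t v y) S\<bar> = t * \<bar>measure (m v y) S - measure (m1 v y) S\<bar>"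
              using t by (simp add: abs_mult)
            also have "\<dots> \<le> t * 1"
            proof (rule mult_left_mono)
              show "\<bar>measure (m v y) S - measure (m1 v y) S\<bar> \<le> 1"
                using M0.prob_le_1[of S] M1.prob_le_1[of S] measure_nonneg[of "m v y" S] measure_nonneg[of "m1 v y" S]
                by linarith
            qed (use t in simp)
            finally show "\<bar>measure (m v y) S - measure (mt t v y) S\<bar> \<le> t" by simp
          qed auto
        qed
        then show ?thesis
          using sum_bounded_above[of V "\<lambda>v. SUP y\<in>PiE (parents E v) X. tv_dist (m v y) (mt t v y)" t] bn(1) bn(3)[OF t]
          by (simp add: tv_circ_def)
      qed
      \<comment> \<open>Infinitely many bad times would force the independence at time 1, that is,
        for the faithful network \<open>m1\<close>.\<close>
      have bad: "finite {t \<in> {0..1}. ci (mt t) i}" if i: "i \<in> I" for i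
      proof (rule ccontr)
        assume inf: "infinite {t \<in> {0..1}. ci (mt t) i}"
        obtain A B C where i': "i = (A, B, C)" and ABC: "A \<subseteq> V" "B \<subseteq> V" "C \<subseteq> V" using i by (auto simp: I_def)
        have inf': "infinite {t \<in> {0..1}. cond_indep X d (?D (mt t)) A B C}"
          using inf by (simp only: ci_def i' case_prod_conv) blast
        have one: "1 \<in> {0..1 :: real}" by simp
        from cond_indep_of_infinitely_many_mixtures[where mt = mt and V = V and E = E, OF dag bn mix ABC inf' one]
        have "cond_indep X d (?D (mt 1)) A B C" .
        then have "ci m1 i" by (simp add: ci_def i' mt1)
        then show False using faithful[OF m1(1)] m1(2) i by blast
      qed
      \<comment> \<open>Positive times below \<open>s\<close> lie in [0,1] and, by
        \<open>dist\<close>, give networks closer than \<open>r\<close> to \<open>m\<close>; the + 1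
        keeps the denominator positive even if \<open>V\<close> is empty. They are infinitely many,
        so some of them avoid the finite set of bad times.\<close>
      define s where "s = min 1 (r / (real (card V) + 1))"
      have s: "0 < s" "s \<le> 1" "s \<le> r / (real (card V) + 1)" using r by (auto simp: s_def)
      have "finite (\<Union>i\<in>I. {t \<in> {0..1}. ci (mt t) i})" using finI bad by blast
      moreover have "infinite {0<..<s}" using s(1) by simp
      ultimately obtain t where t: "t \<in> {0<..<s}" "t \<notin> (\<Union>i\<in>I. {t \<in> {0..1}. ci (mt t) i})"
        by (meson finite_subset subsetI)
      have t01: "t \<in> {0..1}" using t(1) s(2) by simp
      have "?D (mt t) \<in> faithful_dists V E X d" using faithful[OF eqb[OF t01]] t(2) t01 by blast
      moreover have "?\<rho> m (mt t) < r"
      proof -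
        have "t < r / (real (card V) + 1)" using t(1) s(3) by simp
        then have "t * (real (card V) + 1) < r" by (simp add: pos_less_divide_eq)
        moreover have "real (card V) * t \<le> t * (real (card V) + 1)" using t01 by (simp add: algebra_simps)
        ultimately show ?thesis using dist[OF t01] by linarith
      qed
      ultimately show ?thesis using eqb[OF t01] m by (intro bexI[of _ "mt t"]) auto
    qed
    then show ?thesis unfolding N.metric_closure_of by blast
  qed
  ultimately show ?thesis ..
qed

end
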